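(* Let $f\in\mathbb C[x_1,\dots,x_n]$ be nonzero, let $\ell\in\mathbb Z$ and $\omega\in\mathbb R^n\setminus\{0\}$. Then: (i) $\ell\,\mathrm{ord}_f(\omega)$ is a root of $b_{\mathrm{Ann}(f^\ell),\omega}(s)$; (ii) if $\ell\in\mathbb N$, then $b_{\mathrm{Ann}(f^\ell),\omega}(s)=s-\ell\,\mathrm{ord}_f(\omega)$.
   Context: $D_n=\mathbb C[x_1,\dots,x_n,\partial_1,\dots,\partial_n]$ is the $n$-th Weyl algebra ($\partial_ix_j=x_j\partial_i+\delta_{ij}$, all other pairs of generators commute); "ideal" means left ideal. Every $P\in D_n$ has a unique normally ordered expression $P=\sum c_{\alpha\beta}x^\alpha\partial^\beta$ (multi-index notation). For $\omega\in\mathbb R^n$, the $(-\omega,\omega)$-weight of $x^\alpha\partial^\beta$ is $-\langle\omega,\alpha\rangle+\langle\omega,\beta\rangle$; $\mathrm{in}_{(-\omega,\omega)}(P)$ is the sum of the terms of $P$ of maximal weight, and for an ideal $I$, $\mathrm{in}_{(-\omega,\omega)}(I)$ is the left ideal generated by all $\mathrm{in}_{(-\omega,\omega)}(P)$, $P\in I\setminus\{0\}$. For a holonomic ideal $I$ and $\omega\in\mathbb R^n\setminus\{0\}$ put $s=\omega_1x_1\partial_1+\dots+\omega_nx_n\partial_n$; the b-function $b_{I,\omega}(s)$ is the monic generator of the (nonzero) ideal $\mathrm{in}_{(-\omega,\omega)}(I)\cap\mathbb C[s]$ of the polynomial ring $\mathbb C[s]$. Standing assumption: $\mathrm{in}_{(-\omega,\omega)}(I)\neq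 D_n$ for the ideals and weights considered. $D_n$ acts on functions by $x_i\bullet g=x_ig$, $\partial_i\bullet g=\partial g/\partial x_i$ (so $\partial_i\bullet f^\ell=\ell f^{\ell-1}\partial f/\partial x_i$); for nonzero $f\in\mathbb C[x_1,\dots,x_n]$ and $\ell\in\mathbb C$, $\mathrm{Ann}(f^\ell)=\{P\in D_n:P\bullet f^\ell=0\}$, a holonomic ideal; $\mathrm{Ann}(1/f^\ell)$ denotes $\mathrm{Ann}(f^{-\ell})$. For $f=\sum_\gamma c_\gamma x^\gamma$: $\mathrm{Supp}(f)=\{\gamma:c_\gamma\ne0\}$, $\Gamma(f)$ is its convex hull, and $\mathrm{ord}_f(\omega)=\min\{\langle\gamma,\omega\rangle:\gamma\in\Gamma(f)\}$. $\mathbb N=\{0,1,2,\dots\}$. *)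

theory Defs
  imports "HOL-Computational_Algebra.Polynomial"
begin

type_synonym mi = "nat \<Rightarrow> nat"
type_synonym mpoly = "mi \<Rightarrow> complex"   \<comment> \<open>coefficient function, finite support\<close>
type_synonym weyl = "mi \<times> mi \<Rightarrow> complex" \<comment> \<open>normally ordered coefficients c_{alpha beta}\<close>

definition mi_ok :: "nat \<Rightarrow> mi \<Rightarrow> bool" where
  "mi_ok n a \<longleftrightarrow> (\<forall>i\<ge>n. a i = 0)"

definition supp :: "('a \<Rightarrow> complex) \<Rightarrow> 'a set" where
  "supp p = {m. p m \<noteq> 0}"

definition polys :: "nat \<Rightarrow> mpoly set" where
  "polys n = {p. finite (supp p) \<and> (\<forall>g. p g \<noteq> 0 \<longrightarrow> mi_ok n g)}"

definition pone :: mpoly where "pone = (\<lambda>g. if g = (\<lambda>_. 0) then 1 else 0)"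
definition padd :: "mpoly \<Rightarrow> mpoly \<Rightarrow> mpoly" where "padd p q = (\<lambda>g. p g + q g)"
definition psmult :: "complex \<Rightarrow> mpoly \<Rightarrow> mpoly" where "psmult c p = (\<lambda>g. c * p g)"
definition pmult :: "mpoly \<Rightarrow> mpoly \<Rightarrow> mpoly" where
  "pmult p q = (\<lambda>g. \<Sum>a\<in>supp p. \<Sum>b\<in>supp q.
      if (\<lambda>i. a i + b i) = g then p a * q b else 0)"
definition ppow :: "mpoly \<Rightarrow> nat \<Rightarrow> mpoly" where "ppow p k = (pmult p ^^ k) pone"
definition xmono :: "mi \<Rightarrow> mpoly \<Rightarrow> mpoly" where
  "xmono a p = (\<lambda>g. if (\<forall>i. a i \<le> g i) then p (\<lambda>i. g i - a i) else 0)"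
definition pdiff :: "nat \<Rightarrow> mpoly \<Rightarrow> mpoly" where
  "pdiff i p = (\<lambda>g. of_nat (g i + 1) * p (g(i := g i + 1)))"

text \<open>A pair (p,k) stands for the rational function p / f^k.\<close>
definition ldiff :: "mpoly \<Rightarrow> nat \<Rightarrow> mpoly \<times> nat \<Rightarrow> mpoly \<times> nat" where
  "ldiff f i pk = (case pk of (p, k) \<Rightarrow>
     (padd (pmult (pdiff i p) f) (psmult (- of_nat k) (pmult p (pdiff i f))), Suc k))"

definition lder :: "mpoly \<Rightarrow> nat \<Rightarrow> mi \<Rightarrow> mpoly \<times> nat \<Rightarrow> mpoly \<times> nat" where
  "lder f n b g = foldr (\<lambda>i h. (ldiff f i ^^ b i) h) [0..<n] g"

text \<open>numerator of P applied to g = (p,k), written over the common denominator f^D\<close>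
definition act_num :: "nat \<Rightarrow> mpoly \<Rightarrow> weyl \<Rightarrow> mpoly \<times> nat \<Rightarrow> mpoly" where
  "act_num n f P g =
    (let D = snd g + (\<Sum>m\<in>supp P. \<Sum>i<n. snd m i) in
     (\<lambda>c. \<Sum>m\<in>supp P. P m *
        pmult (xmono (fst m) (fst (lder f n (snd m) g)))
              (ppow f (D - snd (lder f n (snd m) g))) c))"

definition fpow :: "mpoly \<Rightarrow> int \<Rightarrow> mpoly \<times> nat" where
  "fpow f l = (if l \<ge> 0 then (ppow f (nat l), 0) else (pone, nat (- l)))"

definition weyl_alg :: "nat \<Rightarrow> weyl set" where
  "weyl_alg n = {P. finite (supp P) \<and> (\<forall>a b. P (a, b) \<noteq> 0 \<longrightarrow> mi_ok n a \<and> mi_ok n b)}"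

definition wzero :: weyl where "wzero = (\<lambda>_. 0)"
definition wone :: weyl where "wone = (\<lambda>m. if m = (\<lambda>_. 0, \<lambda>_. 0) then 1 else 0)"
definition wadd :: "weyl \<Rightarrow> weyl \<Rightarrow> weyl" where "wadd P Q = (\<lambda>m. P m + Q m)"

text \<open>d^b x^c = sum_k prod_i C(b_i,k_i) C(c_i,k_i) k_i! x^(c-k) d^(b-k)\<close>
definition weylc :: "mi \<Rightarrow> mi \<Rightarrow> mi \<Rightarrow> complex" where
  "weylc b c k = (\<Prod>i\<in>{i. k i \<noteq> 0}. of_nat ((b i choose k i) * (c i choose k i) * fact (k i)))"

definition wmult :: "weyl \<Rightarrow> weyl \<Rightarrow> weyl" where
  "wmult P Q = (\<lambda>(mu, nu). \<Sum>m1\<in>supp P. \<Sum>m2\<in>supp Q.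
      \<Sum>k\<in>{k. \<forall>i. k i \<le> min (snd m1 i) (fst m2 i)}.
        if (\<lambda>i. fst m1 i + fst m2 i - k i) = mu \<and> (\<lambda>i. snd m1 i + snd m2 i - k i) = nu
        then P m1 * Q m2 * weylc (snd m1) (fst m2) k else 0)"

definition wpow :: "weyl \<Rightarrow> nat \<Rightarrow> weyl" where "wpow P k = (wmult P ^^ k) wone"

inductive_set lgen :: "nat \<Rightarrow> weyl set \<Rightarrow> weyl set" for n S where
  lgen_zero: "wzero \<in> lgen n S"
| lgen_gen: "s \<in> S \<Longrightarrow> Q \<in> weyl_alg n \<Longrightarrow> wmult Q s \<in> lgen n S"
| lgen_add: "a \<in> lgen n S \<Longrightarrow> b \<in> lgen n S \<Longrightarrow> wadd a b \<in> lgen n S"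

definition Ann :: "nat \<Rightarrow> mpoly \<Rightarrow> int \<Rightarrow> weyl set" where
  "Ann n f l = {P \<in> weyl_alg n. act_num n f P (fpow f l) = (\<lambda>_. 0)}"

definition weight :: "nat \<Rightarrow> (nat \<Rightarrow> real) \<Rightarrow> mi \<times> mi \<Rightarrow> real" where
  "weight n w m = (\<Sum>i<n. w i * (real (snd m i) - real (fst m i)))"

definition in_w :: "nat \<Rightarrow> (nat \<Rightarrow> real) \<Rightarrow> weyl \<Rightarrow> weyl" where
  "in_w n w P = (\<lambda>m. if P m \<noteq> 0 \<and> weight n w m = Max (weight n w ` supp P) then P m else 0)"

definition in_ideal :: "nat \<Rightarrow> (nat \<Rightarrow> real) \<Rightarrow> weyl set \<Rightarrow> weyl set" where
  "in_ideal n w I = lgen n {in_w n w P | P. P \<in> I \<and> P \<noteq> wzero}"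

definition unitv :: "nat \<Rightarrow> mi" where "unitv i = (\<lambda>j. if j = i then 1 else 0)"

definition euler :: "nat \<Rightarrow> (nat \<Rightarrow> real) \<Rightarrow> weyl" where
  "euler n w = (\<lambda>m. \<Sum>i<n. complex_of_real (w i) * (if m = (unitv i, unitv i) then 1 else 0))"

definition weyl_of_poly :: "nat \<Rightarrow> (nat \<Rightarrow> real) \<Rightarrow> complex poly \<Rightarrow> weyl" where
  "weyl_of_poly n w p = (\<lambda>m. \<Sum>k\<le>degree p. coeff p k * wpow (euler n w) k m)"

definition bideal :: "nat \<Rightarrow> (nat \<Rightarrow> real) \<Rightarrow> weyl set \<Rightarrow> complex poly set" where
  "bideal n w I = {p. weyl_of_poly n w p \<in> in_ideal n w I}"

definition bfun :: "nat \<Rightarrow> (nat \<Rightarrow> real) \<Rightarrow> weyl set \<Rightarrow> complex poly" where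
  "bfun n w I = (THE b. lead_coeff b = 1 \<and> (\<forall>p. p \<in> bideal n w I \<longleftrightarrow> b dvd p))"

definition newton :: "mpoly \<Rightarrow> (nat \<Rightarrow> real) set" where
  "newton f = {v. \<exists>t. (\<forall>g\<in>supp f. t g \<ge> 0) \<and> (\<Sum>g\<in>supp f. t g) = (1::real)
                     \<and> v = (\<lambda>i. \<Sum>g\<in>supp f. t g * real (g i))}"

definition ord_f :: "nat \<Rightarrow> mpoly \<Rightarrow> (nat \<Rightarrow> real) \<Rightarrow> real" where
  "ord_f n f w = Inf ((\<lambda>v. \<Sum>i<n. v i * w i) ` newton f)"

end

theory Submission
  imports Defs "HOL-Library.FuncSet" "HOL-Library.Poly_Mapping" "HOL-Computational_Algebra.Fraction_Field"
begin

text \<open>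
  The Weyl algebra is represented faithfully by differential operators on the field of rational
  functions, so that \<open>Ann (f\<^sup>l)\<close> is an honest annihilator.

  If \<open>P\<close> kills \<open>f\<^sup>l\<close>, then the initial form of \<open>P\<close> kills \<open>f\<^sub>0\<^sup>l\<close>, where \<open>f\<^sub>0\<close> is the part of \<open>f\<close> of lowest
  weight. Hence the initial ideal kills \<open>f\<^sub>0\<^sup>l\<close>, on which the Euler operator \<open>s\<close> acts as the scalar
  \<open>l ord\<^sub>f(\<omega>)\<close>, and every polynomial in \<open>s\<close> in the initial ideal vanishes there.

  For \<open>l \<ge> 0\<close> put \<open>g = f\<^sup>l\<close>, and let \<open>x\<^sup>\<alpha>\<close> be a monomial of lowest weight \<open>c\<close> of \<open>g\<close>. An operator of weight \<open>c\<close>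
  maps \<open>g\<close> to its coefficient at \<open>\<alpha>\<close>, and correcting \<open>s - c\<close> by multiples of it with monomials of higher
  weight gives an annihilator of \<open>g\<close> with initial form \<open>s - c\<close>.

  For \<open>l < 0\<close> it remains to see that the initial ideal contains some nonzero polynomial in \<open>s\<close>, that is,
  the relevant consequence of holonomicity. Monomials independent modulo the initial ideal are
  independent modulo \<open>Ann (f\<^sup>l)\<close>, so the quotient by the initial ideal grows like \<open>N\<^sup>n\<close>. Right
  multiplication by \<open>s\<close> acts on this quotient, and if it were transcendental there, then the Weyl algebra
  with coefficients in the polynomials in \<open>s\<close>, which grows like \<open>N\<close> to the \<open>2n + 1\<close>, would act faithfully on it, as in the
  proof of Bernstein's inequality. This is more than the \<open>N\<close> to the \<open>2n\<close> that the endomorphisms allow.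
\<close>

section \<open>Derivations of a fraction field\<close>

text \<open>\<open>bfun\<close> is a definite description, so nothing can be said about its roots
  before some nonzero polynomial in the Euler operator is known to lie in the initial ideal. For
  negative \<open>l\<close> this existence is the hard part, since \<open>f ^ l\<close> is then no
  polynomial from which a coefficient could be extracted. A field gives 1 / f^k a place to live, and
  its additive endomorphisms form a ring, so associativity need not be derived from the formula for
  \<open>wmult\<close>. The initial ideal is only a left ideal. Right multiplication by the Euler
  operator still descends to the quotient because the generators are homogeneous, that is, their
  commutator with it is a scalar multiple of themselves. Multiplying on the right also makes it
  commute with the left action of the algebra, so that polynomials in \<open>s\<close> can serve as
  central coefficients in Bernstein's argument.\<close>

definition derivation :: "('a::comm_ring_1 \<Rightarrow> 'a) \<Rightarrow> bool" where
  "derivation d \<longleftrightarrow> (\<forall>u v. d (u + v) = d u + d v) \<and> (\<forall>u v. d (u * v) = d u * v + u * d v)"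

lemma derivationD:
  assumes "derivation d"
  shows "d (u + v) = d u + d v" "d (u * v) = d u * v + u * d v" "d 0 = 0" "d 1 = 0"
    "d (- u) = - d u" "d (u - v) = d u - d v"
proof -
  show add: "d (u + v) = d u + d v" for u v using assms by (simp add: derivation_def)
  show mul: "d (u * v) = d u * v + u * d v" for u v using assms by (simp add: derivation_def)
  show z: "d 0 = 0" using add[of 0 0] by simp
  show "d 1 = 0" using mul[of 1 1] by simp
  show um: "d (- u) = - d u" for u using add[of u "- u"] z by (simp add: add_eq_0_iff)
  show "d (u - v) = d u - d v" using add[of u "- v"] um by simp
qed

definition fract_deriv :: "('a::idom \<Rightarrow> 'a) \<Rightarrow> 'a fract \<Rightarrow> 'a fract" where
  "fract_deriv d u = (THE v. \<exists>p q. q \<noteq> 0 \<and> u = Fract p q \<and> v = Fract (d p * q - p * d q) (q * q))"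

text \<open>Independence of the representation: differentiating p q' = p' q and multiplying by q q'
  turns one quotient-rule numerator into the other, up to a multiple of p q' - p' q.\<close>

lemma fract_deriv_Fract:
  assumes d: "derivation d" and q: "q \<noteq> 0"
  shows "fract_deriv d (Fract p q) = Fract (d p * q - p * d q) (q * q)"
  unfolding fract_deriv_def
proof (rule the_equality)
  show "\<exists>p' q'. q' \<noteq> 0 \<and> Fract p q = Fract p' q' \<and>
      Fract (d p * q - p * d q) (q * q) = Fract (d p' * q' - p' * d q') (q' * q')"
    using q by blast
next
  fix v
  assume "\<exists>p' q'. q' \<noteq> 0 \<and> Fract p q = Fract p' q' \<and> v = Fract (d p' * q' - p' * d q') (q' * q')"
  then obtain p' q' where q': "q' \<noteq> 0" and eq: "Fract p q = Fract p' q'"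
    and v: "v = Fract (d p' * q' - p' * d q') (q' * q')" by blast
  from eq q q' have e: "p * q' = p' * q" by (simp add: eq_fract)
  hence "d (p * q') = d (p' * q)" by simp
  hence de: "d p * q' + p * d q' = d p' * q + p' * d q" by (simp add: derivationD(2)[OF d])
  have "(d p' * q' - p' * d q') * (q * q) = (d p * q - p * d q) * (q' * q')"
  proof -
    have "(d p' * q' - p' * d q') * (q * q) = (d p' * q) * (q' * q) - (p' * q) * d q' * q"
      by (simp add: algebra_simps)
    also have "\<dots> = (d p * q' + p * d q' - p' * d q) * (q' * q) - (p * q') * d q' * q"
      using de e by (simp add: algebra_simps)
    also have "\<dots> = (d p * q - p * d q) * (q' * q') + (p * q' - p' * q) * (d q * q')"
      by (simp add: algebra_simps)
    finally show ?thesis using e by simp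
  qed
  thus "v = Fract (d p * q - p * d q) (q * q)" using v q q' by (simp add: eq_fract)
qed

lemma derivation_fract_deriv:
  assumes d: "derivation d"
  shows "derivation (fract_deriv d)"
  unfolding derivation_def
proof (intro conjI allI)
  fix u v :: "'a fract"
  obtain p q where u: "u = Fract p q" "q \<noteq> 0" by (cases u) auto
  obtain p' q' where v: "v = Fract p' q'" "q' \<noteq> 0" by (cases v) auto
  show "fract_deriv d (u + v) = fract_deriv d u + fract_deriv d v"
    using u v by (simp add: fract_deriv_Fract[OF d] derivationD[OF d] eq_fract algebra_simps)
  show "fract_deriv d (u * v) = fract_deriv d u * v + u * fract_deriv d v"
    using u v by (simp add: fract_deriv_Fract[OF d] derivationD[OF d] eq_fract algebra_simps)
qed

lemma fract_deriv_of_Fract1: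
  "derivation d \<Longrightarrow> fract_deriv d (Fract p 1) = Fract (d p) 1"
  by (simp add: fract_deriv_Fract derivationD)

text \<open>The commutator of two derivations is a derivation, and it vanishes on numerators and denominators.\<close>

lemma fract_deriv_commute:
  assumes d: "derivation d" and e: "derivation e" and c: "\<And>p. d (e p) = e (d p)"
  shows "fract_deriv d (fract_deriv e u) = fract_deriv e (fract_deriv d u)"
proof -
  obtain p q where u: "u = Fract p q" "q \<noteq> 0" by (cases u) auto
  let ?D = "fract_deriv d" and ?E = "fract_deriv e" and ?q = "Fract q 1"
  note D = derivationD[OF derivation_fract_deriv[OF d]] and E = derivationD[OF derivation_fract_deriv[OF e]]
  have uq: "u * ?q = Fract p 1" using u by (simp add: eq_fract)
  have q0: "?q \<noteq> 0" using u by (simp add: Zero_fract_def eq_fract)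
  have "?D (?E (u * ?q)) = ?E (?D (u * ?q))" "?D (?E ?q) = ?E (?D ?q)"
    unfolding uq by (simp_all add: fract_deriv_of_Fract1 d e c)
  hence "?D (?E u) * ?q = ?E (?D u) * ?q"
    by (simp add: D E algebra_simps)
  thus ?thesis using q0 by simp
qed

section \<open>Partial derivatives of polynomials\<close>

type_synonym mvpoly = "(nat \<Rightarrow>\<^sub>0 nat) \<Rightarrow>\<^sub>0 complex"

lift_definition mv_deriv :: "nat \<Rightarrow> mvpoly \<Rightarrow> mvpoly" is
  "\<lambda>i p g. of_nat (Poly_Mapping.lookup g i + 1) * p (g + Poly_Mapping.single i 1)"
proof -
  fix i and p :: "(nat \<Rightarrow>\<^sub>0 nat) \<Rightarrow> complex"
  assume "finite {k. p k \<noteq> 0}"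
  hence "finite ((\<lambda>g. g + Poly_Mapping.single i 1) -` {k. p k \<noteq> 0})"
    by (rule finite_vimageI) (simp add: inj_def)
  thus "finite {k. of_nat (Poly_Mapping.lookup k i + 1) * p (k + Poly_Mapping.single i 1) \<noteq> 0}"
    by (rule rev_finite_subset) auto
qed

lemma mv_deriv_add: "mv_deriv i (p + q) = mv_deriv i p + mv_deriv i q"
  by (rule poly_mapping_eqI) (simp add: mv_deriv.rep_eq lookup_add ring_distribs)

lemma mv_deriv_0 [simp]: "mv_deriv i 0 = 0"
  by (rule poly_mapping_eqI) (simp add: mv_deriv.rep_eq)

lemma mv_deriv_sum: "mv_deriv i (sum h A) = (\<Sum>a\<in>A. mv_deriv i (h a))"
  by (induction A rule: infinite_finite_induct) (auto simp: mv_deriv_add)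

lemma mv_deriv_single:
  "mv_deriv i (Poly_Mapping.single g c)
     = Poly_Mapping.single (g - Poly_Mapping.single i 1) (of_nat (Poly_Mapping.lookup g i) * c)"
proof (cases "Poly_Mapping.lookup g i = 0")
  case True
  have "g \<noteq> k + Poly_Mapping.single i 1" for k
    using True by (auto simp: lookup_add)
  thus ?thesis using True
    by (intro poly_mapping_eqI) (auto simp: mv_deriv.rep_eq lookup_single when_def)
next
  case False
  have eq: "g = k + Poly_Mapping.single i (Suc 0) \<longleftrightarrow> g - Poly_Mapping.single i (Suc 0) = k" for k
  proof
    assume "g - Poly_Mapping.single i (Suc 0) = k"
    thus "g = k + Poly_Mapping.single i (Suc 0)" using False
      by (intro poly_mapping_eqI) (auto simp: lookup_add lookup_minus lookup_single when_def)
  qed simp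
  show ?thesis
    using False
    by (intro poly_mapping_eqI)
      (auto simp: mv_deriv.rep_eq lookup_single when_def eq lookup_add lookup_minus)
qed

lemma mvpoly_eq_sum_singles:
  "p = (\<Sum>g\<in>Poly_Mapping.keys p. Poly_Mapping.single g (Poly_Mapping.lookup p g))"
proof (rule poly_mapping_eqI)
  fix k
  show "Poly_Mapping.lookup p k
      = Poly_Mapping.lookup (\<Sum>g\<in>Poly_Mapping.keys p. Poly_Mapping.single g (Poly_Mapping.lookup p g)) k"
    by (simp add: lookup_sum lookup_single when_def sum.delta' in_keys_iff)
qed

text \<open>Both sides of the product rule are biadditive, so monomials suffice. Exponents are
  lowered by truncated subtraction, which goes wrong exactly when the exponent is zero; then the
  coefficient vanishes too.\<close>

lemma derivation_mv_deriv: "derivation (mv_deriv i)"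
  unfolding derivation_def
proof (intro conjI allI)
  fix p q :: mvpoly
  show "mv_deriv i (p + q) = mv_deriv i p + mv_deriv i q" by (rule mv_deriv_add)
  have single: "mv_deriv i (Poly_Mapping.single g c * Poly_Mapping.single h e) =
      mv_deriv i (Poly_Mapping.single g c) * Poly_Mapping.single h e +
      Poly_Mapping.single g c * mv_deriv i (Poly_Mapping.single h e)" for g h c e
  proof -
    let ?e = "Poly_Mapping.single i (1::nat)"
    have "Poly_Mapping.single (g - ?e + h) (of_nat (Poly_Mapping.lookup g i) * c * e)
        = Poly_Mapping.single (g + h - ?e) (of_nat (Poly_Mapping.lookup g i) * c * e)"
    proof (cases "Poly_Mapping.lookup g i = 0")
      case False
      hence "g - ?e + h = g + h - ?e"
        by (intro poly_mapping_eqI) (auto simp: lookup_add lookup_minus lookup_single when_def)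
      thus ?thesis by simp
    qed simp
    moreover have "Poly_Mapping.single (g + (h - ?e)) (of_nat (Poly_Mapping.lookup h i) * c * e)
        = Poly_Mapping.single (g + h - ?e) (of_nat (Poly_Mapping.lookup h i) * c * e)"
    proof (cases "Poly_Mapping.lookup h i = 0")
      case False
      hence "g + (h - ?e) = g + h - ?e"
        by (intro poly_mapping_eqI) (auto simp: lookup_add lookup_minus lookup_single when_def)
      thus ?thesis by simp
    qed simp
    ultimately show ?thesis
      by (simp add: mult_single mv_deriv_single lookup_add ring_distribs single_add ac_simps)
  qed
  define P where "P = (\<lambda>g. Poly_Mapping.single g (Poly_Mapping.lookup p g))"
  define Q where "Q = (\<lambda>g. Poly_Mapping.single g (Poly_Mapping.lookup q g))"
  have p: "p = sum P (Poly_Mapping.keys p)" and q: "q = sum Q (Poly_Mapping.keys q)"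
    unfolding P_def Q_def by (rule mvpoly_eq_sum_singles)+
  have "mv_deriv i (sum P A * sum Q B) = mv_deriv i (sum P A) * sum Q B + sum P A * mv_deriv i (sum Q B)" for A B
    by (simp add: sum_product mv_deriv_sum single[folded P_def Q_def] P_def Q_def single sum.distrib)
  from this[of "Poly_Mapping.keys p" "Poly_Mapping.keys q"]
  show "mv_deriv i (p * q) = mv_deriv i p * q + p * mv_deriv i q"
    unfolding p[symmetric] q[symmetric] .
qed

lemma mv_deriv_commute: "mv_deriv i (mv_deriv j p) = mv_deriv j (mv_deriv i p)"
  by (rule poly_mapping_eqI)
    (auto simp: mv_deriv.rep_eq lookup_add lookup_single when_def add_ac mult_ac)

section \<open>Differential fields with independent coordinates\<close>

text \<open>All that the later sections use about rational functions. \<open>monomials_indep\<close>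
  is algebraic independence of the first \<open>n\<close> coordinates over the constants; it yields
  the injectivity of \<open>op\<close> and the way back from identities in the field to coefficient
  functions.\<close>

locale diff_field =
  fixes n :: nat and \<kappa> :: "complex \<Rightarrow> 'a::field" and x :: "nat \<Rightarrow> 'a" and d :: "nat \<Rightarrow> 'a \<Rightarrow> 'a"
  assumes \<kappa>_add: "\<kappa> (a + b) = \<kappa> a + \<kappa> b"
    and \<kappa>_mult: "\<kappa> (a * b) = \<kappa> a * \<kappa> b"
    and \<kappa>_1 [simp]: "\<kappa> 1 = 1"
    and derivation_d: "derivation (d i)"
    and d_\<kappa> [simp]: "d i (\<kappa> a) = 0"
    and d_x: "d i (x j) = (if i = j then 1 else 0)"
    and d_commute: "d i (d j u) = d j (d i u)"
    and monomials_indep: "finite A \<Longrightarrow> (\<And>g. g \<in> A \<Longrightarrow> mi_ok n g) \<Longrightarrow>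
      (\<Sum>g\<in>A. \<kappa> (c g) * (\<Prod>i<n. x i ^ g i)) = 0 \<Longrightarrow> g \<in> A \<Longrightarrow> c g = 0"

definition mv_const :: "complex \<Rightarrow> mvpoly fract" where
  "mv_const c = Fract (Poly_Mapping.single 0 c) 1"

definition mv_var :: "nat \<Rightarrow> mvpoly fract" where
  "mv_var i = Fract (Poly_Mapping.single (Poly_Mapping.single i 1) 1) 1"

lemma Fract1_sum: "Fract (sum h A) (1::'b::idom) = (\<Sum>a\<in>A. Fract (h a) 1)"
proof (induction A rule: infinite_finite_induct)
  case (insert a A)
  have "Fract (sum h (insert a A)) 1 = Fract (h a) 1 + Fract (sum h A) 1"
    using insert.hyps by simp
  thus ?case using insert by simp
qed (auto simp: Zero_fract_def)

lemma mv_var_power: "mv_var i ^ k = Fract (Poly_Mapping.single (Poly_Mapping.single i k) 1) 1"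
  by (induction k) (auto simp: mv_var_def mult_single single_add[symmetric] One_fract_def)

lemma mv_var_monomial:
  "(\<Prod>i<k. mv_var i ^ g i) = Fract (Poly_Mapping.single (\<Sum>i<k. Poly_Mapping.single i (g i)) 1) 1"
  by (induction k) (auto simp: mv_var_power mult_single One_fract_def ac_simps)

text \<open>The type of monomials does not know \<open>n\<close>, so the model has infinitely many
  variables. An exponent satisfying \<open>mi_ok\<close> can be recovered from its monomial
  \<open>m g\<close>, hence distinct members of \<open>A\<close> give distinct monomials.\<close>

lemma diff_field_mvpoly: "diff_field n mv_const mv_var (\<lambda>i. fract_deriv (mv_deriv i))"
proof
  fix a b :: complex and i j :: nat and u :: "mvpoly fract"
  show "mv_const (a + b) = mv_const a + mv_const b" by (simp add: mv_const_def single_add)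
  show "mv_const (a * b) = mv_const a * mv_const b" by (simp add: mv_const_def mult_single)
  show "mv_const 1 = 1" by (simp add: mv_const_def One_fract_def)
  show "derivation (fract_deriv (mv_deriv i))"
    by (intro derivation_fract_deriv derivation_mv_deriv)
  show "fract_deriv (mv_deriv i) (mv_const a) = 0"
    by (simp add: mv_const_def fract_deriv_of_Fract1 derivation_mv_deriv mv_deriv_single Zero_fract_def)
  show "fract_deriv (mv_deriv i) (mv_var j) = (if i = j then 1 else 0)"
    by (auto simp: mv_var_def fract_deriv_of_Fract1 derivation_mv_deriv mv_deriv_single lookup_single
        Zero_fract_def One_fract_def)
  show "fract_deriv (mv_deriv i) (fract_deriv (mv_deriv j) u) = fract_deriv (mv_deriv j) (fract_deriv (mv_deriv i) u)"
    by (intro fract_deriv_commute derivation_mv_deriv mv_deriv_commute)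
next
  fix A :: "(nat \<Rightarrow> nat) set" and c g
  assume fin: "finite A" and ok: "\<And>g. g \<in> A \<Longrightarrow> mi_ok n g" and g: "g \<in> A"
    and z: "(\<Sum>g\<in>A. mv_const (c g) * (\<Prod>i<n. mv_var i ^ g i)) = 0"
  define m :: "(nat \<Rightarrow> nat) \<Rightarrow> nat \<Rightarrow>\<^sub>0 nat" where "m g = (\<Sum>i<n. Poly_Mapping.single i (g i))" for g
  have lm: "Poly_Mapping.lookup (m h) i = h i" if "h \<in> A" for h i
    using ok[OF that] by (auto simp: m_def lookup_sum lookup_single when_def sum.delta' mi_ok_def)
  have "Fract (\<Sum>g\<in>A. Poly_Mapping.single (m g) (c g)) 1 = Fract 0 1"
    using z by (simp add: mv_const_def mv_var_monomial mult_single Fract1_sum m_def Zero_fract_def)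
  hence "(\<Sum>g\<in>A. Poly_Mapping.single (m g) (c g)) = 0" by (simp add: eq_fract)
  hence "Poly_Mapping.lookup (\<Sum>g\<in>A. Poly_Mapping.single (m g) (c g)) (m g) = 0" by simp
  moreover have "Poly_Mapping.lookup (\<Sum>g\<in>A. Poly_Mapping.single (m g) (c g)) (m g)
      = (\<Sum>h\<in>A. if h = g then c h else 0)"
    unfolding lookup_sum
  proof (rule sum.cong[OF refl])
    fix h assume h: "h \<in> A"
    have "m h = m g \<longleftrightarrow> h = g" using lm[OF h] lm[OF g] by (metis ext)
    thus "Poly_Mapping.lookup (Poly_Mapping.single (m h) (c h)) (m g) = (if h = g then c h else 0)"
      by (simp add: lookup_single when_def)
  qed
  ultimately show "c g = 0" using fin g by simp
qed

section \<open>The ring of additive endomorphisms\<close>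

text \<open>Additivity is what the law A (B + C) = A B + A C requires. Linearity over the constants
  cannot be part of the type, since \<kappa> is a parameter of the locale; lemmas such as
  \<open>kk_W\<close> carry it instead.\<close>

typedef (overloaded) 'a endo = "{h :: 'a::field \<Rightarrow> 'a. \<forall>u v. h (u + v) = h u + h v}"
  morphisms app Endo
  by (rule exI[of _ "\<lambda>_. 0"]) simp

setup_lifting type_definition_endo

lemma app_add [simp]: "app A (u + v) = app A u + app A v"
  using app[of A] by simp

lemma app_0 [simp]: "app A 0 = 0"
  using app_add[of A 0 0] by (metis add.right_neutral add_left_cancel)

lemma app_sum: "app A (sum h T) = (\<Sum>t\<in>T. app A (h t))"
  by (induction T rule: infinite_finite_induct) auto

instantiation endo :: (field) ring_1
begin

lift_definition zero_endo :: "'a endo" is "\<lambda>_. 0" by simp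
lift_definition one_endo :: "'a endo" is "\<lambda>u. u" by simp
lift_definition plus_endo :: "'a endo \<Rightarrow> 'a endo \<Rightarrow> 'a endo" is "\<lambda>A B u. A u + B u" by simp
lift_definition minus_endo :: "'a endo \<Rightarrow> 'a endo \<Rightarrow> 'a endo" is "\<lambda>A B u. A u - B u" by simp
lift_definition uminus_endo :: "'a endo \<Rightarrow> 'a endo" is "\<lambda>A u. - A u" by simp
lift_definition times_endo :: "'a endo \<Rightarrow> 'a endo \<Rightarrow> 'a endo" is "\<lambda>A B u. A (B u)" by simp

instance
proof
  show "(0::'a endo) \<noteq> 1"
  proof
    assume "(0::'a endo) = 1"
    hence "app (0::'a endo) 1 = app 1 1" by simp
    thus False by (simp add: zero_endo.rep_eq one_endo.rep_eq)
  qed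
qed (transfer; simp add: fun_eq_iff algebra_simps)+

end

lemmas app_simps [simp] = zero_endo.rep_eq one_endo.rep_eq plus_endo.rep_eq minus_endo.rep_eq
  uminus_endo.rep_eq times_endo.rep_eq

lemma app_sum_left: "app (sum h T) u = (\<Sum>t\<in>T. app (h t) u)"
  by (induction T rule: infinite_finite_induct) auto

lemma endo_eqI: "(\<And>u. app A u = app B u) \<Longrightarrow> A = B"
  by (simp add: app_inject[symmetric] fun_eq_iff)

lift_definition mu :: "'a::field \<Rightarrow> 'a endo" is "\<lambda>u v. u * v" by (simp add: ring_distribs)

lemmas app_mu [simp] = mu.rep_eq

lemma mu_mult: "mu (u * v) = mu u * mu v"
  by (rule endo_eqI) simp

lemma mu_add: "mu (u + v) = mu u + mu v"
  by (rule endo_eqI) (simp add: ring_distribs)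

lemma mu_0 [simp]: "mu 0 = 0" and mu_1 [simp]: "mu 1 = 1"
  by (rule endo_eqI, simp)+

lemma mu_sum: "mu (sum h T) = (\<Sum>t\<in>T. mu (h t))"
  by (induction T rule: infinite_finite_induct) (auto simp: mu_add)

lemma mu_of_nat: "mu (of_nat k) = of_nat k"
  by (induction k) (auto simp: mu_add)

lemma mu_power: "mu (u ^ k) = mu u ^ k"
  by (induction k) (auto simp: mu_mult)

lemma mu_commute: "mu u * mu v = mu v * mu u"
  by (simp add: mu_mult[symmetric] mult.commute)

lemma commute_power: "a * b = b * (a::'b::monoid_mult) \<Longrightarrow> a ^ k * b = b * a ^ k"
  by (induction k) (auto simp: mult.assoc, metis mult.assoc)

lemma commute_prod_list:
  "(\<And>a. a \<in> set as \<Longrightarrow> a * b = b * (a::'b::monoid_mult)) \<Longrightarrow> prod_list as * b = b * prod_list as"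
proof (induction as)
  case (Cons a as)
  have "a * (prod_list as * b) = a * (b * prod_list as)" using Cons by simp
  also have "\<dots> = b * (a * prod_list as)" using Cons.prems[of a] by (metis list.set_intros(1) mult.assoc)
  finally show ?case by (simp add: mult.assoc)
qed simp

lemma finite_mi_le: "mi_ok n b \<Longrightarrow> finite {k. \<forall>i. k i \<le> b i}"
proof -
  assume b: "mi_ok n b"
  have "finite {k. \<forall>i. (i \<in> {..<n} \<longrightarrow> k i \<in> {..Max (b ` {..<n})}) \<and> (i \<notin> {..<n} \<longrightarrow> k i = 0)}"
    by (rule finite_set_of_finite_funs) auto
  moreover have "{k. \<forall>i. k i \<le> b i} \<subseteq>
      {k. \<forall>i. (i \<in> {..<n} \<longrightarrow> k i \<in> {..Max (b ` {..<n})}) \<and> (i \<notin> {..<n} \<longrightarrow> k i = 0)}"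
  proof (intro subsetI CollectI allI conjI impI)
    fix k i assume k: "k \<in> {k. \<forall>i. k i \<le> b i}"
    { assume "i \<in> {..<n}"
      hence "b i \<le> Max (b ` {..<n})" by simp
      moreover have "k i \<le> b i" using k by simp
      ultimately show "k i \<in> {..Max (b ` {..<n})}" by simp }
    { assume "i \<notin> {..<n}"
      hence "b i = 0" using b by (simp add: mi_ok_def)
      moreover have "k i \<le> b i" using k by simp
      ultimately show "k i = 0" by simp }
  qed
  ultimately show ?thesis by (rule rev_finite_subset)
qed

section \<open>The Weyl algebra as differential operators\<close>

context diff_field
begin

lemma \<kappa>_0 [simp]: "\<kappa> 0 = 0"
  using \<kappa>_add[of 0 0] by (metis add.right_neutral add_left_cancel)

lemma \<kappa>_uminus: "\<kappa> (- a) = - \<kappa> a"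
  using \<kappa>_add[of a "- a"] by (simp add: add_eq_0_iff)

lemma \<kappa>_diff: "\<kappa> (a - b) = \<kappa> a - \<kappa> b"
  using \<kappa>_add[of a "- b"] by (simp add: \<kappa>_uminus)

lemma \<kappa>_eq_0_iff [simp]: "\<kappa> a = 0 \<longleftrightarrow> a = 0"
proof
  assume z: "\<kappa> a = 0"
  show "a = 0"
  proof (rule ccontr)
    assume "a \<noteq> 0"
    hence "\<kappa> a * \<kappa> (inverse a) = 1" by (simp add: \<kappa>_mult[symmetric])
    thus False using z by simp
  qed
qed simp

lemma \<kappa>_of_nat: "\<kappa> (of_nat k) = of_nat k"
  by (induction k) (auto simp: \<kappa>_add)

lemma \<kappa>_sum: "\<kappa> (sum h T) = (\<Sum>t\<in>T. \<kappa> (h t))"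
  by (induction T rule: infinite_finite_induct) (auto simp: \<kappa>_add)

lemmas d_simps = derivationD[OF derivation_d]

lemma d_power: "d i (u ^ k) = of_nat k * u ^ (k - 1) * d i u"
proof (induction k)
  case (Suc k)
  have "u * u ^ (k - Suc 0) * of_nat k = (u ^ k * of_nat k :: 'a)"
    by (cases k) auto
  thus ?case using Suc by (auto simp: d_simps algebra_simps)
qed (simp add: d_simps)

lemma d_prod_0: "(\<And>t. t \<in> T \<Longrightarrow> d i (h t) = 0) \<Longrightarrow> d i (prod h T) = 0"
  by (induction T rule: infinite_finite_induct) (auto simp: d_simps)

section \<open>Multiplications and partial derivatives as operators, with their commutation
  rules\<close>

definition D :: "nat \<Rightarrow> 'a endo" where "D i = Endo (d i)"

lemma app_D [simp]: "app (D i) u = d i u"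
  unfolding D_def by (subst Endo_inverse) (auto simp: d_simps)

lemma D_commute: "D i * D j = D j * D i"
  by (rule endo_eqI) (simp add: d_commute)

lemma D_mu: "D i * mu u = mu u * D i + mu (d i u)"
  by (rule endo_eqI) (simp add: d_simps)

definition kk :: "complex \<Rightarrow> 'a endo" where "kk c = mu (\<kappa> c)"

lemma kk_0 [simp]: "kk 0 = 0" and kk_1 [simp]: "kk 1 = 1"
  by (simp_all add: kk_def)

lemma kk_add: "kk (a + b) = kk a + kk b" and kk_mult: "kk (a * b) = kk a * kk b"
  by (simp_all add: kk_def \<kappa>_add \<kappa>_mult mu_add mu_mult)

lemma kk_uminus: "kk (- a) = - kk a"
  using kk_add[of a "- a"] by (simp add: add_eq_0_iff)

lemma kk_diff: "kk (a - b) = kk a - kk b"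
  using kk_add[of a "- b"] by (simp add: kk_uminus)

lemma kk_sum: "kk (sum h T) = (\<Sum>t\<in>T. kk (h t))"
  by (simp add: kk_def \<kappa>_sum mu_sum)

lemma kk_of_nat: "kk (of_nat k) = of_nat k"
  by (simp add: kk_def \<kappa>_of_nat mu_of_nat)

lemma app_kk [simp]: "app (kk c) u = \<kappa> c * u"
  by (simp add: kk_def)

lemma kk_mu: "kk c * mu u = mu u * kk c"
  by (simp add: kk_def mu_commute)

lemma kk_D: "kk c * D i = D i * kk c"
  by (simp add: kk_def D_mu)

text \<open>Truncated to the first \<open>N\<close> variables so that normal ordering and
  homogeneity can be proved by induction on the number of variables.\<close>

definition xmN :: "nat \<Rightarrow> mi \<Rightarrow> 'a" where "xmN N g = (\<Prod>i<N. x i ^ g i)"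

definition DN :: "nat \<Rightarrow> mi \<Rightarrow> 'a endo" where "DN N b = prod_list (map (\<lambda>i. D i ^ b i) [0..<N])"

lemma DN_Suc: "DN (Suc N) b = DN N b * D N ^ b N"
  by (simp add: DN_def)

lemma DN_0 [simp]: "DN 0 b = 1" by (simp add: DN_def)

lemma xmN_Suc: "xmN (Suc N) g = xmN N g * x N ^ g N"
  by (simp add: xmN_def)

lemma xmN_0 [simp]: "xmN 0 g = 1" by (simp add: xmN_def)

lemma D_DN: "DN N b * D i = D i * DN N b"
  unfolding DN_def by (rule commute_prod_list) (auto intro: commute_power simp: D_commute)

lemma DN_add: "DN N (\<lambda>i. a i + b i) = DN N a * DN N b"
proof (induction N)
  case (Suc N)
  have "DN N b * D N ^ a N = D N ^ a N * DN N b"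
    using commute_power[OF D_DN[symmetric], of N "a N" N b] by simp
  thus ?case unfolding DN_Suc Suc.IH power_add by (metis (no_types, lifting) mult.assoc)
qed simp

lemma xmN_add: "xmN N (\<lambda>i. a i + b i) = xmN N a * xmN N b"
  by (simp add: xmN_def power_add prod.distrib)

lemma kk_DN: "kk c * DN N b = DN N b * kk c"
  unfolding DN_def
  by (rule commute_prod_list[symmetric]) (auto intro: commute_power simp: kk_D)

lemma D_mu_const: "d i u = 0 \<Longrightarrow> D i ^ k * mu u = mu u * D i ^ k"
  by (rule commute_power) (simp add: D_mu)

lemma DN_mu_const: "(\<And>i. i < N \<Longrightarrow> d i u = 0) \<Longrightarrow> DN N b * mu u = mu u * DN N b"
  unfolding DN_def by (rule commute_prod_list) (auto intro: D_mu_const)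

text \<open>Leibniz rule, by induction on \<open>b\<close>. The recurrence \<open>BS\<close> of the
  coefficients is Pascal's rule combined with (k+1) C(c,k+1) = (c-k) C(c,k). Terms with
  \<open>k\<close> above \<open>c\<close> have coefficient zero, so the truncated exponent
  \<open>c - k\<close> does no harm.\<close>

lemma normal_order_1:
  "D i ^ b * mu (x i ^ c) =
    (\<Sum>k\<le>b. of_nat ((b choose k) * (c choose k) * fact k) * (mu (x i ^ (c - k)) * D i ^ (b - k)))"
proof (induction b)
  case (Suc b)
  define B where "B b k = (b choose k) * (c choose k) * fact k" for b k :: nat
  define T where "T k = mu (x i ^ (c - k)) * D i ^ (Suc b - k)" for k
  have step: "D i * mu (x i ^ m) = mu (x i ^ m) * D i + of_nat m * mu (x i ^ (m - 1))" for m
    by (simp add: D_mu d_power d_x mu_mult mu_of_nat)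
  have BS: "B (Suc b) (Suc k) = B b (Suc k) + B b k * (c - k)" for k
  proof -
    have "Suc k * (c choose Suc k) = (c - k) * (c choose k)"
      by (simp only: binomial_absorption binomial_absorb_comp)
    hence "(b choose k) * fact k * (Suc k * (c choose Suc k)) = (b choose k) * fact k * ((c - k) * (c choose k))"
      by simp
    thus ?thesis by (simp add: B_def algebra_simps)
  qed
  have "D i ^ Suc b * mu (x i ^ c) = D i * (D i ^ b * mu (x i ^ c))"
    by (simp add: mult.assoc)
  also have "\<dots> = (\<Sum>k\<le>b. D i * (of_nat (B b k) * (mu (x i ^ (c - k)) * D i ^ (b - k))))"
    by (simp only: Suc sum_distrib_left B_def)
  also have "\<dots> = (\<Sum>k\<le>b. of_nat (B b k) * T k + of_nat (B b k * (c - k)) * T (Suc k))"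
  proof (rule sum.cong[OF refl])
    fix k assume "k \<in> {..b}"
    hence k: "k \<le> b" by simp
    have "D i * (of_nat (B b k) * (mu (x i ^ (c - k)) * D i ^ (b - k)))
        = of_nat (B b k) * ((D i * mu (x i ^ (c - k))) * D i ^ (b - k))"
      by (metis mult.assoc mult_of_nat_commute)
    also have "\<dots> = of_nat (B b k) * (mu (x i ^ (c - k)) * (D i * D i ^ (b - k)))
        + of_nat (B b k) * (of_nat (c - k) * (mu (x i ^ (c - k - 1)) * D i ^ (b - k)))"
      by (simp only: step distrib_left distrib_right mult.assoc)
    also have "D i * D i ^ (b - k) = D i ^ (Suc b - k)"
      using k by (simp add: Suc_diff_le)
    finally show "D i * (of_nat (B b k) * (mu (x i ^ (c - k)) * D i ^ (b - k)))
        = of_nat (B b k) * T k + of_nat (B b k * (c - k)) * T (Suc k)"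
      by (simp add: T_def mult.assoc)
  qed
  also have "\<dots> = (\<Sum>k\<le>b. of_nat (B b k) * T k) + (\<Sum>k\<le>b. of_nat (B b k * (c - k)) * T (Suc k))"
    by (rule sum.distrib)
  also have "(\<Sum>k\<le>b. of_nat (B b k) * T k) = (\<Sum>k\<le>Suc b. of_nat (B b k) * T k)"
    by (simp add: B_def binomial_eq_0)
  also have "\<dots> = T 0 + (\<Sum>k\<le>b. of_nat (B b (Suc k)) * T (Suc k))"
    unfolding sum.atMost_Suc_shift by (simp add: B_def)
  also have "\<dots> + (\<Sum>k\<le>b. of_nat (B b k * (c - k)) * T (Suc k))
      = T 0 + (\<Sum>k\<le>b. of_nat (B (Suc b) (Suc k)) * T (Suc k))"
    by (simp add: BS sum.distrib distrib_right add.assoc)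
  also have "\<dots> = (\<Sum>k\<le>Suc b. of_nat (B (Suc b) k) * T k)"
    unfolding sum.atMost_Suc_shift by (simp add: B_def)
  finally show ?case by (simp add: B_def T_def)
qed simp

definition KN :: "nat \<Rightarrow> mi \<Rightarrow> mi \<Rightarrow> mi set" where
  "KN N b c = {k. (\<forall>i<N. k i \<le> min (b i) (c i)) \<and> (\<forall>i\<ge>N. k i = 0)}"

lemma KN_0: "KN 0 b c = {\<lambda>_. 0}"
  by (auto simp: KN_def)

text \<open>\<open>x N\<close> and its derivative commute with the operators of the earlier
  variables, so the one-variable rule applies to them separately. A contraction in
  \<open>Suc N\<close> variables is one in \<open>N\<close> variables plus a value at
  \<open>N\<close>; the convention that contractions vanish beyond their range makes this a
  bijection.\<close>

lemma normal_order_N: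
  "DN N b * mu (xmN N c) =
    (\<Sum>k\<in>KN N b c. kk (\<Prod>i<N. of_nat ((b i choose k i) * (c i choose k i) * fact (k i))) *
       (mu (xmN N (\<lambda>i. c i - k i)) * DN N (\<lambda>i. b i - k i)))"
proof (induction N)
  case 0
  thus ?case by (simp add: KN_0)
next
  case (Suc N)
  define W where "W k i = (b i choose k i) * (c i choose k i) * fact (k i)" for k i
  define T where "T N k = kk (\<Prod>i<N. of_nat (W k i)) *
       (mu (xmN N (\<lambda>i. c i - k i)) * DN N (\<lambda>i. b i - k i))" for N k
  define U where "U j = of_nat ((b N choose j) * (c N choose j) * fact j) *
      (mu (x N ^ (c N - j)) * D N ^ (b N - j))" for j
  have dx: "d N (xmN N c) = 0"
    unfolding xmN_def by (rule d_prod_0) (auto simp: d_power d_x)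
  have one: "D N ^ b N * mu (x N ^ c N) = (\<Sum>j\<le>min (b N) (c N). U j)"
    unfolding normal_order_1 U_def[symmetric]
  proof (rule sum.mono_neutral_right)
    show "\<forall>j\<in>{..b N} - {..min (b N) (c N)}. U j = 0"
    proof
      fix j assume "j \<in> {..b N} - {..min (b N) (c N)}"
      hence "c N < j" by auto
      thus "U j = 0" by (simp add: U_def binomial_eq_0)
    qed
  qed auto
  have "DN (Suc N) b * mu (xmN (Suc N) c)
      = DN N b * (D N ^ b N * mu (xmN N c)) * mu (x N ^ c N)"
    by (simp add: DN_Suc xmN_Suc mu_mult mult.assoc)
  also have "\<dots> = (DN N b * mu (xmN N c)) * (D N ^ b N * mu (x N ^ c N))"
    by (simp add: D_mu_const[OF dx] mult.assoc)
  also have "\<dots> = (\<Sum>k\<in>KN N b c. T N k) * (\<Sum>j\<le>min (b N) (c N). U j)"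
    unfolding Suc one by (simp add: T_def W_def)
  also have "\<dots> = (\<Sum>(k, j)\<in>KN N b c \<times> {..min (b N) (c N)}. T N k * U j)"
    by (simp add: sum_product sum.cartesian_product)
  also have "\<dots> = (\<Sum>k\<in>KN (Suc N) b c. T (Suc N) k)"
  proof (rule sum.reindex_bij_witness[where i = "\<lambda>k. (k(N := 0), k N)" and j = "\<lambda>(k, j). k(N := j)"])
    fix kj assume kj: "kj \<in> KN N b c \<times> {..min (b N) (c N)}"
    obtain k j where e: "kj = (k, j)" by (cases kj)
    from kj e show "((case kj of (k, j) \<Rightarrow> k(N := j))(N := 0), (case kj of (k, j) \<Rightarrow> k(N := j)) N) = kj"
      by (auto simp: KN_def fun_eq_iff)
    from kj e show "(case kj of (k, j) \<Rightarrow> k(N := j)) \<in> KN (Suc N) b c"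
      by (auto simp: KN_def less_Suc_eq)
    let ?p = "mu (xmN N (\<lambda>i. c i - k i))" and ?q = "mu (x N ^ (c N - j))"
      and ?E = "DN N (\<lambda>i. b i - k i)" and ?F = "D N ^ (b N - j)"
      and ?A = "kk (\<Prod>i<N. of_nat (W k i))" and ?w = "of_nat (W (k(N := j)) N) :: 'a endo"
    have comm: "?q * ?E = ?E * ?q"
      by (rule DN_mu_const[symmetric]) (auto simp: d_power d_x)
    have eqs: "DN N (\<lambda>i. b i - (k(N := j)) i) = ?E"
      "xmN N (\<lambda>i. c i - (k(N := j)) i) = xmN N (\<lambda>i. c i - k i)"
      "(\<Prod>i<N. of_nat (W (k(N := j)) i)) = (\<Prod>i<N. of_nat (W k i) :: complex)"
      unfolding DN_def xmN_def W_def
      by (auto intro!: prod.cong arg_cong[where f = prod_list])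
    have "T (Suc N) (k(N := j)) = ?A * ?w * (?p * ?q * (?E * ?F))"
      by (simp add: T_def DN_Suc xmN_Suc mu_mult eqs kk_mult kk_of_nat del: of_nat_mult fun_upd_apply)
        (simp add: W_def)
    also have "\<dots> = ?A * ?w * (?p * ((?q * ?E) * ?F))"
      by (simp only: mult.assoc)
    also have "\<dots> = ?A * ((?w * (?p * ?E)) * (?q * ?F))"
      by (simp only: comm mult.assoc)
    also have "?w * (?p * ?E) = (?p * ?E) * ?w"
      by (rule mult_of_nat_commute)
    also have "?A * ((?p * ?E) * ?w * (?q * ?F)) = T N k * U j"
      by (simp add: T_def U_def W_def mult.assoc)
    finally show "T (Suc N) (case kj of (k, j) \<Rightarrow> k(N := j)) = (case kj of (k, j) \<Rightarrow> T N k * U j)"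
      unfolding e prod.case .
  next
    fix k assume k: "k \<in> KN (Suc N) b c"
    thus "(k(N := 0), k N) \<in> KN N b c \<times> {..min (b N) (c N)}"
      by (auto simp: KN_def)
    show "(case (k(N := 0), k N) of (k, j) \<Rightarrow> k(N := j)) = k" by simp
  qed
  finally show ?case by (simp add: T_def W_def)
qed

section \<open>The representation \<open>op\<close> of the Weyl algebra: multiplicativity and
  injectivity\<close>

abbreviation xm :: "mi \<Rightarrow> 'a" where "xm \<equiv> xmN n"

definition M :: "mi \<times> mi \<Rightarrow> 'a endo" where "M m = mu (xm (fst m)) * DN n (snd m)"

definition op :: "weyl \<Rightarrow> 'a endo" where "op P = (\<Sum>m\<in>supp P. kk (P m) * M m)"

lemma kk_M: "kk c * M m = M m * kk c"
  by (simp only: M_def mult.assoc[symmetric] kk_mu) (simp only: mult.assoc kk_DN)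

lemma kk_kk: "kk a * kk b = kk b * kk a"
  by (simp add: kk_mult[symmetric] mult.commute)

lemma op_eq_sum: "finite T \<Longrightarrow> supp P \<subseteq> T \<Longrightarrow> op P = (\<Sum>m\<in>T. kk (P m) * M m)"
  unfolding op_def by (rule sum.mono_neutral_left) (auto simp: supp_def)

lemma supp_collect:
  fixes v :: "'j \<Rightarrow> complex"
  shows "supp (\<lambda>m. \<Sum>j\<in>T. if h j = m then v j else 0) \<subseteq> h ` T"
proof
  fix m assume "m \<in> supp (\<lambda>m. \<Sum>j\<in>T. if h j = m then v j else 0)"
  hence "(\<Sum>j\<in>T. if h j = m then v j else 0) \<noteq> 0" by (simp add: supp_def)
  then obtain j where "j \<in> T" "(if h j = m then v j else 0) \<noteq> 0" by (rule sum.not_neutral_contains_not_neutral)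
  thus "m \<in> h ` T" by (auto split: if_splits)
qed

text \<open>\<open>h\<close> need not be injective: coefficients of coinciding monomials accumulate.
  Products, the Euler operator and the correction \<open>R\<close> in \<open>linear_in_J\<close> are
  all brought to this form, from which their image under \<open>op\<close> can be read off.\<close>

lemma op_collect:
  assumes "finite T"
  shows "op (\<lambda>m. \<Sum>j\<in>T. if h j = m then v j else 0) = (\<Sum>j\<in>T. kk (v j) * M (h j))"
proof -
  have "op (\<lambda>m. \<Sum>j\<in>T. if h j = m then v j else 0)
      = (\<Sum>m\<in>h ` T. kk (\<Sum>j\<in>T. if h j = m then v j else 0) * M m)"
    by (rule op_eq_sum[OF _ supp_collect]) (use assms in simp)
  also have "\<dots> = (\<Sum>m\<in>h ` T. \<Sum>j\<in>T. if h j = m then kk (v j) * M (h j) else 0)"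
    unfolding kk_sum sum_distrib_right by (intro sum.cong) auto
  also have "\<dots> = (\<Sum>j\<in>T. \<Sum>m\<in>h ` T. if h j = m then kk (v j) * M (h j) else 0)"
    by (rule sum.swap)
  also have "\<dots> = (\<Sum>j\<in>T. kk (v j) * M (h j))"
    by (rule sum.cong) (use assms in auto)
  finally show ?thesis .
qed

lemma op_wadd:
  assumes "finite (supp P)" "finite (supp Q)"
  shows "op (wadd P Q) = op P + op Q"
proof -
  let ?T = "supp P \<union> supp Q"
  have "op (wadd P Q) = (\<Sum>m\<in>?T. kk (wadd P Q m) * M m)"
    by (rule op_eq_sum) (use assms in \<open>auto simp: supp_def wadd_def\<close>)
  also have "\<dots> = (\<Sum>m\<in>?T. kk (P m) * M m) + (\<Sum>m\<in>?T. kk (Q m) * M m)"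
    by (simp add: wadd_def kk_add distrib_right sum.distrib)
  also have "\<dots> = op P + op Q"
    using op_eq_sum[of ?T P] op_eq_sum[of ?T Q] assms by simp
  finally show ?thesis .
qed

lemma op_wzero [simp]: "op wzero = 0"
  by (simp add: op_def supp_def wzero_def)

lemma M_0: "M (\<lambda>_. 0, \<lambda>_. 0) = 1"
proof -
  have "DN N (\<lambda>_. 0) = 1" for N by (induction N) (auto simp: DN_Suc)
  thus ?thesis by (simp add: M_def xmN_def)
qed

lemma op_wone: "op wone = 1"
proof -
  have "wone = (\<lambda>m. \<Sum>j\<in>{()}. if (\<lambda>_. 0, \<lambda>_. 0) = m then 1 else 0)"
    by (auto simp: wone_def)
  thus ?thesis using op_collect[of "{()}" "\<lambda>_. (\<lambda>_. 0, \<lambda>_. 0)" "\<lambda>_. 1"] by (simp add: M_0)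
qed

lemma M_mult:
  assumes b: "mi_ok n b" and a: "mi_ok n a'"
  shows "M (a, b) * M (a', b') = (\<Sum>k | \<forall>i. k i \<le> min (b i) (a' i).
    kk (weylc b a' k) * M (\<lambda>i. a i + a' i - k i, \<lambda>i. b i + b' i - k i))"
proof -
  let ?W = "\<lambda>k. \<Prod>i<n. of_nat ((b i choose k i) * (a' i choose k i) * fact (k i)) :: complex"
  have K: "{k. \<forall>i. k i \<le> min (b i) (a' i)} = KN n b a'"
  proof (intro equalityI subsetI)
    fix k assume k: "k \<in> {k. \<forall>i. k i \<le> min (b i) (a' i)}"
    have "k i = 0" if "n \<le> i" for i
    proof -
      have "k i \<le> b i" using k by simp
      thus ?thesis using b that by (simp add: mi_ok_def)
    qed
    thus "k \<in> KN n b a'" using k by (simp add: KN_def)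
  next
    fix k assume k: "k \<in> KN n b a'"
    have "k i \<le> min (b i) (a' i)" for i
      using k by (cases "i < n") (auto simp: KN_def)
    thus "k \<in> {k. \<forall>i. k i \<le> min (b i) (a' i)}" by blast
  qed
  have W: "?W k = weylc b a' k" if k: "k \<in> KN n b a'" for k
    unfolding weylc_def
  proof (rule prod.mono_neutral_right)
    show "{i. k i \<noteq> 0} \<subseteq> {..<n}"
    proof
      fix i assume "i \<in> {i. k i \<noteq> 0}"
      thus "i \<in> {..<n}" using k by (cases "i < n") (auto simp: KN_def)
    qed
  qed auto
  have "M (a, b) * M (a', b') = mu (xm a) * (DN n b * mu (xm a')) * DN n b'"
    by (simp add: M_def mult.assoc)
  also have "\<dots> = (\<Sum>k\<in>KN n b a'. mu (xm a) * (kk (?W k) *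
      (mu (xm (\<lambda>i. a' i - k i)) * DN n (\<lambda>i. b i - k i))) * DN n b')"
    by (simp only: normal_order_N sum_distrib_left sum_distrib_right)
  also have "\<dots> = (\<Sum>k\<in>KN n b a'. kk (weylc b a' k) * M (\<lambda>i. a i + a' i - k i, \<lambda>i. b i + b' i - k i))"
  proof (rule sum.cong[OF refl])
    fix k assume k: "k \<in> KN n b a'"
    have "k \<in> {k. \<forall>i. k i \<le> min (b i) (a' i)}" using k K by simp
    hence kle: "k i \<le> b i" "k i \<le> a' i" for i by simp_all
    have "(\<lambda>i. a i + a' i - k i) = (\<lambda>i. a i + (a' i - k i))"
      "(\<lambda>i. b i + b' i - k i) = (\<lambda>i. (b i - k i) + b' i)"
      using kle by (simp_all add: fun_eq_iff)
    hence M: "M (\<lambda>i. a i + a' i - k i, \<lambda>i. b i + b' i - k i)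
        = mu (xm a) * mu (xm (\<lambda>i. a' i - k i)) * (DN n (\<lambda>i. b i - k i) * DN n b')"
      by (simp add: M_def xmN_add DN_add mu_mult)
    have "mu (xm a) * (kk (?W k) * (mu (xm (\<lambda>i. a' i - k i)) * DN n (\<lambda>i. b i - k i))) * DN n b'
       = (mu (xm a) * kk (?W k)) * (mu (xm (\<lambda>i. a' i - k i)) * (DN n (\<lambda>i. b i - k i) * DN n b'))"
      by (simp only: mult.assoc)
    also have "mu (xm a) * kk (?W k) = kk (?W k) * mu (xm a)"
      by (simp only: kk_mu)
    also have "kk (?W k) * mu (xm a) * (mu (xm (\<lambda>i. a' i - k i)) * (DN n (\<lambda>i. b i - k i) * DN n b'))
        = kk (weylc b a' k) * M (\<lambda>i. a i + a' i - k i, \<lambda>i. b i + b' i - k i)"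
      unfolding M W[OF k] by (simp only: mult.assoc)
    finally show "mu (xm a) * (kk (?W k) * (mu (xm (\<lambda>i. a' i - k i)) * DN n (\<lambda>i. b i - k i))) * DN n b'
        = kk (weylc b a' k) * M (\<lambda>i. a i + a' i - k i, \<lambda>i. b i + b' i - k i)" .
  qed
  finally show ?thesis unfolding K .
qed

text \<open>The three nested sums of \<open>wmult\<close>, flattened into one index set of two
  monomials and a contraction, so that \<open>op_collect\<close> applies to a product.\<close>

definition wind :: "weyl \<Rightarrow> weyl \<Rightarrow> ((mi \<times> mi) \<times> (mi \<times> mi) \<times> mi) set" where
  "wind P Q = (SIGMA m1:supp P. SIGMA m2:supp Q. {k. \<forall>i. k i \<le> min (snd m1 i) (fst m2 i)})"

definition wtarget :: "(mi \<times> mi) \<times> (mi \<times> mi) \<times> mi \<Rightarrow> mi \<times> mi" where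
  "wtarget = (\<lambda>(m1, m2, k). (\<lambda>i. fst m1 i + fst m2 i - k i, \<lambda>i. snd m1 i + snd m2 i - k i))"

lemma weyl_algD:
  assumes "P \<in> weyl_alg n"
  shows "finite (supp P)" "m \<in> supp P \<Longrightarrow> mi_ok n (fst m)" "m \<in> supp P \<Longrightarrow> mi_ok n (snd m)"
  using assms by (cases m; auto simp: weyl_alg_def supp_def)+

lemma finite_contractions:
  assumes "mi_ok n b"
  shows "finite {k. \<forall>i. k i \<le> min (b i) (a i)}"
  by (rule finite_subset[OF _ finite_mi_le[OF assms]]) auto

lemma finite_wind:
  assumes P: "P \<in> weyl_alg n" and Q: "Q \<in> weyl_alg n"
  shows "finite (wind P Q)"
  unfolding wind_def
  by (intro finite_SigmaI weyl_algD(1)[OF P] weyl_algD(1)[OF Q] finite_contractions weyl_algD(3)[OF P])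

lemma sum_wind:
  assumes P: "P \<in> weyl_alg n" and Q: "Q \<in> weyl_alg n"
  shows "sum F (wind P Q) = (\<Sum>m1\<in>supp P. \<Sum>m2\<in>supp Q.
    \<Sum>k | \<forall>i. k i \<le> min (snd m1 i) (fst m2 i). F (m1, m2, k))"
proof -
  let ?K = "\<lambda>m1 m2. {k. \<forall>i. k i \<le> min (snd m1 i) (fst m2 i)} :: mi set"
  have finK: "finite (?K m1 m2)" if "m1 \<in> supp P" for m1 m2 :: "mi \<times> mi"
    by (rule finite_contractions[OF weyl_algD(3)[OF P that]])
  have "(\<Sum>m1\<in>supp P. \<Sum>m2\<in>supp Q. \<Sum>k\<in>?K m1 m2. F (m1, m2, k))
      = (\<Sum>m1\<in>supp P. \<Sum>r\<in>Sigma (supp Q) (?K m1). F (m1, r))"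
  proof (intro sum.cong refl)
    fix m1 assume m1: "m1 \<in> supp P"
    have "(\<Sum>m2\<in>supp Q. \<Sum>k\<in>?K m1 m2. F (m1, m2, k)) = (\<Sum>(m2, k)\<in>Sigma (supp Q) (?K m1). F (m1, m2, k))"
      by (rule sum.Sigma) (use weyl_algD(1)[OF Q] finK[OF m1] in blast)+
    thus "(\<Sum>m2\<in>supp Q. \<Sum>k\<in>?K m1 m2. F (m1, m2, k)) = (\<Sum>r\<in>Sigma (supp Q) (?K m1). F (m1, r))"
      by (simp only: case_prod_beta' prod.collapse)
  qed
  also have "\<dots> = (\<Sum>(m1, r)\<in>wind P Q. F (m1, r))"
    unfolding wind_def
    by (rule sum.Sigma) (use weyl_algD(1)[OF P] weyl_algD(1)[OF Q] finK in \<open>blast intro: finite_SigmaI\<close>)+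
  finally show ?thesis by (simp only: case_prod_beta' prod.collapse)
qed

lemma wmult_collect:
  assumes P: "P \<in> weyl_alg n" and Q: "Q \<in> weyl_alg n"
  shows "wmult P Q = (\<lambda>m. \<Sum>j\<in>wind P Q. if wtarget j = m
    then (case j of (m1, m2, k) \<Rightarrow> P m1 * Q m2 * weylc (snd m1) (fst m2) k) else 0)"
proof
  fix m :: "mi \<times> mi"
  obtain a b where m: "m = (a, b)" by (cases m)
  show "wmult P Q m = (\<Sum>j\<in>wind P Q. if wtarget j = m
      then (case j of (m1, m2, k) \<Rightarrow> P m1 * Q m2 * weylc (snd m1) (fst m2) k) else 0)"
    unfolding sum_wind[OF assms] wmult_def m wtarget_def prod.case prod.inject by (rule refl)
qed

lemma wmult_in_weyl_alg:
  assumes P: "P \<in> weyl_alg n" and Q: "Q \<in> weyl_alg n"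
  shows "wmult P Q \<in> weyl_alg n"
proof -
  have sub: "supp (wmult P Q) \<subseteq> wtarget ` wind P Q"
    unfolding wmult_collect[OF assms] by (rule supp_collect)
  have "finite (supp (wmult P Q))"
    by (rule finite_subset[OF sub]) (simp add: finite_wind assms)
  moreover have "mi_ok n a \<and> mi_ok n b" if "wmult P Q (a, b) \<noteq> 0" for a b
  proof -
    from that have "(a, b) \<in> wtarget ` wind P Q" using sub by (auto simp: supp_def)
    then obtain m1 m2 k where "m1 \<in> supp P" "m2 \<in> supp Q" "(a, b) = wtarget (m1, m2, k)"
      by (auto simp: wind_def)
    thus ?thesis using weyl_algD(2,3)[OF P, of m1] weyl_algD(2,3)[OF Q, of m2]
      by (auto simp: wtarget_def mi_ok_def)
  qed
  ultimately show ?thesis by (auto simp: weyl_alg_def)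
qed

lemma op_wmult:
  assumes P: "P \<in> weyl_alg n" and Q: "Q \<in> weyl_alg n"
  shows "op (wmult P Q) = op P * op Q"
proof -
  have "op (wmult P Q) = (\<Sum>j\<in>wind P Q.
      kk (case j of (m1, m2, k) \<Rightarrow> P m1 * Q m2 * weylc (snd m1) (fst m2) k) * M (wtarget j))"
    unfolding wmult_collect[OF assms] by (rule op_collect[OF finite_wind[OF assms]])
  also have "\<dots> = (\<Sum>m1\<in>supp P. \<Sum>m2\<in>supp Q. \<Sum>k | \<forall>i. k i \<le> min (snd m1 i) (fst m2 i).
      kk (P m1 * Q m2 * weylc (snd m1) (fst m2) k) * M (wtarget (m1, m2, k)))"
    unfolding sum_wind[OF assms] by simp
  also have "\<dots> = (\<Sum>m1\<in>supp P. \<Sum>m2\<in>supp Q. (kk (P m1) * M m1) * (kk (Q m2) * M m2))"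
  proof (intro sum.cong refl)
    fix m1 m2 assume m: "m1 \<in> supp P" "m2 \<in> supp Q"
    have "(kk (P m1) * M m1) * (kk (Q m2) * M m2) = kk (P m1) * (M m1 * kk (Q m2)) * M m2"
      by (simp only: mult.assoc)
    also have "M m1 * kk (Q m2) = kk (Q m2) * M m1" by (simp only: kk_M)
    also have "kk (P m1) * (kk (Q m2) * M m1) * M m2 = kk (P m1 * Q m2) * (M m1 * M m2)"
      by (simp only: mult.assoc kk_mult)
    also have "M m1 * M m2 = (\<Sum>k | \<forall>i. k i \<le> min (snd m1 i) (fst m2 i).
        kk (weylc (snd m1) (fst m2) k) * M (wtarget (m1, m2, k)))"
      using M_mult[of "snd m1" "fst m2" "fst m1" "snd m2"] weyl_algD[OF P] weyl_algD[OF Q] m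
      by (simp add: wtarget_def)
    finally show "(\<Sum>k | \<forall>i. k i \<le> min (snd m1 i) (fst m2 i).
      kk (P m1 * Q m2 * weylc (snd m1) (fst m2) k) * M (wtarget (m1, m2, k)))
      = (kk (P m1) * M m1) * (kk (Q m2) * M m2)"
      by (simp only: sum_distrib_left kk_mult mult.assoc)
  qed
  also have "\<dots> = op P * op Q" by (simp add: op_def sum_product)
  finally show ?thesis .
qed

lemma app_DN_1: "app (DN N e) 1 = (if \<forall>i<N. e i = 0 then 1 else 0)"
proof (induction N)
  case (Suc N)
  have "app (D N ^ e N) 1 = (if e N = 0 then 1 else 0)"
    by (cases "e N") (auto simp: power_Suc2 d_simps simp del: power_Suc)
  thus ?case using Suc by (auto simp: DN_Suc less_Suc_eq)
qed simp

text \<open>Writing \<open>xm c\<close> as a multiplication operator applied to 1 reduces the claim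
  to normal ordering: after contraction with \<open>k\<close>, the remaining derivatives kill 1
  unless \<open>k = b\<close>.\<close>

lemma app_M_xm:
  assumes b: "mi_ok n b" and c: "mi_ok n c"
  shows "app (M (a, b)) (xm c) = (if \<forall>i. b i \<le> c i
    then \<kappa> (\<Prod>i<n. of_nat ((c i choose b i) * fact (b i))) * xm (\<lambda>i. a i + c i - b i) else 0)"
proof -
  have fin: "finite {k. \<forall>i. k i \<le> min (b i) (c i)}" by (rule finite_contractions[OF b])
  have M1: "app (M (g, h)) 1 = (if h = (\<lambda>_. 0) then xm g else 0)" if "mi_ok n h" for g h
  proof -
    have "(\<forall>i<n. h i = 0) \<longleftrightarrow> h = (\<lambda>_. 0)"
      using that unfolding mi_ok_def fun_eq_iff by (metis not_less)
    thus ?thesis by (simp add: M_def app_DN_1)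
  qed
  have cx: "xm c = app (M (c, \<lambda>_. 0)) 1" by (simp add: M_def app_DN_1)
  have "app (M (a, b)) (xm c) = app (M (a, b) * M (c, \<lambda>_. 0)) 1"
    by (simp add: cx)
  also have "\<dots> = (\<Sum>k | \<forall>i. k i \<le> min (b i) (c i).
      \<kappa> (weylc b c k) * app (M (\<lambda>i. a i + c i - k i, \<lambda>i. b i - k i)) 1)"
    by (subst M_mult[OF b c]) (simp add: app_sum_left)
  also have "\<dots> = (\<Sum>k | \<forall>i. k i \<le> min (b i) (c i).
      if k = b then \<kappa> (weylc b c b) * xm (\<lambda>i. a i + c i - b i) else 0)"
  proof (intro sum.cong refl)
    fix k assume k: "k \<in> {k. \<forall>i. k i \<le> min (b i) (c i)}"
    have ok: "mi_ok n (\<lambda>i. b i - k i)" using b by (auto simp: mi_ok_def)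
    have "(\<lambda>i. b i - k i) = (\<lambda>_. 0) \<longleftrightarrow> k = b"
      using k by (auto simp: fun_eq_iff intro: le_antisym)
    thus "\<kappa> (weylc b c k) * app (M (\<lambda>i. a i + c i - k i, \<lambda>i. b i - k i)) 1 =
        (if k = b then \<kappa> (weylc b c b) * xm (\<lambda>i. a i + c i - b i) else 0)"
      by (simp add: M1[OF ok])
  qed
  also have "\<dots> = (if \<forall>i. b i \<le> c i then \<kappa> (weylc b c b) * xm (\<lambda>i. a i + c i - b i) else 0)"
    using fin by simp
  also have "weylc b c b = (\<Prod>i<n. of_nat ((c i choose b i) * fact (b i)))"
    unfolding weylc_def binomial_n_n mult_1
  proof (rule prod.mono_neutral_left)
    show "{i. b i \<noteq> 0} \<subseteq> {..<n}"
    proof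
      fix i assume "i \<in> {i. b i \<noteq> 0}"
      thus "i \<in> {..<n}" using b by (cases "i < n") (auto simp: mi_ok_def)
    qed
  qed auto
  finally show ?thesis .
qed

text \<open>Test on x^b, where \<open>b\<close> is a derivative exponent of least total order in the
  support. A term with another exponent b' kills x^b unless b' <= b, and then minimality forces b' =
  b. What survives is a polynomial with coefficients \<open>P (g, b)\<close> times b!, so
  independence of monomials applies.\<close>

lemma op_inject_0:
  assumes P: "P \<in> weyl_alg n" and z: "op P = 0"
  shows "P = wzero"
proof (rule ccontr)
  assume "P \<noteq> wzero"
  then obtain m0 where m0: "m0 \<in> supp P" by (auto simp: wzero_def supp_def fun_eq_iff)
  define deg where "deg m = (\<Sum>i<n. snd m i)" for m :: "mi \<times> mi"
  obtain m where m: "m \<in> supp P" and min: "\<And>m'. m' \<in> supp P \<Longrightarrow> deg m \<le> deg m'"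
    using ex_has_least_nat[of "\<lambda>m. m \<in> supp P" m0 deg] m0 by blast
  obtain a b where ab: "m = (a, b)" by (cases m)
  have b: "mi_ok n b" using weyl_algD(3)[OF P m] ab by simp
  let ?F = "\<Prod>i<n. of_nat (fact (b i)) :: complex"
  have "0 = app (op P) (xm b)" by (simp add: z)
  also have "\<dots> = (\<Sum>m'\<in>supp P. \<kappa> (P m') * app (M m') (xm b))"
    by (simp add: op_def app_sum_left)
  also have "\<dots> = (\<Sum>m'\<in>supp P. if snd m' = b then \<kappa> (P m' * ?F) * xm (fst m') else 0)"
  proof (intro sum.cong refl)
    fix m' assume m': "m' \<in> supp P"
    obtain a' b' where e: "m' = (a', b')" by (cases m')
    have ok: "mi_ok n b'" using weyl_algD(3)[OF P m'] e by simp
    show "\<kappa> (P m') * app (M m') (xm b) = (if snd m' = b then \<kappa> (P m' * ?F) * xm (fst m') else 0)"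
    proof (cases "\<forall>i. b' i \<le> b i")
      case True
      have "b' = b"
      proof (rule ccontr)
        assume "b' \<noteq> b"
        then obtain i where "b' i \<noteq> b i" by auto
        hence i: "b' i < b i" using True by (simp add: le_neq_implies_less)
        hence "i < n" using b by (metis mi_ok_def not_less not_less_zero)
        hence "(\<Sum>i<n. b' i) < (\<Sum>i<n. b i)" using True i by (intro sum_strict_mono_ex1) auto
        thus False using min[OF m'] by (simp add: deg_def e ab)
      qed
      thus ?thesis using e app_M_xm[OF ok b, of a'] by (simp add: \<kappa>_mult)
    next
      case False
      thus ?thesis using e app_M_xm[OF ok b, of a'] by auto
    qed
  qed
  also have "\<dots> = (\<Sum>m'\<in>{m'\<in>supp P. snd m' = b}. \<kappa> (P m' * ?F) * xm (fst m'))"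
    by (rule sum.inter_filter[symmetric, OF weyl_algD(1)[OF P]])
  also have "\<dots> = (\<Sum>g\<in>fst ` {m'\<in>supp P. snd m' = b}. \<kappa> (P (g, b) * ?F) * xm g)"
    by (subst sum.reindex) (auto simp: inj_on_def intro!: sum.cong)
  finally have s0: "(\<Sum>g\<in>fst ` {m'\<in>supp P. snd m' = b}. \<kappa> (P (g, b) * ?F) * (\<Prod>i<n. x i ^ g i)) = 0"
    by (simp add: xmN_def)
  have "P (a, b) * ?F = 0"
  proof (rule monomials_indep[OF _ _ s0])
    show "finite (fst ` {m'\<in>supp P. snd m' = b})" using weyl_algD(1)[OF P] by simp
    show "a \<in> fst ` {m'\<in>supp P. snd m' = b}" using m ab by force
    show "mi_ok n g" if "g \<in> fst ` {m'\<in>supp P. snd m' = b}" for g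
      using that weyl_algD(2)[OF P] by auto
  qed
  moreover have "P (a, b) \<noteq> 0" using m ab by (simp add: supp_def)
  ultimately show False by simp
qed

lemma op_inject:
  assumes P: "P \<in> weyl_alg n" and Q: "Q \<in> weyl_alg n" and e: "op P = op Q"
  shows "P = Q"
proof -
  let ?T = "supp P \<union> supp Q"
  let ?R = "\<lambda>m. P m - Q m"
  have fin: "finite ?T" using weyl_algD(1)[OF P] weyl_algD(1)[OF Q] by simp
  have sub: "supp ?R \<subseteq> ?T" by (auto simp: supp_def)
  have R: "?R \<in> weyl_alg n"
  proof -
    have "mi_ok n a \<and> mi_ok n b" if "P (a, b) - Q (a, b) \<noteq> 0" for a b
      using that P Q by (cases "P (a, b) = 0") (auto simp: weyl_alg_def)
    thus ?thesis using finite_subset[OF sub fin] by (simp add: weyl_alg_def)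
  qed
  have "op ?R = op P - op Q"
    using op_eq_sum[OF fin sub] op_eq_sum[OF fin, of P] op_eq_sum[OF fin, of Q]
    by (simp add: kk_diff left_diff_distrib sum_subtractf)
  hence "?R = wzero" using op_inject_0[OF R] e by simp
  thus ?thesis by (simp add: wzero_def fun_eq_iff)
qed

end

section \<open>Generators of ideals of univariate polynomials\<close>

lemma monic_generator_exists:
  fixes B :: "complex poly set"
  assumes add: "\<And>p q. p \<in> B \<Longrightarrow> q \<in> B \<Longrightarrow> p + q \<in> B"
    and mult: "\<And>p q. p \<in> B \<Longrightarrow> q * p \<in> B"
    and nz: "p0 \<in> B" "p0 \<noteq> 0"
  obtains b where "lead_coeff b = 1" "\<And>p. p \<in> B \<longleftrightarrow> b dvd p"
proof -
  obtain q where q: "q \<in> B" "q \<noteq> 0" and min: "\<And>p. p \<in> B \<Longrightarrow> p \<noteq> 0 \<Longrightarrow> degree q \<le> degree p"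
    using ex_has_least_nat[of "\<lambda>p. p \<in> B \<and> p \<noteq> 0" p0 degree] nz by blast
  define b where "b = smult (inverse (lead_coeff q)) q"
  have b: "b \<in> B" using mult[OF q(1), of "[:inverse (lead_coeff q):]"] by (simp add: b_def)
  have lb: "lead_coeff b = 1" using q(2) by (simp add: b_def)
  have "p \<in> B \<longleftrightarrow> b dvd p" for p
  proof
    assume p: "p \<in> B"
    have "p mod b = p + (- (p div b)) * b" by (simp add: minus_div_mult_eq_mod[symmetric])
    hence r: "p mod b \<in> B" using add[OF p mult[OF b, of "- (p div b)"]] by simp
    have "p mod b = 0"
    proof (rule ccontr)
      assume nz: "p mod b \<noteq> 0"
      have "degree (p mod b) < degree b"
        using degree_mod_less[of b p] lb nz by (cases "b = 0") auto
      moreover have "degree b = degree q" using q(2) by (simp add: b_def)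
      ultimately show False using min[OF r nz] by simp
    qed
    thus "b dvd p" by (simp add: mod_eq_0_iff_dvd)
  next
    assume "b dvd p"
    thus "p \<in> B" using mult[OF b] by (metis dvd_def mult.commute)
  qed
  with lb show ?thesis by (rule that)
qed

lemma monic_generator_unique:
  fixes b b' :: "complex poly"
  assumes "lead_coeff b = 1" "lead_coeff b' = 1" "\<And>p. b dvd p \<longleftrightarrow> b' dvd p"
  shows "b = b'"
proof -
  obtain k where k: "b' = b * k" using assms(3)[of b'] by (auto simp: dvd_def)
  have nz: "b \<noteq> 0" "b' \<noteq> 0" using assms(1,2) by auto
  have "b' dvd b" using assms(3)[of b] by simp
  hence "degree b' \<le> degree b" using nz(1) by (rule dvd_imp_degree_le)
  moreover have "k \<noteq> 0" using k nz by auto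
  ultimately have "degree k = 0" using k nz by (simp add: degree_mult_eq)
  then obtain c where c: "k = [:c:]" by (metis degree_eq_zeroE)
  have "lead_coeff b' = lead_coeff b * lead_coeff k" using k by (simp add: lead_coeff_mult)
  hence "c = 1" using c assms(1,2) by simp
  thus ?thesis using k c by simp
qed

lemma bfun_eqI:
  assumes "lead_coeff b = 1" "\<And>p. p \<in> bideal n w I \<longleftrightarrow> b dvd p"
  shows "bfun n w I = b"
  unfolding bfun_def
proof (rule the_equality)
  fix b' assume "lead_coeff b' = 1 \<and> (\<forall>p. p \<in> bideal n w I \<longleftrightarrow> b' dvd p)"
  thus "b' = b" using assms by (intro monic_generator_unique) auto
qed (use assms in simp)

section \<open>Initial ideals as ideals of operators\<close>

lemma in_w_in_weyl_alg:
  assumes "P \<in> weyl_alg n"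
  shows "in_w n w P \<in> weyl_alg n"
proof -
  have "supp (in_w n w P) \<subseteq> supp P" by (auto simp: supp_def in_w_def)
  thus ?thesis using assms finite_subset by (auto simp: weyl_alg_def in_w_def split: if_splits)
qed

lemma euler_in_weyl_alg: "euler n w \<in> weyl_alg n"
proof -
  have ok: "\<exists>i<n. m = (unitv i, unitv i)" if "euler n w m \<noteq> 0" for m
  proof -
    from that obtain i where "i \<in> {..<n}"
      "complex_of_real (w i) * (if m = (unitv i, unitv i) then 1 else 0) \<noteq> 0"
      unfolding euler_def by (rule sum.not_neutral_contains_not_neutral)
    thus ?thesis by (auto split: if_splits)
  qed
  hence "supp (euler n w) \<subseteq> (\<lambda>i. (unitv i, unitv i)) ` {..<n}" by (auto simp: supp_def)
  hence "finite (supp (euler n w))" by (rule finite_subset) simp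
  moreover have "mi_ok n a \<and> mi_ok n b" if "euler n w (a, b) \<noteq> 0" for a b
    using ok[OF that] by (auto simp: mi_ok_def unitv_def)
  ultimately show ?thesis by (simp add: weyl_alg_def)
qed

context diff_field
begin

definition W :: "'a endo set" where "W = op ` weyl_alg n"

lemma sum_kk_M_in_W:
  assumes "finite T" "\<And>j. j \<in> T \<Longrightarrow> mi_ok n (fst (h j)) \<and> mi_ok n (snd (h j))"
  shows "(\<Sum>j\<in>T. kk (v j) * M (h j)) \<in> W"
proof -
  let ?P = "\<lambda>m. \<Sum>j\<in>T. if h j = m then v j else 0"
  have sub: "supp ?P \<subseteq> h ` T" by (rule supp_collect)
  have "mi_ok n a \<and> mi_ok n b" if "?P (a, b) \<noteq> 0" for a b
  proof -
    have "(a, b) \<in> h ` T" using sub that by (auto simp: supp_def)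
    thus ?thesis using assms(2) by (metis fst_conv imageE snd_conv)
  qed
  hence "?P \<in> weyl_alg n" using finite_subset[OF sub] assms(1) by (simp add: weyl_alg_def)
  thus ?thesis unfolding W_def op_collect[OF assms(1), symmetric] by blast
qed

lemma kk_M_in_W: "mi_ok n (fst m) \<Longrightarrow> mi_ok n (snd m) \<Longrightarrow> kk c * M m \<in> W"
  using sum_kk_M_in_W[of "{()}" "\<lambda>_. m" "\<lambda>_. c"] by simp

lemma M_in_W: "mi_ok n (fst m) \<Longrightarrow> mi_ok n (snd m) \<Longrightarrow> M m \<in> W"
  using kk_M_in_W[of m 1] by simp

lemma kk_in_W: "kk c \<in> W"
  using kk_M_in_W[of "(\<lambda>_. 0, \<lambda>_. 0)" c] by (simp add: M_0 mi_ok_def)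

lemma W_mult: "A \<in> W \<Longrightarrow> B \<in> W \<Longrightarrow> A * B \<in> W"
  unfolding W_def by (auto simp: op_wmult[symmetric] intro!: imageI wmult_in_weyl_alg)

lemma wadd_in_weyl_alg:
  assumes "P \<in> weyl_alg n" "Q \<in> weyl_alg n"
  shows "wadd P Q \<in> weyl_alg n"
proof -
  have "supp (wadd P Q) \<subseteq> supp P \<union> supp Q" by (auto simp: supp_def wadd_def)
  hence "finite (supp (wadd P Q))"
    using assms by (metis finite_UnI finite_subset weyl_algD(1))
  moreover have "mi_ok n a \<and> mi_ok n b" if "wadd P Q (a, b) \<noteq> 0" for a b
    using that assms by (cases "P (a, b) = 0") (auto simp: weyl_alg_def wadd_def)
  ultimately show ?thesis by (simp add: weyl_alg_def)
qed

lemma W_add: "A \<in> W \<Longrightarrow> B \<in> W \<Longrightarrow> A + B \<in> W"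
  unfolding W_def by (auto simp: op_wadd[symmetric] weyl_algD(1) intro!: imageI wadd_in_weyl_alg)

lemma W_0: "0 \<in> W" using kk_in_W[of 0] by simp

lemma W_sum: "(\<And>t. t \<in> T \<Longrightarrow> h t \<in> W) \<Longrightarrow> sum h T \<in> W"
  by (induction T rule: infinite_finite_induct) (auto simp: W_0 W_add)

lemma kk_W: "A \<in> W \<Longrightarrow> kk c * A = A * kk c"
proof -
  assume "A \<in> W"
  then obtain P where "A = op P" unfolding W_def by blast
  moreover have "kk c * (kk a * M m) = kk a * M m * kk c" for a m
    by (metis kk_kk kk_M mult.assoc)
  ultimately show ?thesis by (simp add: op_def sum_distrib_left sum_distrib_right)
qed

section \<open>The Euler operator and homogeneity with respect to it\<close>

definition S :: "(nat \<Rightarrow> real) \<Rightarrow> 'a endo" where "S w = op (euler n w)"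

text \<open>Degree is read off from the commutator with the Euler operator, so it adds under
  products by the Leibniz rule; \<open>M m\<close> has degree minus its weight. Commutation with
  constants is included because an \<open>endo\<close> need not be linear and
  \<open>graded_mult\<close> has to move a scalar past \<open>A\<close>.\<close>

definition graded :: "(nat \<Rightarrow> real) \<Rightarrow> real \<Rightarrow> 'a endo \<Rightarrow> bool" where
  "graded w c A \<longleftrightarrow> S w * A = A * S w + kk (of_real c) * A \<and> (\<forall>e. kk e * A = A * kk e)"

lemma S_in_W: "S w \<in> W" unfolding S_def W_def using euler_in_weyl_alg by blast

lemma xmN_unitv: "i < N \<Longrightarrow> xmN N (unitv i) = x i"
proof -
  assume "i < N"
  have "xmN N (unitv i) = (\<Prod>j<N. if j = i then x i else 1)"
    unfolding xmN_def unitv_def by (intro prod.cong) auto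
  thus ?thesis using \<open>i < N\<close> by simp
qed

lemma DN_zero: "(\<And>j. j < N \<Longrightarrow> b j = 0) \<Longrightarrow> DN N b = 1"
  by (induction N) (auto simp: DN_Suc)

lemma DN_unitv: "i < N \<Longrightarrow> DN N (unitv i) = D i"
proof (induction N)
  case (Suc N)
  show ?case
  proof (cases "i = N")
    case True
    hence "DN N (unitv i) = 1" by (intro DN_zero) (auto simp: unitv_def)
    thus ?thesis using True by (simp add: DN_Suc unitv_def)
  next
    case False
    hence "DN N (unitv i) = D i" using Suc by auto
    thus ?thesis using False by (simp add: DN_Suc unitv_def)
  qed
qed simp

lemma S_eq: "S w = (\<Sum>i<n. kk (of_real (w i)) * M (unitv i, unitv i))"
proof -
  have "euler n w = (\<lambda>m. \<Sum>i<n. if (unitv i, unitv i) = m then complex_of_real (w i) else 0)"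
    unfolding euler_def by (intro ext sum.cong) auto
  thus ?thesis unfolding S_def by (simp only: op_collect[OF finite_lessThan])
qed

lemma app_S: "app (S w) u = (\<Sum>i<n. \<kappa> (of_real (w i)) * (x i * d i u))"
  unfolding S_eq app_sum_left by (intro sum.cong) (auto simp: M_def xmN_unitv DN_unitv)

lemma d_sum: "d i (sum h T) = (\<Sum>t\<in>T. d i (h t))"
  by (induction T rule: infinite_finite_induct) (auto simp: d_simps)

lemma app_S_mult: "app (S w) (u * v) = app (S w) u * v + u * app (S w) v"
  by (simp add: app_S d_simps sum_distrib_left sum_distrib_right sum.distrib[symmetric] algebra_simps)

lemma app_S_x: "i < n \<Longrightarrow> app (S w) (x i) = \<kappa> (of_real (w i)) * x i"
proof -
  assume "i < n"
  have "app (S w) (x i) = (\<Sum>j<n. if j = i then \<kappa> (of_real (w i)) * x i else 0)"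
    unfolding app_S by (intro sum.cong) (auto simp: d_x)
  thus ?thesis using \<open>i < n\<close> by simp
qed

lemma graded_mult:
  assumes A: "graded w c A" and B: "graded w e B"
  shows "graded w (c + e) (A * B)"
  unfolding graded_def
proof (intro conjI allI)
  have SA: "S w * A = A * S w + kk (of_real c) * A" and SB: "S w * B = B * S w + kk (of_real e) * B"
    and kA: "kk a * A = A * kk a" and kB: "kk a * B = B * kk a" for a
    using A B by (auto simp: graded_def)
  have "S w * (A * B) = A * (S w * B) + kk (of_real c) * A * B"
    by (simp only: mult.assoc[symmetric] SA distrib_right)
  also have "\<dots> = A * B * S w + (A * kk (of_real e)) * B + kk (of_real c) * A * B"
    by (simp only: SB distrib_left mult.assoc)
  also have "\<dots> = A * B * S w + kk (of_real (c + e)) * (A * B)"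
    by (simp only: kA[symmetric] of_real_add kk_add distrib_right mult.assoc add.assoc add.commute[of "kk (of_real e) * _"])
  finally show "S w * (A * B) = A * B * S w + kk (of_real (c + e)) * (A * B)" .
  show "kk a * (A * B) = A * B * kk a" for a
    by (simp only: mult.assoc[symmetric] kA) (simp only: mult.assoc kB)
qed

lemma graded_1: "graded w 0 1" by (simp add: graded_def)

lemma graded_power: "graded w c A \<Longrightarrow> graded w (real k * c) (A ^ k)"
proof (induction k)
  case (Suc k)
  from graded_mult[OF Suc.prems Suc.IH[OF Suc.prems]] show ?case by (simp add: distrib_right)
qed (simp add: graded_1)

lemma graded_x: "i < n \<Longrightarrow> graded w (w i) (mu (x i))"
  unfolding graded_def
  by (auto intro!: endo_eqI simp: app_S_mult app_S_x algebra_simps)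

lemma graded_D: "i < n \<Longrightarrow> graded w (- w i) (D i)"
proof -
  assume i: "i < n"
  have "app (S w) (d i u) = d i (app (S w) u) - \<kappa> (of_real (w i)) * d i u" for u
  proof -
    have "d i (app (S w) u) = (\<Sum>j<n. \<kappa> (of_real (w j)) * (x j * d j (d i u)) +
        (if j = i then \<kappa> (of_real (w i)) * d i u else 0))"
      unfolding app_S d_sum
      by (intro sum.cong refl) (auto simp: d_simps d_x d_commute[of i] algebra_simps)
    thus ?thesis using i by (simp add: sum.distrib app_S)
  qed
  thus ?thesis unfolding graded_def
    by (auto intro!: endo_eqI simp: kk_D \<kappa>_uminus d_simps)
qed

lemma graded_xmN: "N \<le> n \<Longrightarrow> graded w (\<Sum>i<N. w i * real (a i)) (mu (xmN N a))"
proof (induction N)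
  case (Suc N)
  from graded_mult[OF Suc.IH graded_power[OF graded_x[of N w], of "a N"]] Suc.prems
  show ?case by (simp add: xmN_Suc mu_mult mu_power mult.commute)
qed (simp add: graded_1)

lemma graded_DN: "N \<le> n \<Longrightarrow> graded w (- (\<Sum>i<N. w i * real (b i))) (DN N b)"
proof (induction N)
  case (Suc N)
  from graded_mult[OF Suc.IH graded_power[OF graded_D[of N w], of "b N"]] Suc.prems
  show ?case by (simp add: DN_Suc mult.commute)
qed (simp add: graded_1)

lemma graded_M: "graded w (- weight n w m) (M m)"
proof -
  have "- weight n w m = (\<Sum>i<n. w i * real (fst m i)) + - (\<Sum>i<n. w i * real (snd m i))"
    by (simp add: weight_def right_diff_distrib sum_subtractf)
  thus ?thesis unfolding M_def by (simp only: graded_mult graded_xmN graded_DN order_refl)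
qed

lemma graded_kk_M: "graded w (- weight n w m) (kk c * M m)"
proof -
  have "graded w 0 (kk c)"
    unfolding graded_def by (simp add: kk_W[OF S_in_W] kk_kk)
  from graded_mult[OF this graded_M] show ?thesis by simp
qed

lemma graded_sum: "(\<And>t. t \<in> T \<Longrightarrow> graded w c (h t)) \<Longrightarrow> graded w c (sum h T)"
  by (simp add: graded_def sum_distrib_left sum_distrib_right sum.distrib)

lemma graded_in_w: "graded w (- Max (weight n w ` supp P)) (op (in_w n w P))"
  unfolding op_def
proof (rule graded_sum)
  fix m assume "m \<in> supp (in_w n w P)"
  hence "weight n w m = Max (weight n w ` supp P)" by (auto simp: supp_def in_w_def split: if_splits)
  thus "graded w (- Max (weight n w ` supp P)) (kk (in_w n w P m) * M m)"
    using graded_kk_M[of w m] by simp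
qed

section \<open>The initial ideal inside the operator algebra\<close>

definition J :: "(nat \<Rightarrow> real) \<Rightarrow> weyl set \<Rightarrow> 'a endo set" where "J w I = op ` in_ideal n w I"

lemma in_ideal_subset: "I \<subseteq> weyl_alg n \<Longrightarrow> in_ideal n w I \<subseteq> weyl_alg n"
proof
  fix P assume I: "I \<subseteq> weyl_alg n" and P: "P \<in> in_ideal n w I"
  from P show "P \<in> weyl_alg n" unfolding in_ideal_def
  proof (induction rule: lgen.induct)
    case lgen_zero
    show ?case by (simp add: weyl_alg_def wzero_def supp_def)
  next
    case (lgen_gen s Q)
    thus ?case using I by (auto intro!: wmult_in_weyl_alg in_w_in_weyl_alg)
  next
    case (lgen_add a b)
    thus ?case by (auto intro: wadd_in_weyl_alg)
  qed
qed

lemma J_0: "0 \<in> J w I"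
  unfolding J_def in_ideal_def by (rule image_eqI[where x = wzero]) (simp_all add: lgen_zero)

lemma J_add:
  assumes I: "I \<subseteq> weyl_alg n" and A: "A \<in> J w I" and B: "B \<in> J w I"
  shows "A + B \<in> J w I"
proof -
  obtain P Q where P: "A = op P" "P \<in> in_ideal n w I" and Q: "B = op Q" "Q \<in> in_ideal n w I"
    using A B by (auto simp: J_def)
  have "wadd P Q \<in> in_ideal n w I" using P(2) Q(2) unfolding in_ideal_def by (rule lgen_add)
  moreover have "op (wadd P Q) = A + B"
    using P Q in_ideal_subset[OF I] by (auto intro!: op_wadd weyl_algD(1))
  ultimately show ?thesis unfolding J_def by (blast intro: sym)
qed

lemma J_sum: "I \<subseteq> weyl_alg n \<Longrightarrow> (\<And>t. t \<in> T \<Longrightarrow> h t \<in> J w I) \<Longrightarrow> sum h T \<in> J w I"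
  by (induction T rule: infinite_finite_induct) (auto simp: J_0 J_add)

lemma J_generator:
  assumes I: "I \<subseteq> weyl_alg n" and P: "P \<in> I" "P \<noteq> wzero" and A: "A \<in> W"
  shows "A * op (in_w n w P) \<in> J w I"
proof -
  obtain Q where Q: "A = op Q" "Q \<in> weyl_alg n" using A by (auto simp: W_def)
  have "wmult Q (in_w n w P) \<in> in_ideal n w I"
    unfolding in_ideal_def by (rule lgen_gen) (use P Q in auto)
  moreover have "op (wmult Q (in_w n w P)) = A * op (in_w n w P)"
    unfolding Q(1) by (rule op_wmult) (use Q(2) I P(1) in_w_in_weyl_alg in auto)
  ultimately show ?thesis unfolding J_def by (blast intro: sym)
qed

lemma J_induct [consumes 2, case_names zero gen add]:
  assumes I: "I \<subseteq> weyl_alg n" and A: "A \<in> J w I"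
    and "R 0" "\<And>B P. B \<in> W \<Longrightarrow> P \<in> I \<Longrightarrow> P \<noteq> wzero \<Longrightarrow> R (B * op (in_w n w P))"
    and "\<And>B C. R B \<Longrightarrow> R C \<Longrightarrow> R (B + C)"
  shows "R A"
proof -
  obtain P where P: "A = op P" "P \<in> in_ideal n w I" using A by (auto simp: J_def)
  have "R (op P)" using P(2) unfolding in_ideal_def
  proof (induction rule: lgen.induct)
    case lgen_zero
    show ?case using assms(3) by simp
  next
    case (lgen_gen s Q)
    then obtain P' where P': "s = in_w n w P'" "P' \<in> I" "P' \<noteq> wzero" by blast
    have "op (wmult Q s) = op Q * op s"
      by (rule op_wmult) (use lgen_gen P' I in_w_in_weyl_alg in auto)
    thus ?case using assms(4)[of "op Q" P'] P' lgen_gen(2) by (auto simp: W_def)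
  next
    case (lgen_add a b)
    have "a \<in> weyl_alg n" "b \<in> weyl_alg n"
      using lgen_add(1,2) in_ideal_subset[OF I, of w] by (auto simp: in_ideal_def)
    thus ?case using assms(5) lgen_add(3,4) by (simp add: op_wadd weyl_algD(1))
  qed
  thus ?thesis using P by simp
qed

lemma J_left:
  assumes I: "I \<subseteq> weyl_alg n" and A: "A \<in> W" and B: "B \<in> J w I"
  shows "A * B \<in> J w I"
  using I B
proof (induction rule: J_induct)
  case (gen B P)
  thus ?case using J_generator[OF I gen(2,3) W_mult[OF A gen(1)]] by (simp add: mult.assoc)
qed (auto simp: J_0 distrib_left J_add[OF I])

text \<open>A generator A of degree c satisfies A S = (S - c) A, so a factor S on the right moves to
  the left of the generator, where the left ideal absorbs it.\<close>

lemma J_right_S: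
  assumes I: "I \<subseteq> weyl_alg n" and B: "B \<in> J w I"
  shows "B * S w \<in> J w I"
  using I B
proof (induction rule: J_induct)
  case (gen B P)
  let ?c = "- Max (weight n w ` supp P)"
  have "op (in_w n w P) * S w = (S w + kk (- of_real ?c)) * op (in_w n w P)"
    using graded_in_w[of w P] by (simp add: graded_def distrib_right kk_uminus)
  hence "B * op (in_w n w P) * S w = (B * (S w + kk (- of_real ?c))) * op (in_w n w P)"
    by (simp only: mult.assoc)
  thus ?case
    using J_generator[OF I gen(2,3), of "B * (S w + kk (- of_real ?c))"]
    by (simp add: W_mult W_add gen S_in_W kk_in_W)
qed (auto simp: J_0 distrib_right J_add[OF I])

lemma J_right_S_power:
  "I \<subseteq> weyl_alg n \<Longrightarrow> B \<in> J w I \<Longrightarrow> B * S w ^ k \<in> J w I"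
  by (induction k) (auto simp: power_Suc2 mult.assoc[symmetric] J_right_S simp del: power_Suc)

lemma J_uminus: "I \<subseteq> weyl_alg n \<Longrightarrow> A \<in> J w I \<Longrightarrow> - A \<in> J w I"
  using J_left[of I "kk (- 1)" A w] kk_in_W[of "- 1"] by (simp add: kk_uminus)

lemma J_diff: "I \<subseteq> weyl_alg n \<Longrightarrow> A \<in> J w I \<Longrightarrow> B \<in> J w I \<Longrightarrow> A - B \<in> J w I"
  using J_add[of I A w "- B"] J_uminus[of I B w] by simp

section \<open>Polynomials in the Euler operator and the ideal defining the b-function\<close>

definition evS :: "(nat \<Rightarrow> real) \<Rightarrow> complex poly \<Rightarrow> 'a endo" where
  "evS w p = (\<Sum>k\<le>degree p. kk (coeff p k) * S w ^ k)"

lemma evS_ge: "degree p \<le> N \<Longrightarrow> evS w p = (\<Sum>k\<le>N. kk (coeff p k) * S w ^ k)"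
  unfolding evS_def by (rule sum.mono_neutral_left) (auto simp: coeff_eq_0)

lemma evS_0 [simp]: "evS w 0 = 0" by (simp add: evS_def)

lemma evS_add: "evS w (p + q) = evS w p + evS w q"
proof -
  let ?N = "max (degree p) (degree q)"
  have "degree (p + q) \<le> ?N" by (rule degree_add_le_max)
  thus ?thesis
    by (simp add: evS_ge[of _ ?N] kk_add distrib_right sum.distrib)
qed

lemma evS_smult: "evS w (smult a p) = kk a * evS w p"
  by (simp add: evS_ge[of "smult a p" "degree p"] evS_def kk_mult sum_distrib_left mult.assoc)

lemma evS_pCons: "evS w (pCons a p) = kk a + S w * evS w p"
proof -
  have "evS w (pCons a p) = (\<Sum>k\<le>Suc (degree p). kk (coeff (pCons a p) k) * S w ^ k)"
    by (rule evS_ge) (simp add: degree_pCons_le)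
  also have "\<dots> = kk a + (\<Sum>k\<le>degree p. S w * (kk (coeff p k) * S w ^ k))"
    unfolding sum.atMost_Suc_shift
    by (simp add: mult.assoc[symmetric] kk_W[OF S_in_W])
  finally show ?thesis by (simp add: evS_def sum_distrib_left)
qed

lemma wpow_euler: "wpow (euler n w) k \<in> weyl_alg n \<and> op (wpow (euler n w) k) = S w ^ k"
proof (induction k)
  case 0
  have "supp wone \<subseteq> {(\<lambda>_. 0, \<lambda>_. 0)}" by (auto simp: supp_def wone_def)
  hence "finite (supp wone)" by (rule finite_subset) simp
  hence "wone \<in> weyl_alg n" by (auto simp: weyl_alg_def wone_def mi_ok_def split: if_splits)
  thus ?case by (simp add: wpow_def op_wone)
next
  case (Suc k)
  have "wpow (euler n w) (Suc k) = wmult (euler n w) (wpow (euler n w) k)"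
    by (simp add: wpow_def)
  thus ?case using Suc by (simp add: wmult_in_weyl_alg euler_in_weyl_alg op_wmult S_def)
qed

lemma weyl_of_poly_op:
  "weyl_of_poly n w p \<in> weyl_alg n \<and> op (weyl_of_poly n w p) = evS w p"
proof -
  let ?E = "\<lambda>k. wpow (euler n w) k"
  define T where "T = (\<Union>k\<le>degree p. supp (?E k))"
  have finT: "finite T" unfolding T_def using wpow_euler weyl_algD(1) by blast
  have Tok: "mi_ok n (fst m) \<and> mi_ok n (snd m)" if "m \<in> T" for m
    using that wpow_euler weyl_algD(2,3) unfolding T_def by blast
  have sub: "supp (weyl_of_poly n w p) \<subseteq> T"
  proof
    fix m assume "m \<in> supp (weyl_of_poly n w p)"
    hence "(\<Sum>k\<le>degree p. coeff p k * ?E k m) \<noteq> 0" by (simp add: supp_def weyl_of_poly_def)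
    then obtain k where "k \<in> {..degree p}" "coeff p k * ?E k m \<noteq> 0"
      by (rule sum.not_neutral_contains_not_neutral)
    thus "m \<in> T" unfolding T_def by (auto simp: supp_def)
  qed
  have "mi_ok n a \<and> mi_ok n b" if "weyl_of_poly n w p (a, b) \<noteq> 0" for a b
    using Tok[of "(a, b)"] sub that by (auto simp: supp_def)
  hence 1: "weyl_of_poly n w p \<in> weyl_alg n"
    using finite_subset[OF sub finT] by (simp add: weyl_alg_def)
  have "op (weyl_of_poly n w p) = (\<Sum>m\<in>T. kk (weyl_of_poly n w p m) * M m)"
    by (rule op_eq_sum[OF finT sub])
  also have "\<dots> = (\<Sum>m\<in>T. \<Sum>k\<le>degree p. kk (coeff p k) * (kk (?E k m) * M m))"
    by (simp add: weyl_of_poly_def kk_sum kk_mult sum_distrib_right mult.assoc)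
  also have "\<dots> = (\<Sum>k\<le>degree p. kk (coeff p k) * (\<Sum>m\<in>T. kk (?E k m) * M m))"
    by (subst sum.swap) (simp add: sum_distrib_left)
  also have "\<dots> = (\<Sum>k\<le>degree p. kk (coeff p k) * S w ^ k)"
  proof (intro sum.cong refl)
    fix k assume "k \<in> {..degree p}"
    hence "supp (?E k) \<subseteq> T" unfolding T_def by blast
    hence "(\<Sum>m\<in>T. kk (?E k m) * M m) = S w ^ k"
      using op_eq_sum[OF finT] wpow_euler by metis
    thus "kk (coeff p k) * (\<Sum>m\<in>T. kk (?E k m) * M m) = kk (coeff p k) * S w ^ k" by simp
  qed
  finally show ?thesis using 1 by (simp add: evS_def)
qed

text \<open>The converse rests on faithfulness of \<open>op\<close>: a member of the initial ideal
  with the same image as the polynomial in the Euler operator is equal to it.\<close>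

lemma bideal_iff:
  assumes "I \<subseteq> weyl_alg n"
  shows "p \<in> bideal n w I \<longleftrightarrow> evS w p \<in> J w I"
proof
  assume "p \<in> bideal n w I"
  thus "evS w p \<in> J w I" unfolding bideal_def J_def by (metis imageI mem_Collect_eq weyl_of_poly_op)
next
  assume "evS w p \<in> J w I"
  then obtain P where P: "evS w p = op P" "P \<in> in_ideal n w I" by (auto simp: J_def)
  hence "weyl_of_poly n w p = P"
    using op_inject[of "weyl_of_poly n w p" P] weyl_of_poly_op in_ideal_subset[OF assms] by auto
  thus "p \<in> bideal n w I" using P by (simp add: bideal_def)
qed

lemma bideal_add:
  "I \<subseteq> weyl_alg n \<Longrightarrow> p \<in> bideal n w I \<Longrightarrow> q \<in> bideal n w I \<Longrightarrow> p + q \<in> bideal n w I"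
  by (simp add: bideal_iff evS_add J_add)

lemma bideal_mult:
  assumes I: "I \<subseteq> weyl_alg n" and p: "p \<in> bideal n w I"
  shows "q * p \<in> bideal n w I"
proof (induction q)
  case 0
  show ?case by (simp add: bideal_iff[OF I] J_0)
next
  case (pCons a q)
  have "evS w (pCons a q * p) = kk a * evS w p + S w * evS w (q * p)"
    by (simp add: evS_add evS_smult evS_pCons)
  thus ?case using pCons.IH p
    by (simp add: bideal_iff[OF I] J_add[OF I] J_left[OF I] kk_in_W S_in_W)
qed

text \<open>The nonzero member \<open>p0\<close> makes the description in \<open>bfun\<close>
  meaningful: if \<open>bideal\<close> were zero, a monic \<open>b\<close> as described would divide
  itself, hence lie in \<open>bideal\<close>, hence vanish.\<close>

lemma bfun_root:
  assumes I: "I \<subseteq> weyl_alg n" and nz: "p0 \<in> bideal n w I" "p0 \<noteq> 0"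
    and root: "\<And>p. p \<in> bideal n w I \<Longrightarrow> poly p c = 0"
  shows "poly (bfun n w I) c = 0"
proof -
  obtain b where b: "lead_coeff b = 1" "\<And>p. p \<in> bideal n w I \<longleftrightarrow> b dvd p"
    using monic_generator_exists[OF bideal_add[OF I] bideal_mult[OF I] nz] by blast
  hence "bfun n w I = b" by (rule bfun_eqI)
  thus ?thesis using root b by simp
qed

lemma bfun_linear:
  assumes I: "I \<subseteq> weyl_alg n" and lin: "[:- c, 1:] \<in> bideal n w I"
    and root: "\<And>p. p \<in> bideal n w I \<Longrightarrow> poly p c = 0"
  shows "bfun n w I = [:- c, 1:]"
proof (rule bfun_eqI)
  fix p
  show "p \<in> bideal n w I \<longleftrightarrow> [:- c, 1:] dvd p"
    using root[of p] bideal_mult[OF I lin] by (metis dvd_def mult.commute poly_eq_0_iff_dvd)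
qed simp

end

section \<open>Existence of the b-function for ideals of small growth\<close>

text \<open>Gaussian elimination on one equation \<open>b\<close> with pivot \<open>a0\<close>: the
  unknown at \<open>a0\<close> is eliminated from the other equations, and its value is recovered
  afterwards from equation \<open>b\<close>.\<close>

lemma underdetermined_system:
  fixes c :: "'b \<Rightarrow> 'c \<Rightarrow> complex"
  assumes "finite B" "finite A" "card B < card A"
  shows "\<exists>v. (\<exists>a\<in>A. v a \<noteq> 0) \<and> (\<forall>b\<in>B. (\<Sum>a\<in>A. c b a * v a) = 0)"
  using assms
proof (induction B arbitrary: A c rule: finite_induct)
  case empty
  then obtain a where "a \<in> A" by fastforce
  thus ?case by (intro exI[of _ "\<lambda>_. 1"]) auto
next
  case (insert b B)
  show ?case
  proof (cases "\<forall>a\<in>A. c b a = 0")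
    case True
    have "card B < card A" using insert by simp
    then obtain v where "\<exists>a\<in>A. v a \<noteq> 0" "\<forall>b\<in>B. (\<Sum>a\<in>A. c b a * v a) = 0"
      using insert.IH[of A c] insert.prems by blast
    thus ?thesis using True by (intro exI[of _ v]) auto
  next
    case False
    then obtain a0 where a0: "a0 \<in> A" "c b a0 \<noteq> 0" by blast
    define A' where "A' = A - {a0}"
    have A: "A = insert a0 A'" "finite A'" "a0 \<notin> A'" using a0 insert.prems by (auto simp: A'_def)
    have "card B < card A'" using insert.prems insert.hyps A by simp
    then obtain v where v: "\<exists>a\<in>A'. v a \<noteq> 0"
      "\<forall>b'\<in>B. (\<Sum>a\<in>A'. (c b' a - c b' a0 * c b a / c b a0) * v a) = 0"
      using insert.IH[of A' "\<lambda>b' a. c b' a - c b' a0 * c b a / c b a0"] A(2) by blast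
    define s where "s = (\<Sum>a\<in>A'. c b a * v a)"
    define u where "u = v(a0 := - s / c b a0)"
    have sum_u: "(\<Sum>a\<in>A. c b' a * u a) = (\<Sum>a\<in>A'. c b' a * v a) - c b' a0 * s / c b a0" for b'
    proof -
      have "(\<Sum>a\<in>A'. c b' a * u a) = (\<Sum>a\<in>A'. c b' a * v a)"
        using A(3) by (intro sum.cong) (auto simp: u_def)
      thus ?thesis using A by (simp add: u_def)
    qed
    have "(\<Sum>a\<in>A. c b' a * u a) = 0" if "b' \<in> B" for b'
    proof -
      have "0 = (\<Sum>a\<in>A'. c b' a * v a - (c b' a0 / c b a0) * (c b a * v a))"
        using v(2) that by (simp add: algebra_simps)
      also have "\<dots> = (\<Sum>a\<in>A. c b' a * u a)"
        unfolding sum_u s_def by (simp add: sum_subtractf sum_distrib_left sum_divide_distrib)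
      finally show ?thesis by simp
    qed
    moreover have "(\<Sum>a\<in>A. c b a * u a) = 0"
      unfolding sum_u using a0 by (simp add: s_def)
    moreover have "\<exists>a\<in>A. u a \<noteq> 0" using v(1) A by (auto simp: u_def)
    ultimately show ?thesis by blast
  qed
qed

section \<open>Counting exponents in cubes and by total degree\<close>

definition Box :: "nat \<Rightarrow> nat \<Rightarrow> mi set" where
  "Box n t = {a. mi_ok n a \<and> (\<forall>i<n. a i \<le> t)}"

lemma bij_Box: "bij_betw (\<lambda>f i. if i < n then f i else 0) (PiE {..<n} (\<lambda>_. {..t})) (Box n t)"
  by (rule bij_betw_byWitness[where f' = "\<lambda>a. restrict a {..<n}"])
    (auto simp: Box_def mi_ok_def PiE_def extensional_def fun_eq_iff restrict_def)

lemma card_Box: "card (Box n t) = (t + 1) ^ n"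
  using bij_betw_same_card[OF bij_Box[of n t]] by (simp add: card_PiE)

lemma finite_Box: "finite (Box n t)"
  using bij_betw_finite[OF bij_Box[of n t]] by (simp add: finite_PiE)

definition Mon :: "nat \<Rightarrow> nat \<Rightarrow> (mi \<times> mi) set" where
  "Mon n k = {m. mi_ok n (fst m) \<and> mi_ok n (snd m) \<and> (\<Sum>i<n. fst m i + snd m i) \<le> k}"

lemma finite_Mon: "finite (Mon n k)"
proof (rule finite_subset)
  show "Mon n k \<subseteq> Box n k \<times> Box n k"
  proof
    fix m assume m: "m \<in> Mon n k"
    have "fst m i + snd m i \<le> k" if "i < n" for i
    proof -
      have "fst m i + snd m i \<le> (\<Sum>i<n. fst m i + snd m i)"
        using that by (intro member_le_sum) auto
      thus ?thesis using m by (simp add: Mon_def)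
    qed
    hence "fst m i \<le> k \<and> snd m i \<le> k" if "i < n" for i using that by fastforce
    thus "m \<in> Box n k \<times> Box n k" using m by (cases m) (auto simp: Mon_def Box_def)
  qed
qed (simp add: finite_Box)

text \<open>The cube of side \<open>K\<close> in all \<open>2 * n\<close> exponents has total degree
  at most \<open>2 * n * K\<close>. This crude bound has the right order of growth without binomial
  coefficients.\<close>

lemma card_Mon_ge: "(K + 1) ^ (2 * n) \<le> card (Mon n (2 * n * K))"
proof -
  have "Box n K \<times> Box n K \<subseteq> Mon n (2 * n * K)"
  proof
    fix m assume m: "m \<in> Box n K \<times> Box n K"
    have "(\<Sum>i<n. fst m i + snd m i) \<le> (\<Sum>i<n. 2 * K)"
    proof (rule sum_mono)
      fix i assume "i \<in> {..<n}"
      hence "fst m i \<le> K" "snd m i \<le> K" using m by (auto simp: Box_def)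
      thus "fst m i + snd m i \<le> 2 * K" by simp
    qed
    thus "m \<in> Mon n (2 * n * K)" using m by (auto simp: Mon_def Box_def algebra_simps)
  qed
  from card_mono[OF finite_Mon this] show ?thesis
    by (simp add: card_cartesian_product card_Box mult_2 power_add)
qed

section \<open>Products with a single generator, and the filtration by total degree\<close>

lemma unitv_simps [simp]: "unitv i i = 1" "j \<noteq> i \<Longrightarrow> unitv i j = 0"
  by (auto simp: unitv_def)

lemma mi_ok_unitv: "j < n \<Longrightarrow> mi_ok n (unitv j)"
  by (auto simp: mi_ok_def unitv_def)

lemma le_unitv_cases: "(\<forall>i. k i \<le> unitv j i) \<longleftrightarrow> k = (\<lambda>_. 0) \<or> k = unitv j"
proof
  assume k: "\<forall>i. k i \<le> unitv j i"
  have o: "k i = 0" if "i \<noteq> j" for i using k[rule_format, of i] that by simp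
  have "k j \<le> 1" using k[rule_format, of j] by simp
  hence "k j = 0 \<or> k j = 1" by auto
  thus "k = (\<lambda>_. 0) \<or> k = unitv j"
  proof
    assume "k j = 0"
    hence "k i = 0" for i using o[of i] by (cases "i = j") auto
    thus ?thesis by auto
  next
    assume "k j = 1"
    hence "k i = unitv j i" for i using o[of i] by (cases "i = j") auto
    thus ?thesis by auto
  qed
qed (auto simp: unitv_def)

lemma weylc_0 [simp]: "weylc b c (\<lambda>_. 0) = 1"
  by (simp add: weylc_def)

lemma weylc_unitv: "weylc b c (unitv j) = of_nat (b j * c j)"
proof -
  have "{i. unitv j i \<noteq> 0} = {j}" by (auto simp: unitv_def)
  thus ?thesis by (simp add: weylc_def)
qed

lemma sum_unitv: "j < n \<Longrightarrow> (\<Sum>i<n. unitv j i) = 1"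
  by (simp add: unitv_def)

context diff_field
begin

text \<open>Made for products with one generator. If \<open>unitv j\<close> is not an admissible
  contraction, then \<open>b j\<close> or \<open>a' j\<close> is zero and the second summand
  vanishes by itself, which spares a case distinction.\<close>

lemma M_mult_single_contraction:
  assumes b: "mi_ok n b" and a: "mi_ok n a'"
    and K: "{k. \<forall>i. k i \<le> min (b i) (a' i)} \<subseteq> {\<lambda>_. 0, unitv j}"
  shows "M (a, b) * M (a', b') = M (\<lambda>i. a i + a' i, \<lambda>i. b i + b' i) +
    kk (of_nat (b j * a' j)) * M (\<lambda>i. a i + a' i - unitv j i, \<lambda>i. b i + b' i - unitv j i)"
proof -
  define f where "f k = kk (weylc b a' k) * M (\<lambda>i. a i + a' i - k i, \<lambda>i. b i + b' i - k i)" for k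
  have "(\<lambda>_. 0) \<noteq> unitv j" by (metis unitv_simps(1) zero_neq_one)
  hence two: "sum f {\<lambda>_. 0, unitv j} = f (\<lambda>_. 0) + f (unitv j)" by simp
  have "M (a, b) * M (a', b') = sum f {k. \<forall>i. k i \<le> min (b i) (a' i)}"
    unfolding f_def by (rule M_mult[OF b a])
  also have "\<dots> = sum f {\<lambda>_. 0, unitv j}"
  proof (rule sum.mono_neutral_left[OF _ K])
    show "\<forall>k\<in>{\<lambda>_. 0, unitv j} - {k. \<forall>i. k i \<le> min (b i) (a' i)}. f k = 0"
    proof
      fix k assume k: "k \<in> {\<lambda>_. 0, unitv j} - {k. \<forall>i. k i \<le> min (b i) (a' i)}"
      hence ku: "k = unitv j" by auto
      hence "\<exists>i. \<not> unitv j i \<le> min (b i) (a' i)" using k by auto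
      hence "b j = 0 \<or> a' j = 0" by (auto simp: unitv_def min_def split: if_splits)
      thus "f k = 0" by (auto simp: ku f_def weylc_unitv)
    qed
  qed simp
  also have "\<dots> = M (\<lambda>i. a i + a' i, \<lambda>i. b i + b' i) +
      kk (of_nat (b j * a' j)) * M (\<lambda>i. a i + a' i - unitv j i, \<lambda>i. b i + b' i - unitv j i)"
    unfolding two by (simp add: f_def weylc_unitv)
  finally show ?thesis .
qed

lemma M_x_right:
  assumes "mi_ok n b" "j < n"
  shows "M (a, b) * M (unitv j, \<lambda>_. 0) = M (\<lambda>i. a i + unitv j i, b) + kk (of_nat (b j)) * M (a, \<lambda>i. b i - unitv j i)"
  using M_mult_single_contraction[OF assms(1) mi_ok_unitv[OF assms(2)], of j a "\<lambda>_. 0"]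
  by (simp add: le_unitv_cases[symmetric] Collect_mono_iff subset_iff)

lemma M_x_left:
  assumes "mi_ok n a" "j < n"
  shows "M (unitv j, \<lambda>_. 0) * M (a, b) = M (\<lambda>i. a i + unitv j i, b)"
  using M_mult_single_contraction[of "\<lambda>_. 0" a j "unitv j" b] assms
  by (simp add: mi_ok_def le_unitv_cases[symmetric] subset_iff add.commute)

lemma M_D_left:
  assumes "mi_ok n a" "j < n"
  shows "M (\<lambda>_. 0, unitv j) * M (a, b) = M (a, \<lambda>i. b i + unitv j i) + kk (of_nat (a j)) * M (\<lambda>i. a i - unitv j i, b)"
  using M_mult_single_contraction[OF mi_ok_unitv[OF assms(2)] assms(1), of j "\<lambda>_. 0" b]
  by (simp add: le_unitv_cases[symmetric] subset_iff add.commute)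

lemma M_D_right:
  assumes "mi_ok n b" "j < n"
  shows "M (a, b) * M (\<lambda>_. 0, unitv j) = M (a, \<lambda>i. b i + unitv j i)"
  using M_mult_single_contraction[of b "\<lambda>_. 0" j a "unitv j"] assms
  by (simp add: mi_ok_def le_unitv_cases[symmetric] subset_iff)

text \<open>The Bernstein filtration: coordinates and derivatives both have degree one, so each step
  is finite-dimensional and contractions in a product only lower the degree.\<close>

definition span :: "nat \<Rightarrow> 'a endo set" where
  "span k = range (\<lambda>v. \<Sum>m\<in>Mon n k. kk (v m) * M m)"

lemma spanI: "A = (\<Sum>m\<in>Mon n k. kk (v m) * M m) \<Longrightarrow> A \<in> span k"
  unfolding span_def by blast

lemma span_add: "A \<in> span k \<Longrightarrow> B \<in> span k \<Longrightarrow> A + B \<in> span k"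
proof -
  assume "A \<in> span k" "B \<in> span k"
  then obtain v u where "A = (\<Sum>m\<in>Mon n k. kk (v m) * M m)" "B = (\<Sum>m\<in>Mon n k. kk (u m) * M m)"
    by (auto simp: span_def)
  thus ?thesis
    by (intro spanI[where v = "\<lambda>m. v m + u m"]) (simp add: kk_add distrib_right sum.distrib)
qed

lemma span_kk: "A \<in> span k \<Longrightarrow> kk c * A \<in> span k"
proof -
  assume "A \<in> span k"
  then obtain v where "A = (\<Sum>m\<in>Mon n k. kk (v m) * M m)" by (auto simp: span_def)
  thus ?thesis
    by (intro spanI[where v = "\<lambda>m. c * v m"]) (simp add: kk_mult sum_distrib_left mult.assoc)
qed

lemma span_0: "0 \<in> span k" by (rule spanI[where v = "\<lambda>_. 0"]) simp

lemma span_sum: "(\<And>t. t \<in> T \<Longrightarrow> h t \<in> span k) \<Longrightarrow> sum h T \<in> span k"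
  by (induction T rule: infinite_finite_induct) (auto simp: span_0 span_add)

lemma M_in_span: "m \<in> Mon n k \<Longrightarrow> M m \<in> span k"
proof (rule spanI[where v = "\<lambda>m'. if m' = m then 1 else 0"])
  assume m: "m \<in> Mon n k"
  have "(\<Sum>m'\<in>Mon n k. kk (if m' = m then 1 else 0) * M m') = (\<Sum>m'\<in>Mon n k. if m' = m then M m else 0)"
    by (intro sum.cong) auto
  thus "M m = (\<Sum>m'\<in>Mon n k. kk (if m' = m then 1 else 0) * M m')"
    using m finite_Mon by simp
qed

lemma span_subset_W: "A \<in> span k \<Longrightarrow> A \<in> W"
  unfolding span_def by (auto simp: Mon_def finite_Mon intro!: W_sum kk_M_in_W)

lemma M_mult_in_span:
  assumes m: "m \<in> Mon n k" and m': "m' \<in> Mon n l"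
  shows "M m * M m' \<in> span (k + l)"
proof -
  have ok: "mi_ok n (fst m)" "mi_ok n (snd m)" "mi_ok n (fst m')" "mi_ok n (snd m')"
    and deg: "(\<Sum>i<n. fst m i + snd m i) \<le> k" "(\<Sum>i<n. fst m' i + snd m' i) \<le> l"
    using m m' by (auto simp: Mon_def)
  let ?t = "\<lambda>h. (\<lambda>i. fst m i + fst m' i - h i, \<lambda>i. snd m i + snd m' i - h i) :: mi \<times> mi"
  have "M m * M m' = (\<Sum>h | \<forall>i. h i \<le> min (snd m i) (fst m' i). kk (weylc (snd m) (fst m') h) * M (?t h))"
    using M_mult[OF ok(2,3), of "fst m" "snd m'"] by simp
  moreover have "?t h \<in> Mon n (k + l)" for h
  proof -
    have "(\<Sum>i<n. fst (?t h) i + snd (?t h) i) \<le> (\<Sum>i<n. (fst m i + snd m i) + (fst m' i + snd m' i))"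
      by (rule sum_mono) simp
    also have "\<dots> \<le> k + l" using deg by (simp only: sum.distrib[of "\<lambda>i. fst m i + snd m i"])
    finally show ?thesis using ok by (simp add: Mon_def mi_ok_def)
  qed
  ultimately show ?thesis by (simp add: span_sum span_kk M_in_span)
qed

lemma span_mult: "A \<in> span k \<Longrightarrow> B \<in> span l \<Longrightarrow> A * B \<in> span (k + l)"
proof -
  assume "A \<in> span k" "B \<in> span l"
  then obtain v u where A: "A = (\<Sum>m\<in>Mon n k. kk (v m) * M m)" and B: "B = (\<Sum>m\<in>Mon n l. kk (u m) * M m)"
    by (auto simp: span_def)
  have "kk (v m) * M m * (kk (u m') * M m') = kk (v m * u m') * (M m * M m')" for m m'
    by (metis (no_types, lifting) kk_M kk_mult mult.assoc)
  hence "A * B = (\<Sum>m\<in>Mon n k. \<Sum>m'\<in>Mon n l. kk (v m * u m') * (M m * M m'))"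
    by (simp add: A B sum_product)
  thus ?thesis by (simp add: span_sum span_kk M_mult_in_span)
qed

lemma span_mono: "k \<le> l \<Longrightarrow> A \<in> span k \<Longrightarrow> A \<in> span l"
proof -
  assume kl: "k \<le> l" and "A \<in> span k"
  then obtain v where A: "A = (\<Sum>m\<in>Mon n k. kk (v m) * M m)" by (auto simp: span_def)
  have "Mon n k \<subseteq> Mon n l" using kl by (auto simp: Mon_def)
  thus ?thesis unfolding A by (auto intro!: span_sum span_kk M_in_span)
qed

lemma S_in_span: "S w \<in> span 2"
  unfolding S_eq
  by (auto intro!: span_sum span_kk M_in_span simp: Mon_def mi_ok_unitv sum.distrib sum_unitv)

lemma one_in_span: "1 \<in> span 0"
  using M_in_span[of "(\<lambda>_. 0, \<lambda>_. 0)" 0] by (simp add: M_0 Mon_def mi_ok_def)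

lemma S_power_in_span: "S w ^ i \<in> span (2 * i)"
proof (induction i)
  case (Suc i)
  show ?case using span_mult[OF S_in_span[of w] Suc] by simp
qed (simp add: one_in_span)

end

lemma mi_ok_0: "mi_ok n (\<lambda>_. 0)"
  by (simp add: mi_ok_def)

context diff_field
begin

text \<open>Commutators with a generator lower the degree of an element of the algebra with coefficients
  in the polynomials in the Euler operator, and keep the property of annihilating the span modulo \<open>J\<close>.\<close>

lemma commutator_step:
  assumes I: "I \<subseteq> weyl_alg n" and y: "y \<in> span 1"
    and up: "inj_on up (Mon n k)" "up ` Mon n k \<subseteq> Mon n (Suc k)"
    and comm: "\<And>m. m \<in> Mon n k \<Longrightarrow> M (up m) * y = y * M (up m) + kk (cf m) * M m"
    and comm0: "\<And>m. m \<in> Mon n (Suc k) - up ` Mon n k \<Longrightarrow> M m * y = y * M m"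
    and E: "\<And>Q. Q \<in> span (Suc k) \<Longrightarrow> (\<Sum>m\<in>Mon n (Suc k). \<Sum>i\<le>L. kk (e m i) * (M m * Q * S w ^ i)) \<in> J w I"
    and Q: "Q \<in> span k"
  shows "(\<Sum>m\<in>Mon n k. \<Sum>i\<le>L. kk (cf m * e (up m) i) * (M m * Q * S w ^ i)) \<in> J w I"
proof -
  define F where "F A = (\<Sum>m\<in>Mon n (Suc k). \<Sum>i\<le>L. kk (e m i) * (M m * A * S w ^ i))" for A
  define G where "G m = (\<Sum>i\<le>L. kk (e m i) * ((M m * y - y * M m) * Q * S w ^ i))" for m
  have yW: "y \<in> W" by (rule span_subset_W[OF y])
  \<comment> \<open>Multiplication by \<open>y\<close> costs one degree, which is why the conclusion
    covers only \<open>Q\<close> of degree \<open>k\<close>. Subtracting \<open>y * F Q\<close>,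
    which stays in the left ideal, replaces each \<open>M m\<close> by its commutator with
    \<open>y\<close>.\<close>
  have "F (y * Q) \<in> J w I" "F Q \<in> J w I"
    unfolding F_def using span_mult[OF y Q] span_mono[OF _ Q, of "Suc k"] by (auto intro!: E)
  hence "F (y * Q) - y * F Q \<in> J w I" by (intro J_diff[OF I] J_left[OF I yW])
  also have "F (y * Q) - y * F Q = sum G (Mon n (Suc k))"
  proof -
    have "y * (kk c * (M m * Q * S w ^ i)) = kk c * (y * M m * Q * S w ^ i)" for c m i
      by (simp only: mult.assoc[symmetric] kk_W[OF yW])
    thus ?thesis
      by (simp add: F_def G_def sum_distrib_left sum_subtractf[symmetric] left_diff_distrib
          right_diff_distrib mult.assoc)
  qed
  also have "\<dots> = sum G (up ` Mon n k)"
  proof (rule sum.mono_neutral_right[OF finite_Mon up(2)], rule ballI)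
    fix m assume "m \<in> Mon n (Suc k) - up ` Mon n k"
    from comm0[OF this] show "G m = 0" by (simp add: G_def)
  qed
  also have "\<dots> = (\<Sum>m\<in>Mon n k. G (up m))" by (simp add: sum.reindex[OF up(1)])
  also have "\<dots> = (\<Sum>m\<in>Mon n k. \<Sum>i\<le>L. kk (cf m * e (up m) i) * (M m * Q * S w ^ i))"
  proof (intro sum.cong refl)
    fix m assume m: "m \<in> Mon n k"
    show "G (up m) = (\<Sum>i\<le>L. kk (cf m * e (up m) i) * (M m * Q * S w ^ i))"
      unfolding G_def comm[OF m] by (intro sum.cong refl) (simp only: add_diff_cancel_left' kk_mult kk_kk[of "cf m"] mult.assoc)
  qed
  finally show ?thesis .
qed

lemma polynomial_in_J:
  assumes "(\<Sum>i\<le>L. kk (c i) * S w ^ i) \<in> J w I" and "i0 \<le> L" "c i0 \<noteq> 0"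
  shows "\<exists>p. p \<noteq> 0 \<and> evS w p \<in> J w I"
proof -
  define p where "p = (\<Sum>i\<le>L. monom (c i) i)"
  have cp: "coeff p i = (if i \<le> L then c i else 0)" for i
    unfolding p_def coeff_sum coeff_monom by simp
  have "degree p \<le> L" by (rule degree_le) (simp add: cp)
  hence "evS w p = (\<Sum>i\<le>L. kk (coeff p i) * S w ^ i)" by (rule evS_ge)
  also have "\<dots> = (\<Sum>i\<le>L. kk (c i) * S w ^ i)" by (intro sum.cong) (auto simp: cp)
  finally have "evS w p = (\<Sum>i\<le>L. kk (c i) * S w ^ i)" .
  moreover have "p \<noteq> 0" using cp[of i0] assms by auto
  ultimately show ?thesis using assms(1) by auto
qed

text \<open>While a nonconstant monomial occurs, the commutator with the dual generator lowers the
  degree and multiplies a surviving coefficient by a nonzero exponent, so the family stays nonzero.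
  Once only the constant monomial is left, \<open>Q = 1\<close> exhibits the polynomial in
  \<open>S w\<close>.\<close>

lemma annihilator_of_span:
  assumes I: "I \<subseteq> weyl_alg n"
    and "\<exists>m\<in>Mon n k. \<exists>i\<le>L. e m i \<noteq> 0"
    and "\<And>Q. Q \<in> span k \<Longrightarrow> (\<Sum>m\<in>Mon n k. \<Sum>i\<le>L. kk (e m i) * (M m * Q * S w ^ i)) \<in> J w I"
  shows "\<exists>p. p \<noteq> 0 \<and> evS w p \<in> J w I"
  using assms(2,3)
proof (induction k arbitrary: e)
  let ?o = "(\<lambda>_. 0, \<lambda>_. 0) :: mi \<times> mi"
  have base: "\<exists>p. p \<noteq> 0 \<and> evS w p \<in> J w I"
    if nz: "i0 \<le> L" "e ?o i0 \<noteq> 0"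
      and z: "\<And>m i. m \<in> Mon n k \<Longrightarrow> m \<noteq> ?o \<Longrightarrow> i \<le> L \<Longrightarrow> e m i = 0"
      and E: "(\<Sum>m\<in>Mon n k. \<Sum>i\<le>L. kk (e m i) * (M m * 1 * S w ^ i)) \<in> J w I" for e k i0
  proof -
    have o: "?o \<in> Mon n k" by (simp add: Mon_def mi_ok_def)
    have "(\<Sum>m\<in>Mon n k. \<Sum>i\<le>L. kk (e m i) * (M m * 1 * S w ^ i))
        = (\<Sum>m\<in>Mon n k. if m = ?o then \<Sum>i\<le>L. kk (e ?o i) * S w ^ i else 0)"
      by (intro sum.cong refl) (auto simp: z M_0)
    also have "\<dots> = (\<Sum>i\<le>L. kk (e ?o i) * S w ^ i)"
      using o finite_Mon by simp
    finally have "(\<Sum>i\<le>L. kk (e ?o i) * S w ^ i) \<in> J w I" using E by simp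
    thus ?thesis using nz by (rule polynomial_in_J)
  qed
  {
    case 0
    have "Mon n 0 = {?o}"
    proof (intro equalityI subsetI)
      fix m assume m: "m \<in> Mon n 0"
      have "fst m i = 0 \<and> snd m i = 0" for i
        using m by (cases "i < n") (auto simp: Mon_def mi_ok_def)
      thus "m \<in> {?o}" by (cases m) auto
    qed (auto simp: Mon_def mi_ok_def)
    then obtain i where "i \<le> L" "e ?o i \<noteq> 0" using 0(1) by auto
    thus ?case
      by (rule base[OF _ _ _ 0(2)[OF one_in_span]]) (use \<open>Mon n 0 = {?o}\<close> in blast)
  next
    case (Suc k)
    show ?case
    proof (cases "\<exists>m\<in>Mon n (Suc k). m \<noteq> ?o \<and> (\<exists>i\<le>L. e m i \<noteq> 0)")
      case False
      obtain m i where mi: "m \<in> Mon n (Suc k)" "i \<le> L" "e m i \<noteq> 0" using Suc.prems(1) by blast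
      hence "m = ?o" using False by (metis (no_types))
      hence "i \<le> L" "e ?o i \<noteq> 0" using mi by simp_all
      thus ?thesis
        by (rule base[OF _ _ _ Suc.prems(2)[OF span_mono[OF _ one_in_span]]]) (use False in auto)
    next
      case True
      then obtain m i where m: "m \<in> Mon n (Suc k)" "m \<noteq> ?o" and i: "i \<le> L" "e m i \<noteq> 0" by blast
      have ok: "mi_ok n (fst m)" "mi_ok n (snd m)" using m(1) by (auto simp: Mon_def)
      have "\<exists>j. fst m j \<noteq> 0 \<or> snd m j \<noteq> 0" using m(2) by (cases m) (auto simp: fun_eq_iff)
      then obtain j where j: "fst m j \<noteq> 0 \<or> snd m j \<noteq> 0" by blast
      hence jn: "j < n" using ok by (metis mi_ok_def not_less)
      have dec: "(\<lambda>i. c i - unitv j i + unitv j i) = c" if "c j \<noteq> 0" for c :: mi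
        using that by (auto simp: unitv_def)
      have deg_up: "(\<Sum>i<n. a i + unitv j i + b i) = Suc (\<Sum>i<n. a i + b i)"
        "(\<Sum>i<n. a i + (b i + unitv j i)) = Suc (\<Sum>i<n. a i + b i)" for a b :: mi
        using sum_unitv[OF jn] by (simp_all add: sum.distrib)
      \<comment> \<open>\<open>up\<close> inverts the degree drop: the commutator of
        \<open>M (up m)\<close> with \<open>y\<close> is \<open>cf m\<close> times
        \<open>M m\<close>. As \<open>up\<close> is injective, no two terms merge and the new
        coefficients cannot cancel.\<close>
      have step: ?thesis if y: "y \<in> span 1" and up: "inj_on up (Mon n k)" "up ` Mon n k \<subseteq> Mon n (Suc k)"
        and comm: "\<And>m. m \<in> Mon n k \<Longrightarrow> M (up m) * y = y * M (up m) + kk (cf m) * M m"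
        and comm0: "\<And>m. m \<in> Mon n (Suc k) - up ` Mon n k \<Longrightarrow> M m * y = y * M m"
        and m: "m \<in> up ` Mon n k" and cf: "\<And>m. cf m \<noteq> 0" for y up cf
      proof (rule Suc.IH[of "\<lambda>m i. cf m * e (up m) i"])
        show "\<exists>m\<in>Mon n k. \<exists>i\<le>L. cf m * e (up m) i \<noteq> 0" using m i cf by auto
      qed (rule commutator_step[OF I y up comm comm0 Suc.prems(2)])
      from j show ?thesis
      proof
        assume mj: "snd m j \<noteq> 0"
        define up :: "mi \<times> mi \<Rightarrow> mi \<times> mi" where "up m = (fst m, \<lambda>i. snd m i + unitv j i)" for m
        let ?y = "M (unitv j, \<lambda>_. 0)"
        have down: "m \<in> up ` Mon n k" if "m \<in> Mon n (Suc k)" "snd m j \<noteq> 0" for m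
        proof (rule image_eqI)
          let ?m = "(fst m, \<lambda>i. snd m i - unitv j i)"
          show "m = up ?m" by (simp add: up_def dec[of "snd m", OF that(2)])
          have "Suc (\<Sum>i<n. fst m i + (snd m i - unitv j i)) = (\<Sum>i<n. fst m i + snd m i)"
            using deg_up(2)[of "fst m" "snd ?m"] fun_cong[OF dec[of "snd m", OF that(2)]] by simp
          thus "?m \<in> Mon n k" using that(1) by (simp add: Mon_def mi_ok_def)
        qed
        show ?thesis
        proof (rule step[of ?y up "\<lambda>m. of_nat (snd m j + 1)"])
          show "?y \<in> span 1"
            by (rule M_in_span) (simp add: Mon_def mi_ok_unitv[OF jn] sum_unitv[OF jn] mi_ok_0)
          show "inj_on up (Mon n k)" by (auto simp: inj_on_def up_def fun_eq_iff)
          show "up ` Mon n k \<subseteq> Mon n (Suc k)"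
            using mi_ok_unitv[OF jn] by (auto simp: up_def Mon_def mi_ok_def deg_up)
          show "M (up m) * ?y = ?y * M (up m) + kk (of_nat (snd m j + 1)) * M m" if "m \<in> Mon n k" for m
          proof -
            have "mi_ok n (fst m)" "mi_ok n (\<lambda>i. snd m i + unitv j i)"
              using that mi_ok_unitv[OF jn] by (auto simp: Mon_def mi_ok_def)
            thus ?thesis using jn by (simp add: up_def M_x_right M_x_left del: of_nat_Suc)
          qed
          show "M m * ?y = ?y * M m" if m: "m \<in> Mon n (Suc k) - up ` Mon n k" for m
          proof -
            have "mi_ok n (fst m)" "mi_ok n (snd m)" "snd m j = 0"
              using m down[of m] by (simp add: Mon_def, simp add: Mon_def, blast)
            thus ?thesis using jn M_x_right[of "snd m" j "fst m"] M_x_left[of "fst m" j "snd m"] by simp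
          qed
        qed (use m(1) mj down in \<open>simp_all del: of_nat_Suc\<close>)
      next
        \<comment> \<open>The dual case, with a derivative as generator: D_j x^a = x^a D_j + a_j
          x^(a - e_j) makes the commutator factor negative.\<close>
        assume mj: "fst m j \<noteq> 0"
        define up :: "mi \<times> mi \<Rightarrow> mi \<times> mi" where "up m = (\<lambda>i. fst m i + unitv j i, snd m)" for m
        let ?y = "M (\<lambda>_. 0, unitv j)"
        have down: "m \<in> up ` Mon n k" if "m \<in> Mon n (Suc k)" "fst m j \<noteq> 0" for m
        proof (rule image_eqI)
          let ?m = "(\<lambda>i. fst m i - unitv j i, snd m)"
          show "m = up ?m" by (simp add: up_def dec[of "fst m", OF that(2)])
          have "Suc (\<Sum>i<n. fst m i - unitv j i + snd m i) = (\<Sum>i<n. fst m i + snd m i)"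
            using deg_up(1)[of "fst ?m" "snd m"] fun_cong[OF dec[of "fst m", OF that(2)]] by simp
          thus "?m \<in> Mon n k" using that(1) by (simp add: Mon_def mi_ok_def)
        qed
        show ?thesis
        proof (rule step[of ?y up "\<lambda>m. - of_nat (fst m j + 1)"])
          show "?y \<in> span 1"
            by (rule M_in_span) (simp add: Mon_def mi_ok_unitv[OF jn] sum_unitv[OF jn] mi_ok_0)
          show "inj_on up (Mon n k)" by (auto simp: inj_on_def up_def fun_eq_iff)
          show "up ` Mon n k \<subseteq> Mon n (Suc k)"
            using mi_ok_unitv[OF jn] by (auto simp: up_def Mon_def mi_ok_def deg_up)
          show "M (up m) * ?y = ?y * M (up m) + kk (- of_nat (fst m j + 1)) * M m" if "m \<in> Mon n k" for m
          proof -
            have "mi_ok n (snd m)" "mi_ok n (\<lambda>i. fst m i + unitv j i)"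
              using that mi_ok_unitv[OF jn] by (auto simp: Mon_def mi_ok_def)
            thus ?thesis using jn by (simp add: up_def M_D_right M_D_left kk_uminus del: of_nat_Suc)
          qed
          show "M m * ?y = ?y * M m" if m: "m \<in> Mon n (Suc k) - up ` Mon n k" for m
          proof -
            have "mi_ok n (fst m)" "mi_ok n (snd m)" "fst m j = 0"
              using m down[of m] by (simp add: Mon_def, simp add: Mon_def, blast)
            thus ?thesis using jn M_D_right[of "snd m" j "fst m"] M_D_left[of "fst m" j "snd m"] by simp
          qed
        qed (use m(1) mj down in \<open>simp_all del: of_nat_Suc\<close>)
      qed
    qed
  }
qed

section \<open>Linear independence of monomials modulo the initial ideal\<close>

definition indJ :: "(nat \<Rightarrow> real) \<Rightarrow> weyl set \<Rightarrow> (mi \<times> mi) set \<Rightarrow> bool" where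
  "indJ w I A \<longleftrightarrow> (\<forall>v. (\<Sum>m\<in>A. kk (v m) * M m) \<in> J w I \<longrightarrow> (\<forall>m\<in>A. v m = 0))"

text \<open>Passing to the initial form does not enlarge the support. So an element of
  \<open>I\<close> supported in \<open>A\<close> gives a relation modulo \<open>J w I\<close> among
  the monomials of \<open>A\<close>, nontrivial at any monomial of maximal weight.\<close>

lemma indJ_card_le:
  assumes I: "I \<subseteq> weyl_alg n" and ind: "indJ w I A" and A: "A \<subseteq> Mon n N"
    and growth: "\<And>A. A \<subseteq> Mon n N \<Longrightarrow> g < card A \<Longrightarrow> \<exists>P\<in>I. P \<noteq> wzero \<and> supp P \<subseteq> A"
  shows "card A \<le> g"
proof (rule ccontr)
  assume "\<not> card A \<le> g"
  then obtain P where P: "P \<in> I" "P \<noteq> wzero" "supp P \<subseteq> A" using growth[OF A] by auto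
  have finA: "finite A" using A finite_Mon by (rule finite_subset)
  have "supp (in_w n w P) \<subseteq> A" using P(3) by (auto simp: supp_def in_w_def split: if_splits)
  hence "op (in_w n w P) = (\<Sum>m\<in>A. kk (in_w n w P m) * M m)" by (rule op_eq_sum[OF finA])
  moreover have "op (in_w n w P) \<in> J w I"
    using J_generator[OF I P(1,2) kk_in_W[of 1]] by simp
  ultimately have z: "in_w n w P m = 0" if "m \<in> A" for m
    using ind that unfolding indJ_def by auto
  have fin: "finite (supp P)" using P(3) finA by (rule finite_subset)
  have "supp P \<noteq> {}" using P(2) by (auto simp: supp_def wzero_def fun_eq_iff)
  hence "Max (weight n w ` supp P) \<in> weight n w ` supp P" using fin by simp
  then obtain m where m: "m \<in> supp P" "weight n w m = Max (weight n w ` supp P)" by auto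
  hence "in_w n w P m = P m" by (simp add: in_w_def supp_def)
  moreover have "m \<in> A" using m(1) P(3) by blast
  ultimately show False using z[of m] m(1) by (simp add: supp_def)
qed

text \<open>The basis is a maximal independent set of monomials, not of arbitrary operators, because
  \<open>indJ_card_le\<close> bounds only sets of monomials. Maximality gives a relation for any
  other monomial \<open>m\<close>, solvable for it since \<open>v m\<close> is nonzero.\<close>

lemma indJ_basis:
  assumes I: "I \<subseteq> weyl_alg n"
  obtains B where "B \<subseteq> Mon n N" "indJ w I B"
    "\<And>A. A \<in> span N \<Longrightarrow> \<exists>c. A - (\<Sum>r\<in>B. kk (c r) * M r) \<in> J w I"
proof -
  have "\<exists>B. (B \<subseteq> Mon n N \<and> indJ w I B) \<and> (\<forall>B'. B' \<subseteq> Mon n N \<and> indJ w I B' \<longrightarrow> card B' \<le> card B)"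
  proof (rule ex_has_greatest_nat[where b = "Suc (card (Mon n N))"])
    show "{} \<subseteq> Mon n N \<and> indJ w I {}" by (simp add: indJ_def)
    show "\<forall>B. B \<subseteq> Mon n N \<and> indJ w I B \<longrightarrow> card B < Suc (card (Mon n N))"
      using card_mono[OF finite_Mon] by (auto simp: less_Suc_eq_le)
  qed
  then obtain B where B: "B \<subseteq> Mon n N" "indJ w I B"
    and max: "\<And>B'. B' \<subseteq> Mon n N \<Longrightarrow> indJ w I B' \<Longrightarrow> card B' \<le> card B" by blast
  have finB: "finite B" using B(1) finite_Mon by (rule finite_subset)
  have mon: "\<exists>c. M m - (\<Sum>r\<in>B. kk (c r) * M r) \<in> J w I" if m: "m \<in> Mon n N" for m
  proof (cases "m \<in> B")
    case True
    have "(\<Sum>r\<in>B. kk (if r = m then 1 else 0) * M r) = (\<Sum>r\<in>B. if r = m then M m else 0)"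
      by (intro sum.cong) auto
    hence "M m - (\<Sum>r\<in>B. kk (if r = m then 1 else 0) * M r) = 0" using True finB by simp
    hence "M m - (\<Sum>r\<in>B. kk (if r = m then 1 else 0) * M r) \<in> J w I" by (simp only: J_0)
    thus ?thesis by (intro exI[of _ "\<lambda>r. if r = m then 1 else 0"])
  next
    case False
    have "\<not> indJ w I (insert m B)"
    proof
      assume "indJ w I (insert m B)"
      hence "card (insert m B) \<le> card B" using max[of "insert m B"] B(1) m by blast
      thus False using False finB by simp
    qed
    then obtain v r0 where v: "(\<Sum>r\<in>insert m B. kk (v r) * M r) \<in> J w I"
      and r0: "r0 \<in> insert m B" "v r0 \<noteq> 0" unfolding indJ_def by blast
    have vs: "kk (v m) * M m + (\<Sum>r\<in>B. kk (v r) * M r) \<in> J w I"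
      using v False finB by simp
    have vm: "v m \<noteq> 0"
    proof
      assume "v m = 0"
      hence "\<forall>r\<in>B. v r = 0" using vs B(2) by (auto simp: indJ_def)
      thus False using r0 \<open>v m = 0\<close> by auto
    qed
    have "kk (inverse (v m)) * (kk (v m) * M m + (\<Sum>r\<in>B. kk (v r) * M r)) \<in> J w I"
      by (rule J_left[OF I kk_in_W vs])
    also have "kk (inverse (v m)) * (kk (v m) * M m + (\<Sum>r\<in>B. kk (v r) * M r))
        = M m - (\<Sum>r\<in>B. kk (- inverse (v m) * v r) * M r)"
      using vm by (simp add: distrib_left sum_distrib_left mult.assoc[symmetric] kk_mult[symmetric]
          kk_uminus sum_negf)
    finally show ?thesis by (intro exI[of _ "\<lambda>r. - inverse (v m) * v r"])
  qed
  show ?thesis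
  proof (rule that[OF B])
    fix A assume "A \<in> span N"
    then obtain v where A: "A = (\<Sum>m\<in>Mon n N. kk (v m) * M m)" by (auto simp: span_def)
    define c where "c m = (SOME c. M m - (\<Sum>r\<in>B. kk (c r) * M r) \<in> J w I)" for m
    have c: "M m - (\<Sum>r\<in>B. kk (c m r) * M r) \<in> J w I" if "m \<in> Mon n N" for m
      unfolding c_def by (rule someI_ex[OF mon[OF that]])
    have "(\<Sum>m\<in>Mon n N. kk (v m) * (M m - (\<Sum>r\<in>B. kk (c m r) * M r))) \<in> J w I"
      by (intro J_sum[OF I] J_left[OF I kk_in_W] c)
    also have "(\<Sum>m\<in>Mon n N. kk (v m) * (M m - (\<Sum>r\<in>B. kk (c m r) * M r)))
        = A - (\<Sum>m\<in>Mon n N. \<Sum>r\<in>B. kk (v m * c m r) * M r)"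
      by (simp add: A right_diff_distrib sum_subtractf sum_distrib_left kk_mult mult.assoc)
    also have "(\<Sum>m\<in>Mon n N. \<Sum>r\<in>B. kk (v m * c m r) * M r) = (\<Sum>r\<in>B. kk (\<Sum>m\<in>Mon n N. v m * c m r) * M r)"
      by (subst sum.swap) (simp add: kk_sum sum_distrib_right)
    finally show "\<exists>c. A - (\<Sum>r\<in>B. kk (c r) * M r) \<in> J w I"
      by (intro exI[of _ "\<lambda>r. \<Sum>m\<in>Mon n N. v m * c m r"])
  qed
qed

end

text \<open>With N = 2 n K, the left side bounds the number of equations in
  \<open>bideal_nonzero\<close>: independent monomials of degree N times those of degree 4 N. The
  right side is a lower bound for the unknowns, pairs of a monomial of degree at most N and a power
  of the Euler operator.\<close>

lemma growth_comparison:
  assumes "0 < (n::nat)"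
  obtains K where "((c * (2 * n * K) + 1) ^ n) * ((c * (4 * (2 * n * K)) + 1) ^ n)
    < (K + 1) ^ (2 * n) * (2 * n * K + 1)"
proof -
  \<comment> \<open>Both bases on the left are at most \<open>C * (K + 1)\<close>, so the left side
    is at most \<open>(K + 1) ^ (2 * n)\<close> times \<open>C ^ (2 * n)\<close>. Choosing
    \<open>K\<close> equal to the latter lets the extra factor \<open>2 * n * K + 1\<close>
    win.\<close>
  define C where "C = 8 * n * c + 1"
  define K where "K = C ^ (2 * n)"
  have "c * (2 * n * K) + 1 \<le> C * (K + 1)" "c * (4 * (2 * n * K)) + 1 \<le> C * (K + 1)"
    by (simp_all add: C_def algebra_simps)
  hence "((c * (2 * n * K) + 1) ^ n) * ((c * (4 * (2 * n * K)) + 1) ^ n)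
      \<le> (C * (K + 1)) ^ n * (C * (K + 1)) ^ n"
    by (intro mult_mono power_mono) auto
  also have "\<dots> = (K + 1) ^ (2 * n) * (C ^ n * C ^ n)"
    unfolding mult_2 power_add power_mult_distrib by (simp only: ac_simps)
  also have "\<dots> = (K + 1) ^ (2 * n) * K" by (simp add: K_def mult_2 power_add)
  also have "\<dots> < (K + 1) ^ (2 * n) * (2 * n * K + 1)"
  proof -
    have "K \<le> 2 * n * K" using assms by simp
    hence "K < 2 * n * K + 1" by linarith
    thus ?thesis by (intro mult_strict_left_mono) simp_all
  qed
  finally show ?thesis by (rule that)
qed

context diff_field
begin

text \<open>If \<open>J\<close> contained no nonzero polynomial in \<open>S w\<close>, the operators \<open>Q \<mapsto> \<Sum> kk e * M m * Q * S w ^ i\<close>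
  with \<open>m\<close> of degree and \<open>i\<close> at most \<open>N\<close> would act independently on the span of degree \<open>N\<close> modulo \<open>J\<close>.
  There are about \<open>N ^ (2 * n + 1)\<close> of them, but the growth bound leaves room for only \<open>N ^ (2 * n)\<close>.\<close>

lemma bideal_nonzero:
  assumes I: "I \<subseteq> weyl_alg n" and n: "0 < n"
    and growth: "\<And>N A. A \<subseteq> Mon n N \<Longrightarrow> (c * N + 1) ^ n < card A \<Longrightarrow> \<exists>P\<in>I. P \<noteq> wzero \<and> supp P \<subseteq> A"
  shows "\<exists>p. p \<noteq> 0 \<and> p \<in> bideal n w I"
proof -
  obtain K where K: "((c * (2 * n * K) + 1) ^ n) * ((c * (4 * (2 * n * K)) + 1) ^ n)
      < (K + 1) ^ (2 * n) * (2 * n * K + 1)"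
    using growth_comparison[OF n] by blast
  define N where "N = 2 * n * K"
  obtain B where B: "B \<subseteq> Mon n N" "indJ w I B"
    "\<And>A. A \<in> span N \<Longrightarrow> \<exists>c. A - (\<Sum>r\<in>B. kk (c r) * M r) \<in> J w I"
    by (rule indJ_basis[OF I]) blast
  obtain B' where B': "B' \<subseteq> Mon n (4 * N)" "indJ w I B'"
    "\<And>A. A \<in> span (4 * N) \<Longrightarrow> \<exists>c. A - (\<Sum>r\<in>B'. kk (c r) * M r) \<in> J w I"
    by (rule indJ_basis[OF I]) blast
  have fin: "finite B" "finite B'" using B(1) B'(1) finite_Mon finite_subset by blast+
  have "card B * card B' \<le> (c * N + 1) ^ n * (c * (4 * N) + 1) ^ n"
    by (intro mult_mono indJ_card_le[OF I B(2,1)] indJ_card_le[OF I B'(2,1)] growth) auto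
  also have "\<dots> < (K + 1) ^ (2 * n) * (N + 1)" using K by (simp add: N_def)
  also have "\<dots> \<le> card (Mon n N) * (N + 1)"
    using card_Mon_ge[of K n] unfolding N_def by (rule mult_right_mono) simp
  finally have card: "card (B \<times> B') < card (Mon n N \<times> {..N})"
    by (simp add: card_cartesian_product)
  \<comment> \<open>Origin of \<open>4 * N\<close>: degree \<open>N\<close> from \<open>M m\<close>,
    \<open>N\<close> from \<open>M q\<close>, and two from each of at most \<open>N\<close> factors
    \<open>S w\<close>.\<close>
  have "\<exists>c. M m * M q * S w ^ i - (\<Sum>r\<in>B'. kk (c r) * M r) \<in> J w I"
    if "m \<in> Mon n N" "i \<le> N" "q \<in> B" for m i q
  proof (rule B'(3))
    have "M m * M q * S w ^ i \<in> span (N + N + 2 * i)"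
      using that B(1) by (intro span_mult M_in_span S_power_in_span) auto
    thus "M m * M q * S w ^ i \<in> span (4 * N)" by (rule span_mono[rotated]) (use that in simp)
  qed
  note reduce = this
  define t where "t m i q = (SOME c. M m * M q * S w ^ i - (\<Sum>r\<in>B'. kk (c r) * M r) \<in> J w I)" for m i q
  have t: "M m * M q * S w ^ i - (\<Sum>r\<in>B'. kk (t m i q r) * M r) \<in> J w I"
    if "m \<in> Mon n N" "i \<le> N" "q \<in> B" for m i q
    unfolding t_def by (rule someI_ex[OF reduce[OF that]])
  \<comment> \<open>\<open>t\<close> holds the matrices, modulo \<open>J w I\<close>, of the
    operators labelled by pairs (m, i), with rows and columns indexed by \<open>B\<close> and
    \<open>B'\<close>. There are more labels than matrix entries, so a nonzero combination
    \<open>e\<close> of these matrices is zero.\<close>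
  obtain e where e_nz: "\<exists>a\<in>Mon n N \<times> {..N}. e a \<noteq> 0"
    and e: "\<forall>b\<in>B \<times> B'. (\<Sum>a\<in>Mon n N \<times> {..N}. t (fst a) (snd a) (fst b) (snd b) * e a) = 0"
    using underdetermined_system[OF _ _ card, of "\<lambda>b a. t (fst a) (snd a) (fst b) (snd b)"] fin finite_Mon
    by blast
  define E where "E Q = (\<Sum>m\<in>Mon n N. \<Sum>i\<le>N. kk (e (m, i)) * (M m * Q * S w ^ i))" for Q
  have E_add: "E (Q + Q') = E Q + E Q'" for Q Q'
    by (simp add: E_def distrib_left distrib_right sum.distrib)
  have E_kk: "E (kk a * Q) = kk a * E Q" for a Q
  proof -
    have "kk f * (M m * (kk a * Q) * s) = (kk f * (M m * kk a)) * (Q * s)" for f m s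
      by (simp only: mult.assoc)
    also have "(kk f * (M m * kk a)) * (Q * s) = (kk f * kk a) * (M m * (Q * s))" for f m s
      by (simp only: kk_M[symmetric] mult.assoc)
    also have "(kk f * kk a) * (M m * (Q * s)) = kk a * (kk f * (M m * Q * s))" for f m s
      by (simp only: kk_kk[of f a] mult.assoc)
    finally have "kk f * (M m * (kk a * Q) * s) = kk a * (kk f * (M m * Q * s))" for f m s .
    thus ?thesis by (simp add: E_def sum_distrib_left)
  qed
  have E_sum: "E (sum h T) = (\<Sum>t\<in>T. E (h t))" if "finite T" for h and T :: "(mi \<times> mi) set"
    using that by (induction T rule: finite_induct) (auto simp: E_add, simp add: E_def)
  have EB: "E (M q) \<in> J w I" if q: "q \<in> B" for q
  proof -
    have "(\<Sum>m\<in>Mon n N. \<Sum>i\<le>N. kk (e (m, i)) * (M m * M q * S w ^ i - (\<Sum>r\<in>B'. kk (t m i q r) * M r))) \<in> J w I"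
      using q by (intro J_sum[OF I] J_left[OF I kk_in_W] t) auto
    also have "(\<Sum>m\<in>Mon n N. \<Sum>i\<le>N. kk (e (m, i)) * (M m * M q * S w ^ i - (\<Sum>r\<in>B'. kk (t m i q r) * M r)))
        = E (M q) - (\<Sum>m\<in>Mon n N. \<Sum>i\<le>N. \<Sum>r\<in>B'. kk (t m i q r * e (m, i)) * M r)"
      by (simp add: E_def right_diff_distrib sum_subtractf sum_distrib_left mult.assoc[symmetric]
          kk_mult[symmetric] mult.commute[of "e _"])
    also have "(\<Sum>m\<in>Mon n N. \<Sum>i\<le>N. \<Sum>r\<in>B'. kk (t m i q r * e (m, i)) * M r)
        = (\<Sum>a\<in>Mon n N \<times> {..N}. \<Sum>r\<in>B'. kk (t (fst a) (snd a) q r * e a) * M r)"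
      by (rule trans[OF sum.cartesian_product]) (auto intro!: sum.cong)
    also have "\<dots> = (\<Sum>r\<in>B'. kk (\<Sum>a\<in>Mon n N \<times> {..N}. t (fst a) (snd a) q r * e a) * M r)"
      by (subst sum.swap) (simp add: kk_sum sum_distrib_right)
    also have "\<dots> = 0"
      using e q by (intro sum.neutral) auto
    finally show ?thesis by simp
  qed
  have "\<exists>p. p \<noteq> 0 \<and> evS w p \<in> J w I"
  proof (rule annihilator_of_span[OF I, where k = N and L = N and e = "\<lambda>m i. e (m, i)"])
    show "\<exists>m\<in>Mon n N. \<exists>i\<le>N. e (m, i) \<noteq> 0" using e_nz by auto
    fix Q assume Q: "Q \<in> span N"
    obtain b where b: "Q - (\<Sum>r\<in>B. kk (b r) * M r) \<in> J w I" using B(3)[OF Q] by blast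
    define R where "R = Q - (\<Sum>r\<in>B. kk (b r) * M r)"
    \<comment> \<open>\<open>R\<close> lies in the ideal and stays there under \<open>M m\<close> on
      the left and, by stability under the Euler operator, under \<open>S w ^ i\<close> on the
      right. Hence vanishing on the basis \<open>B\<close> extends to the whole span.\<close>
    have "E R \<in> J w I"
      unfolding E_def mult.assoc
      using b by (intro J_sum[OF I] J_left[OF I kk_in_W] J_left[OF I M_in_W] J_right_S_power[OF I])
        (auto simp: R_def Mon_def)
    moreover have "E (\<Sum>r\<in>B. kk (b r) * M r) \<in> J w I"
      unfolding E_sum[OF fin(1)] E_kk by (intro J_sum[OF I] J_left[OF I kk_in_W] EB)
    ultimately have "E R + E (\<Sum>r\<in>B. kk (b r) * M r) \<in> J w I" by (rule J_add[OF I])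
    hence "E Q \<in> J w I" unfolding E_add[symmetric] by (simp add: R_def)
    thus "(\<Sum>m\<in>Mon n N. \<Sum>i\<le>N. kk (e (m, i)) * (M m * Q * S w ^ i)) \<in> J w I" by (simp add: E_def)
  qed
  thus ?thesis by (simp add: bideal_iff[OF I])
qed

end

section \<open>Annihilators in terms of the field\<close>

context diff_field
begin

text \<open>\<open>t\<close> bounds the degree in each variable separately: such bounds add under
  products, and the space has dimension \<open>(t + 1) ^ n\<close>.\<close>

definition pbox :: "nat \<Rightarrow> mpoly set" where
  "pbox t = {p \<in> polys n. supp p \<subseteq> Box n t}"

definition toF :: "mpoly \<Rightarrow> 'a" where "toF p = (\<Sum>g\<in>supp p. \<kappa> (p g) * xm g)"

lemma polysD: "p \<in> polys n \<Longrightarrow> finite (supp p)" "p \<in> polys n \<Longrightarrow> g \<in> supp p \<Longrightarrow> mi_ok n g"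
  by (auto simp: polys_def supp_def)

lemma polys_pbox:
  assumes "p \<in> polys n"
  obtains t where "p \<in> pbox t"
proof -
  have "g i \<le> (\<Sum>h\<in>supp p. \<Sum>i<n. h i)" if "g \<in> supp p" "i < n" for g i
  proof -
    have "g i \<le> (\<Sum>i<n. g i)" using that(2) by (intro member_le_sum) auto
    also have "\<dots> \<le> (\<Sum>h\<in>supp p. \<Sum>i<n. h i)"
      using that(1) polysD(1)[OF assms] by (intro member_le_sum) auto
    finally show ?thesis .
  qed
  hence "p \<in> pbox (\<Sum>h\<in>supp p. \<Sum>i<n. h i)"
    using assms polysD(2)[OF assms] by (auto simp: pbox_def Box_def)
  thus ?thesis by (rule that)
qed

lemma pbox_polys: "p \<in> pbox t \<Longrightarrow> p \<in> polys n" by (simp add: pbox_def)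

lemma pbox_collect:
  assumes "finite T" "\<And>j. j \<in> T \<Longrightarrow> h j \<in> Box n t"
  shows "(\<lambda>g. \<Sum>j\<in>T. if h j = g then v j else 0) \<in> pbox t"
proof -
  let ?p = "\<lambda>g. \<Sum>j\<in>T. if h j = g then v j else 0"
  have sub: "supp ?p \<subseteq> h ` T" by (rule supp_collect)
  hence box: "supp ?p \<subseteq> Box n t" using assms(2) by blast
  have "finite (supp ?p)" using sub assms(1) finite_surj by blast
  moreover have "mi_ok n g" if "?p g \<noteq> 0" for g
    using box that by (auto simp: supp_def Box_def)
  ultimately show ?thesis using box by (simp add: pbox_def polys_def)
qed

lemma toF_eq_sum: "finite T \<Longrightarrow> supp p \<subseteq> T \<Longrightarrow> toF p = (\<Sum>g\<in>T. \<kappa> (p g) * xm g)"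
  unfolding toF_def by (rule sum.mono_neutral_left) (auto simp: supp_def)

lemma toF_collect:
  assumes "finite T"
  shows "toF (\<lambda>g. \<Sum>j\<in>T. if h j = g then v j else 0) = (\<Sum>j\<in>T. \<kappa> (v j) * xm (h j))"
proof -
  have "toF (\<lambda>g. \<Sum>j\<in>T. if h j = g then v j else 0)
      = (\<Sum>g\<in>h ` T. \<kappa> (\<Sum>j\<in>T. if h j = g then v j else 0) * xm g)"
    by (rule toF_eq_sum[OF _ supp_collect]) (use assms in simp)
  also have "\<dots> = (\<Sum>g\<in>h ` T. \<Sum>j\<in>T. if h j = g then \<kappa> (v j) * xm (h j) else 0)"
    unfolding \<kappa>_sum sum_distrib_right by (intro sum.cong) auto
  also have "\<dots> = (\<Sum>j\<in>T. \<Sum>g\<in>h ` T. if h j = g then \<kappa> (v j) * xm (h j) else 0)"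
    by (rule sum.swap)
  also have "\<dots> = (\<Sum>j\<in>T. \<kappa> (v j) * xm (h j))"
    by (rule sum.cong) (use assms in auto)
  finally show ?thesis .
qed

lemma toF_eq_0:
  assumes "p \<in> polys n" "toF p = 0"
  shows "p = (\<lambda>_. 0)"
proof
  fix g
  show "p g = 0"
  proof (cases "g \<in> supp p")
    case True
    show ?thesis
      by (rule monomials_indep[OF polysD(1)[OF assms(1)] _ _ True])
        (use assms polysD(2)[OF assms(1)] in \<open>auto simp: toF_def xmN_def\<close>)
  qed (simp add: supp_def)
qed

lemma xm_0 [simp]: "xm (\<lambda>_. 0) = 1" by (simp add: xmN_def)

lemma pone: "pone \<in> pbox 0" "toF pone = 1"
proof -
  have e: "pone = (\<lambda>g. \<Sum>j\<in>{()}. if (\<lambda>_. 0) = g then 1 else 0)"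
    by (auto simp: pone_def)
  show "pone \<in> pbox 0" unfolding e by (rule pbox_collect) (auto simp: Box_def mi_ok_def)
  show "toF pone = 1" unfolding e by (subst toF_collect) auto
qed

lemma lincomb:
  assumes T: "finite T" and q: "\<And>t. t \<in> T \<Longrightarrow> q t \<in> pbox B"
  shows "(\<lambda>g. \<Sum>t\<in>T. v t * q t g) \<in> pbox B" "toF (\<lambda>g. \<Sum>t\<in>T. v t * q t g) = (\<Sum>t\<in>T. \<kappa> (v t) * toF (q t))"
proof -
  let ?p = "\<lambda>g. \<Sum>t\<in>T. v t * q t g"
  have sub: "supp ?p \<subseteq> Box n B"
  proof
    fix g assume "g \<in> supp ?p"
    hence "(\<Sum>t\<in>T. v t * q t g) \<noteq> 0" by (simp add: supp_def)
    then obtain t where "t \<in> T" "v t * q t g \<noteq> 0" by (rule sum.not_neutral_contains_not_neutral)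
    thus "g \<in> Box n B" using q[of t] by (auto simp: pbox_def supp_def)
  qed
  show "?p \<in> pbox B"
    using finite_subset[OF sub finite_Box] sub by (auto simp: pbox_def polys_def supp_def Box_def)
  have "toF ?p = (\<Sum>g\<in>Box n B. \<kappa> (?p g) * xm g)" by (rule toF_eq_sum[OF finite_Box sub])
  also have "\<dots> = (\<Sum>g\<in>Box n B. \<Sum>t\<in>T. \<kappa> (v t) * (\<kappa> (q t g) * xm g))"
    by (simp add: \<kappa>_sum \<kappa>_mult sum_distrib_right mult.assoc)
  also have "\<dots> = (\<Sum>t\<in>T. \<kappa> (v t) * (\<Sum>g\<in>Box n B. \<kappa> (q t g) * xm g))"
    by (subst sum.swap) (simp add: sum_distrib_left)
  also have "\<dots> = (\<Sum>t\<in>T. \<kappa> (v t) * toF (q t))"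
    by (intro sum.cong refl arg_cong2[where f = "(*)"] toF_eq_sum[symmetric] finite_Box)
      (use q in \<open>simp add: pbox_def\<close>)
  finally show "toF ?p = (\<Sum>t\<in>T. \<kappa> (v t) * toF (q t))" .
qed

lemma pbox_mono: "s \<le> t \<Longrightarrow> p \<in> pbox s \<Longrightarrow> p \<in> pbox t"
  by (force simp: pbox_def Box_def)

lemma padd:
  assumes "p \<in> pbox B" "q \<in> pbox B"
  shows "padd p q \<in> pbox B" "toF (padd p q) = toF p + toF q"
proof -
  have e: "padd p q = (\<lambda>g. \<Sum>t\<in>{True, False}. 1 * (if t then p else q) g)"
    by (simp add: padd_def)
  show "padd p q \<in> pbox B" unfolding e by (rule lincomb) (use assms in auto)
  show "toF (padd p q) = toF p + toF q" unfolding e by (subst lincomb(2)) (use assms in auto)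
qed

lemma psmult:
  assumes "p \<in> pbox B"
  shows "psmult c p \<in> pbox B" "toF (psmult c p) = \<kappa> c * toF p"
proof -
  have e: "psmult c p = (\<lambda>g. \<Sum>t\<in>{()}. c * p g)"
    by (simp add: psmult_def)
  show "psmult c p \<in> pbox B" unfolding e by (rule lincomb) (use assms in auto)
  show "toF (psmult c p) = \<kappa> c * toF p" unfolding e by (subst lincomb(2)) (use assms in auto)
qed

lemma pmult:
  assumes p: "p \<in> pbox s" and q: "q \<in> pbox t"
  shows "pmult p q \<in> pbox (s + t)" "toF (pmult p q) = toF p * toF q"
proof -
  let ?T = "supp p \<times> supp q" and ?h = "\<lambda>j. \<lambda>i. fst j i + snd j i :: nat"
  have e: "pmult p q = (\<lambda>g. \<Sum>j\<in>?T. if ?h j = g then p (fst j) * q (snd j) else 0)"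
    unfolding pmult_def by (simp add: sum.cartesian_product case_prod_beta')
  have fin: "finite ?T" using pbox_polys[OF p] pbox_polys[OF q] polysD(1) by blast
  show "pmult p q \<in> pbox (s + t)" unfolding e
  proof (rule pbox_collect[OF fin])
    fix j assume "j \<in> ?T"
    hence "fst j \<in> Box n s" "snd j \<in> Box n t" using p q by (auto simp: pbox_def)
    thus "?h j \<in> Box n (s + t)" by (auto simp: Box_def mi_ok_def add_mono)
  qed
  have "toF (pmult p q) = (\<Sum>j\<in>?T. (\<kappa> (p (fst j)) * xm (fst j)) * (\<kappa> (q (snd j)) * xm (snd j)))"
    unfolding e toF_collect[OF fin] by (simp add: xmN_add \<kappa>_mult mult_ac)
  also have "\<dots> = toF p * toF q"
    by (simp add: toF_def sum_product sum.cartesian_product case_prod_beta')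
  finally show "toF (pmult p q) = toF p * toF q" .
qed

lemma ppow:
  assumes p: "p \<in> pbox t"
  shows "ppow p k \<in> pbox (k * t) \<and> toF (ppow p k) = toF p ^ k"
proof (induction k)
  case 0
  show ?case using pone by (simp add: ppow_def)
next
  case (Suc k)
  have "ppow p (Suc k) = pmult p (ppow p k)" by (simp add: ppow_def)
  thus ?case using pmult[OF p, of "ppow p k" "k * t"] Suc by simp
qed

lemma xmono:
  assumes p: "p \<in> pbox t" and a: "a \<in> Box n s"
  shows "xmono a p \<in> pbox (s + t)" "toF (xmono a p) = xm a * toF p"
proof -
  let ?h = "\<lambda>h i. a i + h i :: nat"
  have fin: "finite (supp p)" using pbox_polys[OF p] polysD(1) by blast
  have e: "xmono a p = (\<lambda>g. \<Sum>h\<in>supp p. if ?h h = g then p h else 0)"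
  proof
    fix g
    show "xmono a p g = (\<Sum>h\<in>supp p. if ?h h = g then p h else 0)"
    proof (cases "\<forall>i. a i \<le> g i")
      case True
      hence "?h h = g \<longleftrightarrow> h = (\<lambda>i. g i - a i)" for h
        unfolding fun_eq_iff by (metis add_diff_cancel_left' le_add_diff_inverse)
      hence "(\<Sum>h\<in>supp p. if ?h h = g then p h else 0) = (\<Sum>h\<in>supp p. if h = (\<lambda>i. g i - a i) then p h else 0)"
        by simp
      also have "\<dots> = p (\<lambda>i. g i - a i)" using fin by (simp add: supp_def)
      finally show ?thesis using True by (simp add: xmono_def)
    next
      case False
      have "?h h \<noteq> g" for h
      proof
        assume "?h h = g"
        hence "a i \<le> g i" for i by (metis le_add1)
        thus False using False by blast
      qed
      moreover have "xmono a p g = 0" unfolding xmono_def using False by (simp only: if_False)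
      ultimately show ?thesis by simp
    qed
  qed
  show "xmono a p \<in> pbox (s + t)" unfolding e
  proof (rule pbox_collect[OF fin])
    fix h assume "h \<in> supp p"
    hence "h \<in> Box n t" using p by (auto simp: pbox_def)
    thus "?h h \<in> Box n (s + t)" using a by (auto simp: Box_def mi_ok_def add_mono)
  qed
  show "toF (xmono a p) = xm a * toF p"
    unfolding e toF_collect[OF fin] by (simp add: toF_def xmN_add sum_distrib_left mult_ac)
qed

lemma d_xm:
  assumes "mi_ok n a" "i < n"
  shows "d i (xm a) = \<kappa> (of_nat (a i)) * xm (a(i := a i - 1))"
proof -
  have u: "(\<lambda>j. a j - unitv i j) = a(i := a i - 1)" by (auto simp: unitv_def)
  have "M (\<lambda>_. 0, unitv i) = D i" using assms(2) by (simp add: M_def DN_unitv)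
  moreover have "app (M (a, \<lambda>_. 0)) 1 = xm a" by (simp add: M_def app_DN_1)
  ultimately have "d i (xm a) = app (M (\<lambda>_. 0, unitv i) * M (a, \<lambda>_. 0)) 1" by simp
  also have "\<dots> = app (M (a, unitv i)) 1 + \<kappa> (of_nat (a i)) * app (M (\<lambda>j. a j - unitv i j, \<lambda>_. 0)) 1"
    by (subst M_D_left[OF assms]) simp
  also have "app (M (a, unitv i)) 1 = 0"
    using assms(2) by (auto simp: M_def app_DN_1 unitv_def)
  finally show ?thesis by (simp add: M_def app_DN_1 u)
qed

lemma pdiff:
  assumes p: "p \<in> pbox t" and i: "i < n"
  shows "pdiff i p \<in> pbox t" "toF (pdiff i p) = d i (toF p)"
proof -
  let ?h = "\<lambda>h :: mi. h(i := h i - 1)"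
  have fin: "finite (supp p)" using pbox_polys[OF p] polysD(1) by blast
  have e: "pdiff i p = (\<lambda>g. \<Sum>h\<in>supp p. if ?h h = g then of_nat (h i) * p h else 0)"
  proof
    fix g
    have "(if ?h h = g then of_nat (h i) * p h else 0) =
        (if h = g(i := g i + 1) then of_nat (g i + 1) * p (g(i := g i + 1)) else 0)" for h
    proof (cases "h i = 0")
      case True
      hence "h \<noteq> g(i := g i + 1)" by (metis add_is_0 fun_upd_same one_neq_zero)
      thus ?thesis using True by simp
    next
      case False
      hence "?h h = g \<longleftrightarrow> h = g(i := g i + 1)" by (auto simp: fun_eq_iff)
      thus ?thesis by auto
    qed
    thus "pdiff i p g = (\<Sum>h\<in>supp p. if ?h h = g then of_nat (h i) * p h else 0)"
      using fin by (simp add: pdiff_def supp_def)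
  qed
  show "pdiff i p \<in> pbox t" unfolding e
  proof (rule pbox_collect[OF fin])
    fix h assume "h \<in> supp p"
    hence "h \<in> Box n t" using p by (auto simp: pbox_def)
    thus "?h h \<in> Box n t" by (auto simp: Box_def mi_ok_def intro: le_trans[OF diff_le_self])
  qed
  have "d i (toF p) = (\<Sum>h\<in>supp p. \<kappa> (p h) * d i (xm h))"
    by (simp add: toF_def d_sum d_simps)
  also have "\<dots> = (\<Sum>h\<in>supp p. \<kappa> (of_nat (h i) * p h) * xm (?h h))"
    using polysD(2)[OF pbox_polys[OF p]] i by (intro sum.cong refl) (simp add: d_xm \<kappa>_mult mult_ac)
  finally show "toF (pdiff i p) = d i (toF p)" unfolding e toF_collect[OF fin] by simp
qed

section \<open>Derivatives of p / f^k and annihilators, with control of degrees\<close>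

definition val :: "mpoly \<Rightarrow> mpoly \<times> nat \<Rightarrow> 'a" where
  "val f pk = toF (fst pk) / toF f ^ snd pk"

text \<open>Differentiate \<open>(u / v ^ k) * v ^ k = u\<close> and solve. The factor
  \<open>of_nat k\<close> takes care of the truncated \<open>k - 1\<close>.\<close>

lemma d_divide_power:
  assumes "v \<noteq> 0"
  shows "d i (u / v ^ k) = (d i u * v - of_nat k * u * d i v) / v ^ Suc k"
proof -
  have "d i (u / v ^ k) * v ^ k + (u / v ^ k) * (of_nat k * v ^ (k - 1) * d i v) = d i u"
    using d_simps(2)[of i "u / v ^ k" "v ^ k"] assms by (simp add: d_power)
  hence "(d i (u / v ^ k) * v ^ k + (u / v ^ k) * (of_nat k * v ^ (k - 1) * d i v)) * v = d i u * v" by simp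
  moreover have "(u / v ^ k) * (of_nat k * v ^ (k - 1) * d i v) * v = of_nat k * u * d i v"
    using assms by (cases k) (auto simp: field_simps)
  ultimately have "d i (u / v ^ k) * v ^ Suc k = d i u * v - of_nat k * u * d i v"
    by (simp add: algebra_simps)
  thus ?thesis using assms by (simp add: eq_divide_eq)
qed

text \<open>Fractions are never reduced: each derivative costs one factor \<open>f\<close> in the
  denominator and \<open>B\<close> in the degree of the numerator. This linear cost is the source of
  the growth bound.\<close>

lemma ldiff:
  assumes f: "f \<in> pbox B" and fnz: "toF f \<noteq> 0" and p: "fst pk \<in> pbox t" and i: "i < n"
  shows "fst (ldiff f i pk) \<in> pbox (t + B)" "snd (ldiff f i pk) = Suc (snd pk)"
    "val f (ldiff f i pk) = d i (val f pk)"
proof -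
  obtain q k where e: "pk = (q, k)" by (cases pk)
  have q: "q \<in> pbox t" using p e by simp
  note q' = pdiff[OF q i] and f' = pdiff[OF f i]
  note m = pmult[OF q'(1) f] pmult[OF q f'(1)]
  have s: "psmult (- of_nat k) (pmult q (pdiff i f)) \<in> pbox (t + B)"
    "toF (psmult (- of_nat k) (pmult q (pdiff i f))) = - of_nat k * (toF q * d i (toF f))"
    using psmult[OF m(3)] m(4) f'(2) by (simp_all add: \<kappa>_uminus \<kappa>_of_nat)
  show "fst (ldiff f i pk) \<in> pbox (t + B)" "snd (ldiff f i pk) = Suc (snd pk)"
    using padd(1)[OF m(1) s(1)] by (simp_all add: ldiff_def e)
  show "val f (ldiff f i pk) = d i (val f pk)"
    unfolding val_def using padd(2)[OF m(1) s(1)] m(2) q'(2) s(2)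
    by (simp add: ldiff_def e d_divide_power[OF fnz] del: power_Suc)
qed

lemma ldiff_iterate:
  assumes f: "f \<in> pbox B" and fnz: "toF f \<noteq> 0" and p: "fst pk \<in> pbox t" and i: "i < n"
  shows "fst ((ldiff f i ^^ j) pk) \<in> pbox (t + j * B) \<and> snd ((ldiff f i ^^ j) pk) = snd pk + j \<and>
    val f ((ldiff f i ^^ j) pk) = app (D i ^ j) (val f pk)"
proof (induction j)
  case (Suc j)
  show ?case using ldiff[OF f fnz conjunct1[OF Suc] i] Suc by (simp add: add_ac)
qed (use p in simp)

lemma lder:
  assumes f: "f \<in> pbox B" and fnz: "toF f \<noteq> 0" and p: "fst pk \<in> pbox t"
  shows "fst (lder f n b pk) \<in> pbox (t + (\<Sum>i<n. b i) * B) \<and> snd (lder f n b pk) = snd pk + (\<Sum>i<n. b i) \<and>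
    val f (lder f n b pk) = app (DN n b) (val f pk)"
proof -
  \<comment> \<open>Generalised from the full index list to any list of indices, for the induction
    along \<open>foldr\<close>.\<close>
  define g where "g xs = foldr (\<lambda>i h. (ldiff f i ^^ b i) h) xs pk" for xs
  have "fst (g xs) \<in> pbox (t + sum_list (map b xs) * B) \<and> snd (g xs) = snd pk + sum_list (map b xs) \<and>
      val f (g xs) = app (prod_list (map (\<lambda>i. D i ^ b i) xs)) (val f pk)" if "set xs \<subseteq> {..<n}" for xs
    using that
  proof (induction xs)
    case Nil
    thus ?case using p by (simp add: g_def)
  next
    case (Cons i xs)
    have "g (i # xs) = (ldiff f i ^^ b i) (g xs)" by (simp add: g_def)
    thus ?case using ldiff_iterate[OF f fnz, of "g xs" "t + sum_list (map b xs) * B" i "b i"] Cons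
      by (simp add: algebra_simps)
  qed
  from this[of "[0..<n]"] show ?thesis
    by (simp add: g_def lder_def DN_def interv_sum_list_conv_sum_set_nat atLeast0LessThan)
qed

text \<open>The numerator of \<open>x\<^sup>a \<partial>\<^sup>b\<close> applied to \<open>pk\<close>, over the common denominator \<open>f\<^sup>e\<close>.\<close>

definition mnum :: "mpoly \<Rightarrow> mpoly \<times> nat \<Rightarrow> nat \<Rightarrow> mi \<times> mi \<Rightarrow> mpoly" where
  "mnum f pk e m = pmult (xmono (fst m) (fst (lder f n (snd m) pk))) (ppow f (e - snd (lder f n (snd m) pk)))"

text \<open>The two multiples of \<open>B\<close> add up to \<open>(e - snd pk) * B\<close> whatever
  the order of the derivative: fewer derivatives mean more factors \<open>f\<close> to reach the
  common denominator.\<close>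

lemma mnum:
  assumes f: "f \<in> pbox B" and fnz: "toF f \<noteq> 0" and p: "fst pk \<in> pbox t"
    and a: "fst m \<in> Box n s" and e: "snd pk + (\<Sum>i<n. snd m i) \<le> e"
  shows "mnum f pk e m \<in> pbox (s + t + (\<Sum>i<n. snd m i) * B + (e - (snd pk + (\<Sum>i<n. snd m i))) * B)"
    "toF (mnum f pk e m) = app (M m) (val f pk) * toF f ^ e"
proof -
  define L where "L = lder f n (snd m) pk"
  note l = lder[OF f fnz p, of "snd m", folded L_def]
  note xl = xmono[OF conjunct1[OF l] a]
  note pw = ppow[OF f, of "e - snd L"]
  show "mnum f pk e m \<in> pbox (s + t + (\<Sum>i<n. snd m i) * B + (e - (snd pk + (\<Sum>i<n. snd m i))) * B)"
    using pmult(1)[OF xl(1) conjunct1[OF pw]] l by (simp add: mnum_def L_def add_ac)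
  have "toF (fst L) = app (DN n (snd m)) (val f pk) * toF f ^ snd L"
    using l fnz by (simp add: val_def field_simps)
  moreover have "snd L + (e - snd L) = e" using l e by simp
  hence "toF f ^ snd L * toF f ^ (e - snd L) = toF f ^ e" by (simp only: power_add[symmetric])
  ultimately show "toF (mnum f pk e m) = app (M m) (val f pk) * toF f ^ e"
    using pmult(2)[OF xl(1) conjunct1[OF pw]] xl(2) pw by (simp add: mnum_def L_def M_def mult_ac)
qed

lemma app_op: "app (op P) u = (\<Sum>m\<in>supp P. \<kappa> (P m) * app (M m) u)"
  by (simp add: op_def app_sum_left)

text \<open>The common denominator is a nonzero power of \<open>f\<close> in the field, so the
  operator kills the function exactly when the numerator is zero there; \<open>toF_eq_0\<close>
  transfers this to the coefficient function.\<close>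

lemma act_num:
  assumes f: "f \<in> polys n" and fnz: "toF f \<noteq> 0" and p: "fst pk \<in> polys n" and P: "P \<in> weyl_alg n"
  shows "act_num n f P pk = (\<lambda>_. 0) \<longleftrightarrow> app (op P) (val f pk) = 0"
proof -
  obtain B where B: "f \<in> pbox B" using polys_pbox[OF f] .
  obtain t where t: "fst pk \<in> pbox t" using polys_pbox[OF p] .
  have fin: "finite (supp P)" by (rule weyl_algD(1)[OF P])
  define e where "e = snd pk + (\<Sum>m\<in>supp P. \<Sum>i<n. snd m i)"
  have act: "act_num n f P pk = (\<lambda>g. \<Sum>m\<in>supp P. P m * mnum f pk e m g)"
    by (simp add: act_num_def mnum_def e_def Let_def)
  have le: "snd pk + (\<Sum>i<n. snd m i) \<le> e" if "m \<in> supp P" for m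
    unfolding e_def using fin that member_le_sum[of m "supp P" "\<lambda>m. \<Sum>i<n. snd m i"] by simp
  have "\<exists>r. mnum f pk e m \<in> pbox r" if m: "m \<in> supp P" for m
  proof -
    define s where "s = (\<Sum>i<n. fst m i)"
    have "fst m i \<le> s" if "i < n" for i using that unfolding s_def by (intro member_le_sum) auto
    hence "fst m \<in> Box n s" using weyl_algD(2)[OF P m] by (simp add: Box_def)
    from mnum(1)[OF B fnz t this le[OF m]] show ?thesis by blast
  qed
  then obtain r where r: "\<And>m. m \<in> supp P \<Longrightarrow> mnum f pk e m \<in> pbox (r m)" by metis
  define R where "R = (\<Sum>m\<in>supp P. r m)"
  have R: "mnum f pk e m \<in> pbox R" if "m \<in> supp P" for m
    by (rule pbox_mono[OF _ r[OF that]]) (use that fin in \<open>auto simp: R_def intro!: member_le_sum\<close>)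
  have "toF (act_num n f P pk) = (\<Sum>m\<in>supp P. \<kappa> (P m) * toF (mnum f pk e m))"
    unfolding act by (rule lincomb(2)[OF fin R])
  also have "\<dots> = (\<Sum>m\<in>supp P. \<kappa> (P m) * (app (M m) (val f pk) * toF f ^ e))"
  proof (intro sum.cong refl)
    fix m assume m: "m \<in> supp P"
    have "fst m \<in> Box n (\<Sum>i<n. fst m i)"
      using weyl_algD(2)[OF P m] by (auto simp: Box_def intro!: member_le_sum)
    from mnum(2)[OF B fnz t this le[OF m]]
    show "\<kappa> (P m) * toF (mnum f pk e m) = \<kappa> (P m) * (app (M m) (val f pk) * toF f ^ e)" by simp
  qed
  also have "\<dots> = app (op P) (val f pk) * toF f ^ e"
    by (simp add: app_op sum_distrib_right mult.assoc)
  finally have eq: "toF (act_num n f P pk) = app (op P) (val f pk) * toF f ^ e" .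
  have pol: "act_num n f P pk \<in> polys n"
    unfolding act by (rule pbox_polys[OF lincomb(1)[OF fin R]])
  show ?thesis
  proof
    assume "act_num n f P pk = (\<lambda>_. 0)"
    hence "toF (act_num n f P pk) = 0" by (simp add: toF_def supp_def)
    thus "app (op P) (val f pk) = 0" using eq fnz by simp
  next
    assume "app (op P) (val f pk) = 0"
    thus "act_num n f P pk = (\<lambda>_. 0)" using eq toF_eq_0[OF pol] by simp
  qed
qed

lemma fpow_polys: "f \<in> polys n \<Longrightarrow> fst (fpow f l) \<in> polys n"
  using ppow pbox_polys pone(1) polys_pbox by (auto simp: fpow_def) metis

lemma Ann_iff:
  assumes f: "f \<in> polys n" and fnz: "f \<noteq> (\<lambda>_. 0)"
  shows "P \<in> Ann n f l \<longleftrightarrow> P \<in> weyl_alg n \<and> app (op P) (val f (fpow f l)) = 0"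
proof -
  have "toF f \<noteq> 0" using toF_eq_0[OF f] fnz by blast
  thus ?thesis using act_num[OF f _ fpow_polys[OF f]] by (auto simp: Ann_def)
qed

text \<open>A negative power has numerator 1, of degree 0. Over the denominator with exponent
  \<open>snd pk + N\<close>, a monomial operator x^a D^b of degree at most N produces a numerator of
  degree at most |a| + N B <= (B + 1) N in each variable. More monomials than the dimension of that
  space satisfy a linear relation, which is the operator sought.\<close>

lemma Ann_growth:
  assumes f: "f \<in> pbox B" and fnz: "f \<noteq> (\<lambda>_. 0)" and l: "l < 0"
    and A: "A \<subseteq> Mon n N" and card: "((B + 1) * N + 1) ^ n < card A"
  shows "\<exists>P\<in>Ann n f l. P \<noteq> wzero \<and> supp P \<subseteq> A"
proof -
  define pk where "pk = fpow f l"
  have pk: "fst pk \<in> pbox 0" using l pone by (simp add: pk_def fpow_def)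
  have fF: "toF f \<noteq> 0" using toF_eq_0[OF pbox_polys[OF f]] fnz by blast
  have finA: "finite A" using A finite_Mon finite_subset by blast
  define e where "e = snd pk + N"
  have deg: "(\<Sum>i<n. fst m i) + (\<Sum>i<n. snd m i) \<le> N" if "m \<in> A" for m
    using A that by (auto simp: Mon_def sum.distrib)
  have box: "fst m \<in> Box n (\<Sum>i<n. fst m i)" if "m \<in> A" for m
    using A that by (auto simp: Mon_def Box_def intro!: member_le_sum)
  have le: "snd pk + (\<Sum>i<n. snd m i) \<le> e" if "m \<in> A" for m using deg[OF that] by (simp add: e_def)
  note mn = mnum[OF f fF pk box le]
  have mb: "mnum f pk e m \<in> pbox ((B + 1) * N)" if m: "m \<in> A" for m
  proof (rule pbox_mono[OF _ mn(1)[OF m m]])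
    let ?a = "\<Sum>i<n. fst m i" and ?b = "\<Sum>i<n. snd m i"
    have "?b * B + (e - (snd pk + ?b)) * B = N * B"
      using deg[OF m] by (simp add: e_def distrib_right[symmetric])
    thus "?a + 0 + ?b * B + (e - (snd pk + ?b)) * B \<le> (B + 1) * N"
      using deg[OF m] by (simp add: algebra_simps)
  qed
  have "card (Box n ((B + 1) * N)) < card A" using card by (simp add: card_Box)
  from underdetermined_system[OF finite_Box finA this, of "\<lambda>g m. mnum f pk e m g"]
  obtain v where v: "\<exists>m\<in>A. v m \<noteq> 0" "\<And>g. g \<in> Box n ((B + 1) * N) \<Longrightarrow> (\<Sum>m\<in>A. mnum f pk e m g * v m) = 0"
    by blast
  have z: "(\<Sum>m\<in>A. v m * mnum f pk e m g) = 0" for g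
  proof (cases "g \<in> Box n ((B + 1) * N)")
    case True
    thus ?thesis using v(2) by (simp add: mult.commute)
  next
    case False
    hence "mnum f pk e m g = 0" if "m \<in> A" for m using mb[OF that] by (auto simp: pbox_def supp_def)
    thus ?thesis by simp
  qed
  have "0 = toF (\<lambda>g. \<Sum>m\<in>A. v m * mnum f pk e m g)" by (simp add: z toF_def supp_def)
  also have "\<dots> = (\<Sum>m\<in>A. \<kappa> (v m) * toF (mnum f pk e m))" by (rule lincomb(2)[OF finA mb])
  also have "\<dots> = (\<Sum>m\<in>A. \<kappa> (v m) * app (M m) (val f pk)) * toF f ^ e"
    unfolding sum_distrib_right by (intro sum.cong refl) (simp add: mn(2))
  finally have s0: "(\<Sum>m\<in>A. \<kappa> (v m) * app (M m) (val f pk)) = 0" using fF by simp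
  define P where "P m = (if m \<in> A then v m else 0)" for m
  have sub: "supp P \<subseteq> A" by (auto simp: supp_def P_def split: if_splits)
  have "P \<in> weyl_alg n"
    using finite_subset[OF sub finA] A by (auto simp: weyl_alg_def P_def Mon_def split: if_splits)
  moreover have "app (op P) (val f pk) = 0"
  proof -
    have "op P = (\<Sum>m\<in>A. kk (P m) * M m)" by (rule op_eq_sum[OF finA sub])
    hence "app (op P) (val f pk) = (\<Sum>m\<in>A. \<kappa> (P m) * app (M m) (val f pk))" by (simp add: app_sum_left)
    also have "\<dots> = (\<Sum>m\<in>A. \<kappa> (v m) * app (M m) (val f pk))" by (intro sum.cong) (auto simp: P_def)
    finally show ?thesis using s0 by simp
  qed
  ultimately have "P \<in> Ann n f l" using Ann_iff[OF pbox_polys[OF f] fnz] by (simp add: pk_def)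
  moreover have "P \<noteq> wzero" using v(1) by (auto simp: P_def wzero_def fun_eq_iff)
  ultimately show ?thesis using sub by blast
qed

end

section \<open>Initial forms of rational functions\<close>

context diff_field
begin

section \<open>Weights of polynomials and their leading parts\<close>

definition wt :: "(nat \<Rightarrow> real) \<Rightarrow> mi \<Rightarrow> real" where "wt w g = (\<Sum>i<n. w i * real (g i))"

lemma wt_add: "wt w (\<lambda>i. a i + b i) = wt w a + wt w b"
  by (simp add: wt_def distrib_left sum.distrib)

lemma weight_wt: "weight n w m = wt w (snd m) - wt w (fst m)"
  by (simp add: weight_def wt_def right_diff_distrib sum_subtractf)

lemma wt_upd: "i < n \<Longrightarrow> wt w (g(i := k)) = wt w g - w i * real (g i) + w i * real k"
  by (simp add: wt_def sum.remove[of "{..<n}" i])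

text \<open>A set of admissible weights lets one predicate describe both homogeneous elements,
  \<open>A = {c}\<close>, and remainders of higher order, \<open>A = {c<..}\<close>.\<close>

definition wts :: "(nat \<Rightarrow> real) \<Rightarrow> real set \<Rightarrow> 'a \<Rightarrow> bool" where
  "wts w A u \<longleftrightarrow> (\<exists>p\<in>polys n. u = toF p \<and> (\<forall>g\<in>supp p. wt w g \<in> A))"

lemma wtsI:
  assumes "finite T" "\<And>j. j \<in> T \<Longrightarrow> mi_ok n (h j) \<and> wt w (h j) \<in> A"
  shows "wts w A (\<Sum>j\<in>T. \<kappa> (v j) * xm (h j))"
proof -
  let ?p = "\<lambda>g. \<Sum>j\<in>T. if h j = g then v j else 0"
  have sub: "supp ?p \<subseteq> h ` T" by (rule supp_collect)
  have fin: "finite (supp ?p)" using sub assms(1) finite_surj by blast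
  have sub': "mi_ok n g \<and> wt w g \<in> A" if "g \<in> supp ?p" for g using that sub assms(2) by blast
  hence "?p \<in> polys n" using fin by (simp add: polys_def supp_def)
  moreover have "toF ?p = (\<Sum>j\<in>T. \<kappa> (v j) * xm (h j))" by (rule toF_collect[OF assms(1)])
  ultimately show ?thesis unfolding wts_def
    by (intro bexI[of _ ?p] conjI ballI) (simp_all only: sub')
qed

lemma wts_monomial: "mi_ok n g \<Longrightarrow> wt w g \<in> A \<Longrightarrow> wts w A (\<kappa> c * xm g)"
  using wtsI[of "{()}" "\<lambda>_. g" w A "\<lambda>_. c"] by simp

lemma wtsE:
  assumes "wts w A u"
  obtains T v where "finite T" "\<forall>g\<in>T. mi_ok n g \<and> wt w g \<in> A" "u = (\<Sum>g\<in>T. \<kappa> (v g) * xm g)"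
proof -
  obtain p where p: "p \<in> polys n" "u = toF p" "\<forall>g\<in>supp p. wt w g \<in> A"
    using assms unfolding wts_def by blast
  show ?thesis
    by (rule that[of "supp p" p]) (use p polysD[OF p(1)] in \<open>auto simp: toF_def\<close>)
qed

lemma wts_0: "wts w A 0"
  using wtsI[of "{}" id w A] by simp

lemma wts_add:
  assumes "wts w A u" "wts w A v"
  shows "wts w A (u + v)"
proof -
  obtain T a where T: "finite T" "\<forall>g\<in>T. mi_ok n g \<and> wt w g \<in> A" "u = (\<Sum>g\<in>T. \<kappa> (a g) * xm g)"
    using assms(1) by (rule wtsE)
  obtain T' b where T': "finite T'" "\<forall>g\<in>T'. mi_ok n g \<and> wt w g \<in> A" "v = (\<Sum>g\<in>T'. \<kappa> (b g) * xm g)"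
    using assms(2) by (rule wtsE)
  \<comment> \<open>The disjoint sum of index sets keeps exponents common to both supports
    apart.\<close>
  have "wts w A (\<Sum>j\<in>T <+> T'. \<kappa> (case_sum a b j) * xm (case_sum id id j))"
    by (rule wtsI) (use T(1,2) T'(1,2) in auto)
  thus ?thesis using T(1,3) T'(1,3) by (simp add: sum.Plus)
qed

lemma wts_mult:
  assumes "wts w A u" "wts w B v" and AB: "\<And>a b. a \<in> A \<Longrightarrow> b \<in> B \<Longrightarrow> a + b \<in> C"
  shows "wts w C (u * v)"
proof -
  obtain T a where T: "finite T" "\<forall>g\<in>T. mi_ok n g \<and> wt w g \<in> A" "u = (\<Sum>g\<in>T. \<kappa> (a g) * xm g)"
    using assms(1) by (rule wtsE)
  obtain T' b where T': "finite T'" "\<forall>g\<in>T'. mi_ok n g \<and> wt w g \<in> B" "v = (\<Sum>g\<in>T'. \<kappa> (b g) * xm g)"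
    using assms(2) by (rule wtsE)
  have "wts w C (\<Sum>j\<in>T \<times> T'. \<kappa> (a (fst j) * b (snd j)) * xm (\<lambda>i. fst j i + snd j i))"
  proof (rule wtsI)
    fix j assume "j \<in> T \<times> T'"
    hence "mi_ok n (fst j) \<and> wt w (fst j) \<in> A" "mi_ok n (snd j) \<and> wt w (snd j) \<in> B"
      using T(2) T'(2) by auto
    thus "mi_ok n (\<lambda>i. fst j i + snd j i) \<and> wt w (\<lambda>i. fst j i + snd j i) \<in> C"
      using AB by (auto simp: mi_ok_def wt_add)
  qed (use T T' in simp)
  also have "(\<Sum>j\<in>T \<times> T'. \<kappa> (a (fst j) * b (snd j)) * xm (\<lambda>i. fst j i + snd j i)) = u * v"
    by (simp add: T(3) T'(3) sum_product sum.cartesian_product case_prod_beta' xmN_add \<kappa>_mult mult_ac)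
  finally show ?thesis .
qed

lemma wts_\<kappa>: "wts w {0} (\<kappa> c)"
  using wts_monomial[of "\<lambda>_. 0" w "{0}" c] by (simp add: wt_def mi_ok_def)

lemma wts_uminus: "wts w A u \<Longrightarrow> wts w A (- u)"
  using wts_mult[OF wts_\<kappa>[of w "- 1"], of A u A] by (simp add: \<kappa>_uminus)

lemma wts_mono: "wts w A u \<Longrightarrow> A \<subseteq> B \<Longrightarrow> wts w B u"
  unfolding wts_def by blast

lemma wts_d:
  assumes "wts w A u" and i: "i < n" and AB: "\<And>a. a \<in> A \<Longrightarrow> a - w i \<in> B"
  shows "wts w B (d i u)"
proof -
  obtain T c where T: "finite T" "\<forall>g\<in>T. mi_ok n g \<and> wt w g \<in> A" "u = (\<Sum>g\<in>T. \<kappa> (c g) * xm g)"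
    using assms(1) by (rule wtsE)
  have "d i u = (\<Sum>g\<in>T. \<kappa> (c g * of_nat (g i)) * xm (g(i := g i - 1)))"
    unfolding T(3) d_sum by (intro sum.cong refl) (use T(2) i in \<open>auto simp: d_simps d_xm \<kappa>_mult\<close>)
  \<comment> \<open>Exponents with \<open>g i = 0\<close> have to go: truncation would leave them
    with the weight of \<open>g\<close> instead of \<open>wt w g - w i\<close>.\<close>
  also have "\<dots> = (\<Sum>g\<in>{g\<in>T. g i \<noteq> 0}. \<kappa> (c g * of_nat (g i)) * xm (g(i := g i - 1)))"
    by (rule sum.mono_neutral_right) (use T(1) in auto)
  also have "wts w B \<dots>"
  proof (rule wtsI)
    fix g assume g: "g \<in> {g\<in>T. g i \<noteq> 0}"
    hence "wt w (g(i := g i - 1)) = wt w g - w i" using i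
      by (simp add: wt_upd of_nat_diff algebra_simps)
    thus "mi_ok n (g(i := g i - 1)) \<and> wt w (g(i := g i - 1)) \<in> B"
      using g T(2) AB by (auto simp: mi_ok_def)
  qed (use T(1) in simp)
  finally show ?thesis .
qed

lemma toF_diff:
  assumes "p \<in> polys n" "q \<in> polys n"
  shows "toF p - toF q = toF (\<lambda>g. p g - q g)" "(\<lambda>g. p g - q g) \<in> polys n"
proof -
  obtain s t where st: "p \<in> pbox s" "q \<in> pbox t" using assms polys_pbox by metis
  have e: "(\<lambda>g. p g - q g) = padd p (psmult (- 1) q)" by (simp add: padd_def psmult_def)
  have P: "p \<in> pbox (max s t)" and Q: "psmult (- 1) q \<in> pbox (max s t)"
    using st psmult(1)[OF pbox_mono[OF _ st(2)]] pbox_mono[OF _ st(1)] by auto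
  show "toF p - toF q = toF (\<lambda>g. p g - q g)" "(\<lambda>g. p g - q g) \<in> polys n"
    unfolding e using padd[OF P Q] psmult(2)[OF st(2)] by (auto simp: \<kappa>_uminus intro: pbox_polys)
qed

lemma wts_disjoint:
  assumes "wts w A u" "wts w B u" "A \<inter> B = {}"
  shows "u = 0"
proof -
  obtain p where p: "p \<in> polys n" "u = toF p" "\<forall>g\<in>supp p. wt w g \<in> A"
    using assms(1) unfolding wts_def by blast
  obtain q where q: "q \<in> polys n" "u = toF q" "\<forall>g\<in>supp q. wt w g \<in> B"
    using assms(2) unfolding wts_def by blast
  have "toF (\<lambda>g. p g - q g) = 0" using toF_diff(1)[OF p(1) q(1)] p(2) q(2) by simp
  hence "(\<lambda>g. p g - q g) = (\<lambda>_. 0)" by (rule toF_eq_0[OF toF_diff(2)[OF p(1) q(1)]])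
  hence "p g = q g" for g by (metis right_minus_eq)
  hence "supp p = supp q" by (simp add: supp_def)
  hence "supp p = {}" using p(3) q(3) assms(3) by blast
  thus ?thesis using p(2) by (simp add: toF_def)
qed

text \<open>\<open>p0\<close> is the part of \<open>p\<close> in weight \<open>c\<close> and may be
  zero; excluding zero would break closure under sums and derivatives, where leading parts can
  vanish.\<close>

definition lead :: "(nat \<Rightarrow> real) \<Rightarrow> real \<Rightarrow> 'a \<Rightarrow> 'a \<Rightarrow> bool" where
  "lead w c p p0 \<longleftrightarrow> wts w {c} p0 \<and> wts w {c<..} (p - p0)"

lemma lead_add: "lead w c p p0 \<Longrightarrow> lead w c q q0 \<Longrightarrow> lead w c (p + q) (p0 + q0)"
  using wts_add[of w "{c<..}" "p - p0" "q - q0"] wts_add[of w "{c}" p0 q0]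
  by (simp add: lead_def algebra_simps)

lemma lead_mult:
  assumes "lead w c p p0" "lead w e q q0"
  shows "lead w (c + e) (p * q) (p0 * q0)"
proof -
  have p: "wts w {c} p0" "wts w {c<..} (p - p0)" and q: "wts w {e} q0" "wts w {e<..} (q - q0)"
    using assms by (auto simp: lead_def)
  have "wts w {c + e<..} ((p - p0) * (q - q0) + (p - p0) * q0 + p0 * (q - q0))"
    by (intro wts_add wts_mult[OF p(2) q(2)] wts_mult[OF p(2) q(1)] wts_mult[OF p(1) q(2)]) auto
  moreover have "(p - p0) * (q - q0) + (p - p0) * q0 + p0 * (q - q0) = p * q - p0 * q0"
    by (simp add: algebra_simps)
  moreover have "wts w {c + e} (p0 * q0)" by (rule wts_mult[OF p(1) q(1)]) auto
  ultimately show ?thesis by (simp add: lead_def)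
qed

lemma lead_d: "lead w c p p0 \<Longrightarrow> i < n \<Longrightarrow> lead w (c - w i) (d i p) (d i p0)"
  using wts_d[of w "{c}" p0 i "{c - w i}"] wts_d[of w "{c<..}" "p - p0" i "{c - w i<..}"]
  by (simp add: lead_def d_simps)

lemma lead_hom: "wts w {c} p \<Longrightarrow> lead w c p p"
  by (simp add: lead_def wts_0)

lemma lead_\<kappa>: "lead w 0 (\<kappa> c) (\<kappa> c)"
  by (rule lead_hom[OF wts_\<kappa>])

lemma lead_1: "lead w 0 1 1"
  using lead_\<kappa>[of w 1] by simp

lemma lead_uminus: "lead w c p p0 \<Longrightarrow> lead w c (- p) (- p0)"
  using lead_mult[OF lead_\<kappa>[of w "- 1"]] by (fastforce simp: \<kappa>_uminus)

lemma lead_diff: "lead w c p p0 \<Longrightarrow> lead w c q q0 \<Longrightarrow> lead w c (p - q) (p0 - q0)"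
  using lead_add[of w c p p0 "- q" "- q0"] lead_uminus by simp

lemma lead_power: "lead w c p p0 \<Longrightarrow> lead w (real k * c) (p ^ k) (p0 ^ k)"
proof (induction k)
  case (Suc k)
  show ?case using lead_mult[OF Suc.prems Suc.IH[OF Suc.prems]] by (simp add: distrib_right)
qed (simp add: lead_1)

lemma lead_lower:
  assumes "lead w c p p0" "e < c"
  shows "lead w e p 0"
proof -
  have "wts w {e<..} ((p - p0) + p0)"
    using assms by (intro wts_add) (auto simp: lead_def elim: wts_mono)
  thus ?thesis by (simp add: lead_def wts_0)
qed

lemma lead_0: "lead w c 0 p0 \<Longrightarrow> p0 = 0"
proof -
  assume l: "lead w c 0 p0"
  hence "wts w {c<..} p0" using wts_uminus[of w "{c<..}" "0 - p0"] by (simp add: lead_def)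
  thus ?thesis using wts_disjoint[of w "{c}" p0 "{c<..}"] l by (simp add: lead_def)
qed

text \<open>\<open>Ini w c u h\<close>: the expansion of \<open>u\<close> starts in weight \<open>c\<close> with the term \<open>h\<close>, which may be zero.\<close>

definition Ini :: "(nat \<Rightarrow> real) \<Rightarrow> real \<Rightarrow> 'a \<Rightarrow> 'a \<Rightarrow> bool" where
  "Ini w c u h \<longleftrightarrow> (\<exists>p q p0 q0 e. u = p / q \<and> h = p0 / q0 \<and> q \<noteq> 0 \<and> q0 \<noteq> 0 \<and>
    lead w (c + e) p p0 \<and> lead w e q q0)"

lemma IniI:
  "u = p / q \<Longrightarrow> h = p0 / q0 \<Longrightarrow> q0 \<noteq> 0 \<Longrightarrow> lead w (c + e) p p0 \<Longrightarrow> lead w e q q0 \<Longrightarrow> Ini w c u h"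
  unfolding Ini_def by (intro exI[of _ p] exI[of _ q] exI[of _ p0] exI[of _ q0] exI[of _ e]) (auto dest: lead_0)

lemma IniE:
  assumes "Ini w c u h"
  obtains p q p0 q0 e where "u = p / q" "h = p0 / q0" "q \<noteq> 0" "q0 \<noteq> 0" "lead w (c + e) p p0" "lead w e q q0"
  using assms unfolding Ini_def by blast

lemma Ini_add:
  assumes "Ini w c u h" "Ini w c u' h'"
  shows "Ini w c (u + u') (h + h')"
proof -
  obtain p q p0 q0 e where 1: "u = p / q" "h = p0 / q0" "q \<noteq> 0" "q0 \<noteq> 0" "lead w (c + e) p p0" "lead w e q q0"
    using assms(1) by (rule IniE)
  obtain p' q' p0' q0' e' where 2: "u' = p' / q'" "h' = p0' / q0'" "q' \<noteq> 0" "q0' \<noteq> 0"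
    "lead w (c + e') p' p0'" "lead w e' q' q0'"
    using assms(2) by (rule IniE)
  show ?thesis
  proof (rule IniI)
    show "u + u' = (p * q' + p' * q) / (q * q')" using 1 2 by (simp add: field_simps)
    show "h + h' = (p0 * q0' + p0' * q0) / (q0 * q0')" using 1 2 by (simp add: field_simps)
    show "lead w (e + e') (q * q') (q0 * q0')" by (rule lead_mult[OF 1(6) 2(6)])
    show "lead w (c + (e + e')) (p * q' + p' * q) (p0 * q0' + p0' * q0)"
      using lead_add[OF lead_mult[OF 1(5) 2(6)], of "p' * q" "p0' * q0"] lead_mult[OF 2(5) 1(6)]
      by (simp add: add_ac)
    show "q0 * q0' \<noteq> 0" using 1 2 by simp
  qed
qed

lemma Ini_lead_mult:
  assumes "lead w a v v0" "Ini w c u h"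
  shows "Ini w (a + c) (v * u) (v0 * h)"
proof -
  obtain p q p0 q0 e where 1: "u = p / q" "h = p0 / q0" "q \<noteq> 0" "q0 \<noteq> 0" "lead w (c + e) p p0" "lead w e q q0"
    using assms(2) by (rule IniE)
  show ?thesis
    by (rule IniI[of _ "v * p" q _ "v0 * p0" q0 _ _ e])
      (use 1 lead_mult[OF assms(1) 1(5)] in \<open>simp_all add: add.assoc\<close>)
qed

lemma Ini_d:
  assumes "Ini w c u h" and i: "i < n"
  shows "Ini w (c - w i) (d i u) (d i h)"
proof -
  obtain p q p0 q0 e where 1: "u = p / q" "h = p0 / q0" "q \<noteq> 0" "q0 \<noteq> 0" "lead w (c + e) p p0" "lead w e q q0"
    using assms(1) by (rule IniE)
  have dq: "d i (a / b) = (d i a * b - a * d i b) / (b * b)" if "b \<noteq> 0" for a b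
    using d_divide_power[OF that, of i a 1] by (simp add: power2_eq_square)
  show ?thesis
  proof (rule IniI)
    show "d i u = (d i p * q - p * d i q) / (q * q)" using 1 dq by simp
    show "d i h = (d i p0 * q0 - p0 * d i q0) / (q0 * q0)" using 1 dq by simp
    show "lead w (e + e) (q * q) (q0 * q0)" by (rule lead_mult[OF 1(6) 1(6)])
    have "lead w (c - w i + (e + e)) (d i p * q) (d i p0 * q0)"
      using lead_mult[OF lead_d[OF 1(5) i] 1(6)] by (simp add: algebra_simps)
    moreover have "lead w (c - w i + (e + e)) (p * d i q) (p0 * d i q0)"
      using lead_mult[OF 1(5) lead_d[OF 1(6) i]] by (simp add: algebra_simps)
    ultimately show "lead w (c - w i + (e + e)) (d i p * q - p * d i q) (d i p0 * q0 - p0 * d i q0)"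
      by (rule lead_diff)
    show "q0 * q0 \<noteq> 0" using 1 by simp
  qed
qed

lemma Ini_lower:
  assumes "Ini w c u h" "e < c"
  shows "Ini w e u 0"
proof -
  obtain p q p0 q0 a where 1: "u = p / q" "h = p0 / q0" "q \<noteq> 0" "q0 \<noteq> 0" "lead w (c + a) p p0" "lead w a q q0"
    using assms(1) by (rule IniE)
  show ?thesis
    by (rule IniI[of _ p q _ 0 q0 _ _ a]) (use 1 lead_lower[OF 1(5), of "e + a"] assms(2) in simp_all)
qed

lemma Ini_0: "Ini w c 0 h \<Longrightarrow> h = 0"
  by (erule IniE) (auto dest: lead_0)

lemma Ini_zero: "Ini w c 0 0"
  by (rule IniI[of _ 0 1 _ 0 1 _ _ 0]) (simp_all add: lead_1 lead_hom wts_0)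

lemma Ini_sum:
  "(\<And>t. t \<in> T \<Longrightarrow> Ini w c (u t) (h t)) \<Longrightarrow> Ini w c (sum u T) (sum h T)"
  by (induction T rule: infinite_finite_induct) (auto simp: Ini_zero Ini_add)

lemma Ini_D_power: "Ini w c u h \<Longrightarrow> i < n \<Longrightarrow> Ini w (c - w i * real k) (app (D i ^ k) u) (app (D i ^ k) h)"
proof (induction k)
  case (Suc k)
  show ?case using Ini_d[OF Suc.IH[OF Suc.prems] Suc.prems(2)] by (simp add: algebra_simps)
qed simp

lemma Ini_DN:
  "Ini w c u h \<Longrightarrow> N \<le> n \<Longrightarrow> Ini w (c - (\<Sum>i<N. w i * real (b i))) (app (DN N b) u) (app (DN N b) h)"
proof (induction N arbitrary: c u h)
  case (Suc N)
  have "Ini w (c - w N * real (b N)) (app (D N ^ b N) u) (app (D N ^ b N) h)"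
    using Suc.prems by (intro Ini_D_power) auto
  from Suc.IH[OF this] Suc.prems(2) show ?case by (simp add: DN_Suc algebra_simps)
qed simp

lemma Ini_M:
  assumes "Ini w c u h" "mi_ok n (fst m)"
  shows "Ini w (c - weight n w m) (app (M m) u) (app (M m) h)"
proof -
  have "lead w (wt w (fst m)) (xm (fst m)) (xm (fst m))"
    using wts_monomial[of "fst m" w "{wt w (fst m)}" 1] assms(2) by (intro lead_hom) simp
  from Ini_lead_mult[OF this Ini_DN[OF assms(1) order_refl, of "snd m"]]
  show ?thesis by (simp add: M_def weight_wt wt_def[of w "snd m"] algebra_simps)
qed

text \<open>A term of \<open>P\<close> of smaller weight lands strictly above \<open>c\<close> minus
  the maximal weight, so \<open>Ini_lower\<close> assigns it leading part zero there; the terms of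
  maximal weight contribute the initial form.\<close>

lemma Ini_op:
  assumes P: "P \<in> weyl_alg n" and u: "Ini w c u h"
  shows "Ini w (c - Max (weight n w ` supp P)) (app (op P) u) (app (op (in_w n w P)) h)"
proof -
  let ?W = "Max (weight n w ` supp P)"
  have fin: "finite (supp P)" by (rule weyl_algD(1)[OF P])
  have "op (in_w n w P) = (\<Sum>m\<in>supp P. kk (in_w n w P m) * M m)"
    by (rule op_eq_sum[OF fin]) (auto simp: supp_def in_w_def)
  hence "app (op (in_w n w P)) h = (\<Sum>m\<in>supp P. \<kappa> (in_w n w P m) * app (M m) h)"
    by (simp add: app_sum_left)
  moreover have "Ini w (c - ?W) (\<kappa> (P m) * app (M m) u) (\<kappa> (in_w n w P m) * app (M m) h)"
    if m: "m \<in> supp P" for m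
  proof -
    have I: "Ini w (c - weight n w m) (\<kappa> (P m) * app (M m) u) (\<kappa> (P m) * app (M m) h)"
      using Ini_lead_mult[OF lead_\<kappa> Ini_M[OF u weyl_algD(2)[OF P m]]] by simp
    have le: "weight n w m \<le> ?W" using fin m by simp
    show ?thesis
    proof (cases "weight n w m = ?W")
      case True
      hence "in_w n w P m = P m" by (simp add: in_w_def)
      thus ?thesis using I True by simp
    next
      case False
      hence "in_w n w P m = 0" by (simp add: in_w_def)
      thus ?thesis using Ini_lower[OF I, of "c - ?W"] le False by simp
    qed
  qed
  ultimately show ?thesis by (simp add: app_op Ini_sum)
qed

section \<open>Integer powers as eigenvectors of the Euler operator\<close>

definition zpow :: "'a \<Rightarrow> int \<Rightarrow> 'a" where
  "zpow u l = (if l \<ge> 0 then u ^ nat l else 1 / u ^ nat (- l))"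

lemma val_fpow: "f \<in> polys n \<Longrightarrow> val f (fpow f l) = zpow (toF f) l"
proof -
  assume "f \<in> polys n"
  then obtain t where t: "f \<in> pbox t" by (rule polys_pbox)
  show ?thesis using ppow[OF t] pone(2) by (simp add: val_def fpow_def zpow_def)
qed

lemma Ini_zpow:
  assumes "lead w c u u0" "u0 \<noteq> 0"
  shows "Ini w (of_int l * c) (zpow u l) (zpow u0 l)"
proof (cases "l \<ge> 0")
  case True
  have "lead w (of_int l * c + 0) (u ^ nat l) (u0 ^ nat l)"
    using lead_power[OF assms(1), of "nat l"] True by simp
  thus ?thesis using True
    by (intro IniI[of _ "u ^ nat l" 1 _ "u0 ^ nat l" 1 _ _ 0]) (auto simp: zpow_def lead_1)
next
  case False
  have "lead w (real (nat (- l)) * c) (u ^ nat (- l)) (u0 ^ nat (- l))"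
    by (rule lead_power[OF assms(1)])
  thus ?thesis using False assms(2) lead_1[of w]
    by (intro IniI[of _ 1 "u ^ nat (- l)" _ 1 "u0 ^ nat (- l)" _ _ "real (nat (- l)) * c"])
      (auto simp: zpow_def)
qed

lemma app_S_hom:
  assumes "wts w {c} u"
  shows "app (S w) u = \<kappa> (of_real c) * u"
proof -
  obtain T v where T: "finite T" "\<forall>g\<in>T. mi_ok n g \<and> wt w g \<in> {c}" "u = (\<Sum>g\<in>T. \<kappa> (v g) * xm g)"
    using assms by (rule wtsE)
  have S\<kappa>: "app (S w) (\<kappa> a) = 0" for a by (simp add: app_S)
  have "app (S w) (xm g) = \<kappa> (of_real c) * xm g" if "g \<in> T" for g
  proof -
    have "graded w (wt w g) (mu (xm g))" unfolding wt_def by (rule graded_xmN[OF order_refl])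
    hence "app (S w * mu (xm g)) 1 = app (mu (xm g) * S w + kk (of_real (wt w g)) * mu (xm g)) 1"
      by (simp add: graded_def)
    thus ?thesis using bspec[OF T(2) that] S\<kappa>[of 1] by simp
  qed
  thus ?thesis by (simp add: T(3) app_sum app_S_mult S\<kappa> sum_distrib_left mult_ac)
qed

lemma app_S_1: "app (S w) 1 = 0"
  by (simp add: app_S d_simps)

lemma app_S_power: "app (S w) u = \<kappa> a * u \<Longrightarrow> app (S w) (u ^ k) = \<kappa> (of_nat k * a) * u ^ k"
proof (induction k)
  case 0
  show ?case by (simp add: app_S d_simps)
next
  case (Suc k)
  thus ?case by (simp add: app_S_mult \<kappa>_add \<kappa>_mult algebra_simps)
qed

lemma app_S_zpow:
  assumes S: "app (S w) u = \<kappa> a * u" and u: "u \<noteq> 0"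
  shows "app (S w) (zpow u l) = \<kappa> (of_int l * a) * zpow u l"
proof (cases "l \<ge> 0")
  case True
  have "complex_of_int l = of_nat (nat l)" using True by simp
  thus ?thesis using app_S_power[OF S, of "nat l"] True by (simp add: zpow_def)
next
  case False
  let ?k = "nat (- l)"
  define U y where "U = u ^ ?k" and "y = 1 / u ^ ?k"
  have Uy: "U * y = 1" "U \<noteq> 0" using u by (auto simp: U_def y_def)
  have SU: "app (S w) U = \<kappa> (of_nat ?k * a) * U" unfolding U_def by (rule app_S_power[OF S])
  \<comment> \<open>Applying the Euler derivation, which kills 1, to \<open>U * y = 1\<close> gives
    the eigenvalue of the inverse power.\<close>
  have "app (S w) U * y + U * app (S w) y = app (S w) 1"
    using app_S_mult[of w U y] Uy(1) by simp
  hence "U * (\<kappa> (of_nat ?k * a) * y + app (S w) y) = 0"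
    unfolding SU app_S_1 by (simp only: distrib_left mult.left_commute[of U "\<kappa> _"] mult.assoc)
  hence "app (S w) y = - \<kappa> (of_nat ?k * a) * y" using Uy(2) by (simp add: add_eq_0_iff)
  moreover have "complex_of_int l * a = - (of_nat ?k * a)" using False by simp
  moreover have "zpow u l = y" using False by (simp add: zpow_def y_def)
  ultimately show ?thesis by (simp only: \<kappa>_uminus)
qed

lemma app_evS:
  assumes "app (S w) u = \<kappa> a * u"
  shows "app (evS w p) u = \<kappa> (poly p a) * u"
proof (induction p)
  case (pCons b p)
  have "app (evS w (pCons b p)) u = \<kappa> b * u + app (S w) (\<kappa> (poly p a) * u)"
    by (simp add: evS_pCons pCons.IH)
  also have "app (S w) (\<kappa> (poly p a) * u) = \<kappa> (poly p a) * (\<kappa> a * u)"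
    using assms by (simp add: app_S_mult) (simp add: app_S)
  finally show ?case by (simp add: \<kappa>_add \<kappa>_mult algebra_simps)
qed simp

text \<open>The initial ideal annihilates the initial form of \<open>f\<^sup>l\<close>, which is an eigenvector of the Euler operator.\<close>

lemma bideal_Ann_root:
  assumes f: "f \<in> polys n" and fnz: "f \<noteq> (\<lambda>_. 0)"
    and lead: "lead w c (toF f) u0" "u0 \<noteq> 0" and p: "p \<in> bideal n w (Ann n f l)"
  shows "poly p (of_real (of_int l * c)) = 0"
proof -
  let ?I = "Ann n f l"
  have I: "?I \<subseteq> weyl_alg n" by (auto simp: Ann_def)
  let ?h = "zpow u0 l"
  have "evS w p \<in> J w ?I" using p bideal_iff[OF I] by simp
  with I have "app (evS w p) ?h = 0"
  proof (induction rule: J_induct)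
    case (gen B P)
    have P: "P \<in> weyl_alg n" "app (op P) (zpow (toF f) l) = 0"
      using gen(2) Ann_iff[OF f fnz] val_fpow[OF f] by auto
    from Ini_op[OF P(1) Ini_zpow[OF lead, of l]] P(2)
    have "app (op (in_w n w P)) ?h = 0" using Ini_0 by simp
    thus ?case by simp
  qed auto
  moreover have "app (S w) ?h = \<kappa> (of_int l * of_real c) * ?h"
    using lead by (intro app_S_zpow app_S_hom) (auto simp: lead_def)
  hence "app (evS w p) ?h = \<kappa> (poly p (of_int l * of_real c)) * ?h" by (rule app_evS)
  moreover have "?h \<noteq> 0" using lead(2) by (simp add: zpow_def)
  ultimately show ?thesis by simp
qed

text \<open>A convex combination of weights is at least their minimum, and the point mass at a
  minimising exponent attains it.\<close>

lemma ord_f_eq_Min: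
  assumes f: "f \<in> polys n" and fnz: "f \<noteq> (\<lambda>_. 0)"
  shows "ord_f n f w = Min (wt w ` supp f)"
proof -
  have fin: "finite (supp f)" by (rule polysD(1)[OF f])
  have ne: "supp f \<noteq> {}" using fnz by (auto simp: supp_def fun_eq_iff)
  have lin: "(\<Sum>i<n. (\<Sum>g\<in>supp f. t g * real (g i)) * w i) = (\<Sum>g\<in>supp f. t g * wt w g)" for t :: "mi \<Rightarrow> real"
    unfolding wt_def sum_distrib_left sum_distrib_right by (subst sum.swap) (simp add: mult_ac)
  show ?thesis unfolding ord_f_def
  proof (rule cInf_eq_minimum)
    have "Min (wt w ` supp f) \<in> wt w ` supp f" using fin ne by simp
    then obtain g0 where g0: "g0 \<in> supp f" "Min (wt w ` supp f) = wt w g0" by auto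
    let ?t = "\<lambda>g. if g = g0 then 1 else 0 :: real"
    have "(\<lambda>i. \<Sum>g\<in>supp f. ?t g * real (g i)) \<in> newton f"
      unfolding newton_def using g0 fin by (intro CollectI exI[of _ ?t]) auto
    moreover have "(\<Sum>i<n. (\<Sum>g\<in>supp f. ?t g * real (g i)) * w i) = wt w g0"
    proof -
      have "(\<Sum>g\<in>supp f. ?t g * wt w g) = (\<Sum>g\<in>supp f. if g = g0 then wt w g0 else 0)"
        by (intro sum.cong) auto
      thus ?thesis unfolding lin using g0 fin by simp
    qed
    ultimately show "Min (wt w ` supp f) \<in> (\<lambda>v. \<Sum>i<n. v i * w i) ` newton f"
      unfolding g0(2) by (intro image_eqI[of _ _ "\<lambda>i. \<Sum>g\<in>supp f. ?t g * real (g i)"]) simp_all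
  next
    fix y assume "y \<in> (\<lambda>v. \<Sum>i<n. v i * w i) ` newton f"
    then obtain t where t: "\<forall>g\<in>supp f. t g \<ge> 0" "(\<Sum>g\<in>supp f. t g) = 1"
      and y: "y = (\<Sum>i<n. (\<Sum>g\<in>supp f. t g * real (g i)) * w i)"
      unfolding newton_def by auto
    have "Min (wt w ` supp f) = (\<Sum>g\<in>supp f. t g * Min (wt w ` supp f))"
      by (simp only: sum_distrib_right[symmetric] t(2) mult_1)
    also have "\<dots> \<le> (\<Sum>g\<in>supp f. t g * wt w g)"
      using t(1) fin by (intro sum_mono mult_left_mono) auto
    finally show "Min (wt w ` supp f) \<le> y" unfolding y lin .
  qed
qed

lemma lead_toF:
  assumes f: "f \<in> polys n" and fnz: "f \<noteq> (\<lambda>_. 0)"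
  obtains u0 where "lead w (Min (wt w ` supp f)) (toF f) u0" "u0 \<noteq> 0"
proof -
  let ?c = "Min (wt w ` supp f)"
  have fin: "finite (supp f)" by (rule polysD(1)[OF f])
  have ne: "supp f \<noteq> {}" using fnz by (auto simp: supp_def fun_eq_iff)
  define A where "A = {g \<in> supp f. wt w g = ?c}"
  define u0 where "u0 = (\<Sum>g\<in>A. \<kappa> (f g) * xm g)"
  have A: "finite A" "A \<subseteq> supp f" using fin by (auto simp: A_def)
  have "toF f = u0 + (\<Sum>g\<in>supp f - A. \<kappa> (f g) * xm g)"
    unfolding toF_def u0_def using sum.subset_diff[OF A(2) fin] by (simp add: add.commute)
  hence "toF f - u0 = (\<Sum>g\<in>supp f - A. \<kappa> (f g) * xm g)" by simp
  moreover have "wts w {?c<..} (\<Sum>g\<in>supp f - A. \<kappa> (f g) * xm g)"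
  proof (rule wtsI)
    fix g assume g: "g \<in> supp f - A"
    hence "?c \<le> wt w g" "wt w g \<noteq> ?c" using fin by (auto simp: A_def)
    thus "mi_ok n g \<and> wt w g \<in> {?c<..}" using polysD(2)[OF f] g by auto
  qed (use fin in simp)
  moreover have "wts w {?c} u0" unfolding u0_def
    by (rule wtsI) (use A polysD(2)[OF f] in \<open>auto simp: A_def\<close>)
  ultimately have "lead w ?c (toF f) u0" by (simp add: lead_def)
  moreover have "u0 \<noteq> 0"
  proof
    assume z: "u0 = 0"
    have "?c \<in> wt w ` supp f" using fin ne by simp
    then obtain g where g: "g \<in> A" by (auto simp: A_def)
    have "f g = 0"
      by (rule monomials_indep[OF A(1) _ _ g]) (use A polysD(2)[OF f] z in \<open>auto simp: u0_def xmN_def\<close>)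
    thus False using g by (simp add: A_def supp_def)
  qed
  ultimately show ?thesis by (rule that)
qed

end

section \<open>Nonnegative powers\<close>

text \<open>With m = \<beta> - \<alpha>, the identity C(\<beta>, \<alpha>+j) C(\<alpha>+j, \<alpha>)
  = C(\<beta>, \<alpha>) C(m, j) turns the sum into the expansion of (1 - 1)^m; the bound on \<beta>
  ensures that this expansion is complete.\<close>

lemma alternating_binomial_sum:
  fixes \<alpha> \<beta> t :: nat
  assumes "\<beta> \<le> t"
  shows "(\<Sum>j\<le>t. (- 1) ^ j / (fact \<alpha> * fact j) * of_nat ((\<beta> choose (\<alpha> + j)) * fact (\<alpha> + j)))
    = (if \<beta> = \<alpha> then 1 else 0 :: complex)"
proof (cases "\<alpha> \<le> \<beta>")
  case False
  thus ?thesis by (auto intro!: sum.neutral simp: binomial_eq_0)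
next
  case True
  define m where "m = \<beta> - \<alpha>"
  have summand: "(- 1) ^ j / (fact \<alpha> * fact j) * of_nat ((\<beta> choose (\<alpha> + j)) * fact (\<alpha> + j))
      = of_nat (\<beta> choose \<alpha>) * ((- 1) ^ j * of_nat (m choose j) :: complex)" for j
  proof (cases "\<alpha> + j \<le> \<beta>")
    case le: True
    have "(\<beta> choose (\<alpha> + j)) * ((\<alpha> + j) choose \<alpha>) = (\<beta> choose \<alpha>) * (m choose j)"
      using choose_mult[OF _ le, of \<alpha>] by (simp add: m_def)
    hence "of_nat (\<beta> choose (\<alpha> + j)) * of_nat ((\<alpha> + j) choose \<alpha>) = (of_nat (\<beta> choose \<alpha>) * of_nat (m choose j) :: complex)"
      by (simp only: of_nat_mult[symmetric])
    moreover have "of_nat ((\<alpha> + j) choose \<alpha>) = (fact (\<alpha> + j) / (fact \<alpha> * fact j) :: complex)"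
      by (subst binomial_fact) auto
    ultimately show ?thesis by (simp add: field_simps)
  next
    case False
    hence "\<beta> < \<alpha> + j" "m < j" using True by (auto simp: m_def)
    thus ?thesis by (simp add: binomial_eq_0)
  qed
  have "(\<Sum>j\<le>t. (- 1) ^ j * of_nat (m choose j) :: complex) = (\<Sum>j\<le>m. (- 1) ^ j * of_nat (m choose j))"
    using assms by (intro sum.mono_neutral_right) (auto simp: m_def binomial_eq_0)
  also have "\<dots> = (if m = 0 then 1 else 0)"
    using choose_alternating_sum[of m, where 'a = complex] by auto
  finally have "(\<Sum>j\<le>t. (- 1) ^ j * of_nat (m choose j) :: complex) = (if m = 0 then 1 else 0)" .
  thus ?thesis using True unfolding summand sum_distrib_left[symmetric] by (auto simp: m_def)
qed

lemma sum_Box_prod: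
  fixes \<phi> :: "nat \<Rightarrow> nat \<Rightarrow> complex"
  shows "(\<Sum>b\<in>Box n t. \<Prod>i<n. \<phi> i (b i)) = (\<Prod>i<n. \<Sum>j\<le>t. \<phi> i j)"
proof -
  have "(\<Sum>b\<in>Box n t. \<Prod>i<n. \<phi> i (b i)) = (\<Sum>g\<in>PiE {..<n} (\<lambda>_. {..t}). \<Prod>i<n. \<phi> i (if i < n then g i else 0))"
    by (rule sum.reindex_bij_betw[OF bij_Box, symmetric])
  also have "\<dots> = (\<Sum>g\<in>PiE {..<n} (\<lambda>_. {..t}). \<Prod>i<n. \<phi> i (g i))"
    by (intro sum.cong prod.cong) auto
  also have "\<dots> = (\<Prod>i<n. \<Sum>j\<le>t. \<phi> i j)"
    by (rule prod_sum_PiE[symmetric]) auto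
  finally show ?thesis .
qed

text \<open>The two supports are separated by weight, so nothing cancels and the top weight is
  0.\<close>

lemma in_w_wadd:
  assumes "finite (supp E)" "finite (supp R)" and E: "E \<noteq> wzero" "\<And>m. m \<in> supp E \<Longrightarrow> weight n w m = 0"
    and R: "\<And>m. m \<in> supp R \<Longrightarrow> weight n w m < 0"
  shows "in_w n w (wadd E R) = E" "wadd E R \<noteq> wzero"
proof -
  have val: "wadd E R m = (if weight n w m = 0 then E m else R m)" for m
    using E(2)[of m] R[of m] by (cases "E m = 0"; cases "R m = 0") (auto simp: wadd_def supp_def)
  obtain m0 where m0: "E m0 \<noteq> 0" using E(1) by (auto simp: wzero_def fun_eq_iff)
  have w0: "weight n w m0 = 0" using E(2)[of m0] m0 by (simp add: supp_def)
  have m0': "m0 \<in> supp (wadd E R)" using m0 w0 by (simp add: supp_def val)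
  have fin: "finite (supp (wadd E R))"
    by (rule finite_subset[of _ "supp E \<union> supp R"]) (use assms(1,2) in \<open>auto simp: supp_def wadd_def\<close>)
  have max: "Max (weight n w ` supp (wadd E R)) = 0"
  proof (rule Max_eqI)
    show "0 \<in> weight n w ` supp (wadd E R)" using m0' w0 by force
    fix y assume "y \<in> weight n w ` supp (wadd E R)"
    then obtain m where m: "m \<in> supp (wadd E R)" "y = weight n w m" by blast
    show "y \<le> 0"
    proof (cases "weight n w m = 0")
      case False
      hence "m \<in> supp R" using m(1) by (simp add: supp_def val)
      thus ?thesis using R[of m] m(2) by simp
    qed (use m in simp)
  qed (use fin in simp)
  show "in_w n w (wadd E R) = E"
  proof
    fix m
    show "in_w n w (wadd E R) m = E m"
      using E(2)[of m] unfolding in_w_def max val by (auto simp: supp_def)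
  qed
  show "wadd E R \<noteq> wzero" using m0' by (auto simp: supp_def wzero_def)
qed

lemma unitv_inject: "unitv i = unitv j \<longleftrightarrow> i = j"
proof
  assume "unitv i = unitv j"
  hence "unitv j i = 1" using unitv_simps(1)[of i] by simp
  thus "i = j" by (auto simp: unitv_def split: if_splits)
qed simp

context diff_field
begin

text \<open>The operator \<open>\<Sum>\<^sub>b (- x)\<^sup>b \<partial>\<^sup>b / b!\<close> evaluates polynomials at \<open>0\<close> (Taylor expansion), so composing it
  with \<open>\<partial>\<^sup>\<alpha> / \<alpha>!\<close> extracts the coefficient of \<open>x\<^sup>\<alpha>\<close>.\<close>

lemma coefficient_extraction:
  assumes q: "q \<in> pbox t" and \<alpha>: "\<alpha> \<in> Box n t"
  shows "(\<Sum>b\<in>Box n t. \<kappa> (\<Prod>i<n. (- 1) ^ b i / (fact (\<alpha> i) * fact (b i))) *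
    app (M (\<lambda>i. \<gamma> i + b i, \<lambda>i. \<alpha> i + b i)) (toF q)) = \<kappa> (q \<alpha>) * xm \<gamma>"
proof -
  let ?c = "\<lambda>b. \<Prod>i<n. (- 1) ^ b i / (fact (\<alpha> i) * fact (b i)) :: complex"
  let ?M = "\<lambda>b. M (\<lambda>i. \<gamma> i + b i, \<lambda>i. \<alpha> i + b i)"
  have fin: "finite (supp q)" using polysD(1)[OF pbox_polys[OF q]] .
  have mono: "(\<Sum>b\<in>Box n t. \<kappa> (?c b) * app (?M b) (xm \<beta>)) = (if \<beta> = \<alpha> then xm \<gamma> else 0)"
    if \<beta>: "\<beta> \<in> Box n t" for \<beta>
  proof -
    \<comment> \<open>Differentiating \<alpha> + b times and multiplying by x^(\<gamma> + b) shifts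
      exponents independently of \<open>b\<close>, so \<open>?y\<close> factors out and a numerical
      sum remains. The subtraction can truncate only if \<beta> differs from \<alpha>, and then that
      sum is zero.\<close>
    let ?y = "xm (\<lambda>i. \<gamma> i + \<beta> i - \<alpha> i)"
    have ok: "mi_ok n \<beta>" "mi_ok n \<alpha>" using \<alpha> \<beta> by (auto simp: Box_def)
    have each: "app (?M b) (xm \<beta>) = \<kappa> (\<Prod>i<n. of_nat ((\<beta> i choose (\<alpha> i + b i)) * fact (\<alpha> i + b i))) * ?y"
      if b: "b \<in> Box n t" for b
    proof -
      have okb: "mi_ok n (\<lambda>i. \<alpha> i + b i)" using b ok by (auto simp: Box_def mi_ok_def)
      show ?thesis
      proof (cases "\<forall>i. \<alpha> i + b i \<le> \<beta> i")
        case True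
        have "(\<lambda>i. \<gamma> i + b i + \<beta> i - (\<alpha> i + b i)) = (\<lambda>i. \<gamma> i + \<beta> i - \<alpha> i)" by auto
        thus ?thesis using app_M_xm[OF okb ok(1), of "\<lambda>i. \<gamma> i + b i"] True by simp
      next
        case False
        then obtain i where i: "\<beta> i < \<alpha> i + b i" by (auto simp: not_le)
        hence "i < n" using okb by (metis mi_ok_def not_less not_less_zero)
        hence "(\<Prod>i<n. of_nat ((\<beta> i choose (\<alpha> i + b i)) * fact (\<alpha> i + b i)) :: complex) = 0"
          using i by (intro prod_zero) (auto simp: binomial_eq_0 intro!: bexI[of _ i])
        thus ?thesis using app_M_xm[OF okb ok(1), of "\<lambda>i. \<gamma> i + b i"] False by auto
      qed
    qed
    have "(\<Sum>b\<in>Box n t. \<kappa> (?c b) * app (?M b) (xm \<beta>)) = \<kappa> (\<Sum>b\<in>Box n t. \<Prod>i<n.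
        (- 1) ^ b i / (fact (\<alpha> i) * fact (b i)) * of_nat ((\<beta> i choose (\<alpha> i + b i)) * fact (\<alpha> i + b i))) * ?y"
      unfolding \<kappa>_sum sum_distrib_right
      by (intro sum.cong refl) (simp only: each prod.distrib \<kappa>_mult mult.assoc)
    also have "(\<Sum>b\<in>Box n t. \<Prod>i<n.
        (- 1) ^ b i / (fact (\<alpha> i) * fact (b i)) * of_nat ((\<beta> i choose (\<alpha> i + b i)) * fact (\<alpha> i + b i)))
      = (\<Prod>i<n. \<Sum>j\<le>t. (- 1) ^ j / (fact (\<alpha> i) * fact j) * of_nat ((\<beta> i choose (\<alpha> i + j)) * fact (\<alpha> i + j)) :: complex)"
      by (rule sum_Box_prod)
    also have "\<dots> = (\<Prod>i<n. if \<beta> i = \<alpha> i then 1 else 0)"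
      by (intro prod.cong refl alternating_binomial_sum) (use \<beta> in \<open>auto simp: Box_def\<close>)
    also have "\<dots> = (if \<beta> = \<alpha> then 1 else 0)"
    proof (cases "\<beta> = \<alpha>")
      case False
      then obtain i where i: "\<beta> i \<noteq> \<alpha> i" by blast
      hence "i < n" using ok by (metis mi_ok_def not_less)
      thus ?thesis using False i by (auto intro!: prod_zero)
    qed simp
    finally show ?thesis by auto
  qed
  have "(\<Sum>b\<in>Box n t. \<kappa> (?c b) * app (?M b) (toF q))
      = (\<Sum>b\<in>Box n t. \<Sum>\<beta>\<in>supp q. \<kappa> (q \<beta>) * (\<kappa> (?c b) * app (?M b) (xm \<beta>)))"
  proof (intro sum.cong refl)
    fix b
    have "app (?M b) (\<kappa> a * u) = \<kappa> a * app (?M b) u" for a u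
    proof -
      have "app (?M b * kk a) u = app (kk a * ?M b) u" by (simp only: kk_M)
      thus ?thesis by simp
    qed
    thus "\<kappa> (?c b) * app (?M b) (toF q) = (\<Sum>\<beta>\<in>supp q. \<kappa> (q \<beta>) * (\<kappa> (?c b) * app (?M b) (xm \<beta>)))"
      by (simp add: toF_def app_sum sum_distrib_left mult.left_commute)
  qed
  also have "\<dots> = (\<Sum>\<beta>\<in>supp q. \<kappa> (q \<beta>) * (\<Sum>b\<in>Box n t. \<kappa> (?c b) * app (?M b) (xm \<beta>)))"
    by (subst sum.swap) (simp add: sum_distrib_left)
  also have "\<dots> = (\<Sum>\<beta>\<in>supp q. if \<beta> = \<alpha> then \<kappa> (q \<alpha>) * xm \<gamma> else 0)"
    by (intro sum.cong refl) (use q in \<open>auto simp: mono pbox_def subset_iff\<close>)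
  also have "\<dots> = \<kappa> (q \<alpha>) * xm \<gamma>"
    using fin by (simp add: supp_def)
  finally show ?thesis .
qed

lemma app_S_xm: "mi_ok n g \<Longrightarrow> app (S w) (xm g) = \<kappa> (of_real (wt w g)) * xm g"
  using app_S_hom[of w "wt w g" "xm g"] wts_monomial[of g w "{wt w g}" 1] by simp

lemma app_S_toF:
  assumes "q \<in> polys n"
  shows "app (S w) (toF q) = (\<Sum>g\<in>supp q. \<kappa> (q g * of_real (wt w g)) * xm g)"
proof -
  have "app (S w) (\<kappa> (q g) * xm g) = \<kappa> (q g * of_real (wt w g)) * xm g" if "g \<in> supp q" for g
  proof -
    have "app (S w) (\<kappa> (q g)) = 0" by (simp add: app_S)
    thus ?thesis using app_S_xm[OF polysD(2)[OF assms that], of w]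
      by (simp add: app_S_mult \<kappa>_mult mult_ac)
  qed
  thus ?thesis by (simp add: toF_def app_sum)
qed

text \<open>The constant is left existential here; the root obtained from the initial form of f^l
  determines it in the end.\<close>

lemma linear_in_J:
  assumes I: "I \<subseteq> weyl_alg n" and IP: "\<And>P. P \<in> weyl_alg n \<Longrightarrow> app (op P) (toF q) = 0 \<Longrightarrow> P \<in> I"
    and q: "q \<in> polys n" "q \<noteq> (\<lambda>_. 0)" and w: "\<exists>i<n. w i \<noteq> 0"
  shows "\<exists>c. [:- c, 1:] \<in> bideal n w I"
proof -
  obtain t where t: "q \<in> pbox t" using polys_pbox[OF q(1)] .
  have fin: "finite (supp q)" by (rule polysD(1)[OF q(1)])
  have ne: "supp q \<noteq> {}" using q(2) by (auto simp: supp_def fun_eq_iff)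
  define c where "c = Min (wt w ` supp q)"
  have "c \<in> wt w ` supp q" unfolding c_def using fin ne by simp
  then obtain \<alpha> where \<alpha>: "\<alpha> \<in> supp q" "wt w \<alpha> = c" by auto
  have c_le: "c \<le> wt w \<gamma>" if "\<gamma> \<in> supp q" for \<gamma> unfolding c_def using fin that by simp
  have \<alpha>box: "\<alpha> \<in> Box n t" and q\<alpha>: "q \<alpha> \<noteq> 0" using t \<alpha> by (auto simp: pbox_def supp_def)

  define G where "G = {\<gamma> \<in> supp q. wt w \<gamma> \<noteq> c}"
  define T where "T = G \<times> Box n t"
  \<comment> \<open>The weight of \<open>h (\<gamma>, b)\<close> is
    \<open>wt w \<alpha> - wt w \<gamma>\<close> for every \<open>b\<close>, which is negative on
    \<open>T\<close> because \<alpha> has least weight.\<close>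
  define h :: "mi \<times> mi \<Rightarrow> mi \<times> mi" where "h j = (\<lambda>i. fst j i + snd j i, \<lambda>i. \<alpha> i + snd j i)" for j
  \<comment> \<open>\<open>wt w \<gamma> - c\<close> is the eigenvalue of s - c on x^\<gamma>; the
    sign makes the correction cancel that term, and dividing by \<open>q \<alpha>\<close>
    compensates for the value that coefficient extraction produces.\<close>
  define v0 :: "mi \<Rightarrow> complex" where "v0 \<gamma> = - q \<gamma> * of_real (wt w \<gamma> - c) / q \<alpha>" for \<gamma>
  define v1 :: "mi \<Rightarrow> complex" where "v1 b = (\<Prod>i<n. (- 1) ^ b i / (fact (\<alpha> i) * fact (b i)))" for b
  define R :: weyl where "R = (\<lambda>m. \<Sum>j\<in>T. if h j = m then v0 (fst j) * v1 (snd j) else 0)"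
  define K :: weyl where "K = (\<lambda>m. \<Sum>j\<in>{()}. if (\<lambda>_. 0, \<lambda>_. 0) = m then - of_real c else 0)"
  define E where "E = wadd (euler n w) K"

  have finT: "finite T" unfolding T_def G_def using fin finite_Box by simp
  have Rsub: "supp R \<subseteq> h ` T" unfolding R_def by (rule supp_collect)
  have hj: "mi_ok n (fst (h j)) \<and> mi_ok n (snd (h j)) \<and> weight n w (h j) < 0" if "j \<in> T" for j
  proof -
    have "fst j \<in> supp q" "wt w (fst j) \<noteq> c" "snd j \<in> Box n t" using that by (auto simp: T_def G_def)
    thus ?thesis using c_le[of "fst j"] \<alpha>(2) polysD(2)[OF q(1)] \<alpha>(1)
      by (auto simp: h_def mi_ok_def Box_def weight_wt wt_add)
  qed
  have Rfin: "finite (supp R)" using Rsub finT finite_surj by blast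
  have RW: "R \<in> weyl_alg n"
  proof -
    have "mi_ok n a \<and> mi_ok n b" if "R (a, b) \<noteq> 0" for a b
    proof -
      have "(a, b) \<in> h ` T" using Rsub that by (auto simp: supp_def)
      then obtain j where "j \<in> T" "(a, b) = h j" by (rule imageE)
      thus ?thesis using hj[of j] by (metis fst_conv snd_conv)
    qed
    thus ?thesis using Rfin by (simp add: weyl_alg_def)
  qed
  have Ksub: "supp K \<subseteq> {(\<lambda>_. 0, \<lambda>_. 0)}" unfolding K_def by (auto simp: supp_def split: if_splits)
  have KW: "K \<in> weyl_alg n"
    using finite_subset[OF Ksub] by (auto simp: weyl_alg_def K_def mi_ok_def split: if_splits)
  have opK: "op K = kk (- of_real c)" unfolding K_def by (subst op_collect) (auto simp: M_0)
  have EW: "E \<in> weyl_alg n" unfolding E_def by (rule wadd_in_weyl_alg[OF euler_in_weyl_alg KW])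
  have opE: "op E = evS w [:- of_real c, 1:]"
    unfolding E_def op_wadd[OF weyl_algD(1)[OF euler_in_weyl_alg] weyl_algD(1)[OF KW]]
    by (simp add: opK evS_pCons S_def)
  have Ewt: "weight n w m = 0" if "m \<in> supp E" for m
  proof -
    have "fst m = snd m"
    proof (rule ccontr)
      assume ne: "fst m \<noteq> snd m"
      hence "m \<noteq> (a, a)" for a by auto
      hence "euler n w m = 0" "K m = 0" by (auto simp: euler_def K_def)
      thus False using that by (simp add: E_def wadd_def supp_def)
    qed
    thus ?thesis by (simp add: weight_def)
  qed
  \<comment> \<open>The coefficient of x_i D_i is \<open>w i\<close>, so a nonzero weight vector
    keeps s - c from being the zero operator, whatever \<open>c\<close> is.\<close>
  have Enz: "E \<noteq> wzero"
  proof
    obtain i where i: "i < n" "w i \<noteq> 0" using w by blast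
    assume "E = wzero"
    hence z: "euler n w (unitv i, unitv i) + K (unitv i, unitv i) = 0"
      by (simp add: E_def wadd_def wzero_def fun_eq_iff)
    have "(\<lambda>_. 0) \<noteq> unitv i" by (metis unitv_simps(1) zero_neq_one)
    hence "K (unitv i, unitv i) = 0" by (simp add: K_def)
    moreover have "euler n w (unitv i, unitv i) = (\<Sum>j<n. if j = i then complex_of_real (w i) else 0)"
      unfolding euler_def by (intro sum.cong) (auto simp: unitv_inject)
    ultimately show False using z i by simp
  qed
  have Rwt: "weight n w m < 0" if m: "m \<in> supp R" for m
  proof -
    obtain j where "j \<in> T" "m = h j" using m Rsub by blast
    thus ?thesis using hj[of j] by simp
  qed
  note ini = in_w_wadd[OF weyl_algD(1)[OF EW] Rfin Enz Ewt Rwt]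

  have "app (op R) (toF q) = (\<Sum>j\<in>T. \<kappa> (v0 (fst j) * v1 (snd j)) * app (M (h j)) (toF q))"
    unfolding R_def op_collect[OF finT] by (simp add: app_sum_left)
  also have "\<dots> = (\<Sum>\<gamma>\<in>G. \<Sum>b\<in>Box n t. \<kappa> (v0 \<gamma>) *
      (\<kappa> (v1 b) * app (M (\<lambda>i. \<gamma> i + b i, \<lambda>i. \<alpha> i + b i)) (toF q)))"
    unfolding T_def sum.cartesian_product by (intro sum.cong) (auto simp: h_def \<kappa>_mult mult.assoc)
  also have "\<dots> = (\<Sum>\<gamma>\<in>G. \<kappa> (v0 \<gamma>) * (\<kappa> (q \<alpha>) * xm \<gamma>))"
    unfolding sum_distrib_left[symmetric] v1_def coefficient_extraction[OF t \<alpha>box] ..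
  also have "\<dots> = (\<Sum>\<gamma>\<in>G. - (\<kappa> (q \<gamma> * of_real (wt w \<gamma> - c)) * xm \<gamma>))"
  proof (intro sum.cong refl)
    fix \<gamma>
    have "v0 \<gamma> * q \<alpha> = - (q \<gamma> * of_real (wt w \<gamma> - c))" using q\<alpha> by (simp add: v0_def)
    thus "\<kappa> (v0 \<gamma>) * (\<kappa> (q \<alpha>) * xm \<gamma>) = - (\<kappa> (q \<gamma> * of_real (wt w \<gamma> - c)) * xm \<gamma>)"
      by (simp only: mult.assoc[symmetric] \<kappa>_mult[symmetric]) (simp add: \<kappa>_uminus)
  qed
  also have "\<dots> = - (\<Sum>\<gamma>\<in>supp q. \<kappa> (q \<gamma> * of_real (wt w \<gamma> - c)) * xm \<gamma>)"
    unfolding sum_negf by (rule arg_cong[where f = uminus], rule sum.mono_neutral_left)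
      (use fin in \<open>auto simp: G_def\<close>)
  also have "(\<Sum>\<gamma>\<in>supp q. \<kappa> (q \<gamma> * of_real (wt w \<gamma> - c)) * xm \<gamma>) = app (op E) (toF q)"
  proof -
    have "app (op E) (toF q) = app (S w) (toF q) - \<kappa> (of_real c) * toF q"
      by (simp add: opE evS_pCons \<kappa>_uminus)
    thus ?thesis unfolding app_S_toF[OF q(1)]
      by (simp add: toF_def sum_distrib_left sum_subtractf[symmetric] \<kappa>_mult \<kappa>_diff algebra_simps)
  qed
  finally have "app (op (wadd E R)) (toF q) = 0"
    by (simp add: op_wadd weyl_algD(1)[OF EW] Rfin)
  hence "wadd E R \<in> I" by (intro IP wadd_in_weyl_alg EW RW)
  from J_generator[OF I this ini(2) kk_in_W[of 1], of w]
  have "op E \<in> J w I" by (simp add: ini(1))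
  hence "[:- of_real c, 1:] \<in> bideal n w I" using opE bideal_iff[OF I] by simp
  thus ?thesis by blast
qed

end

theorem mainTheorem3:
  fixes n :: nat and f :: mpoly and l :: int and w :: "nat \<Rightarrow> real"
  assumes "f \<in> polys n" and "f \<noteq> (\<lambda>_. 0)"
    and "\<exists>i<n. w i \<noteq> 0"
    and "in_ideal n w (Ann n f l) \<noteq> weyl_alg n"
  shows "poly (bfun n w (Ann n f l)) (complex_of_real (of_int l * ord_f n f w)) = 0
    \<and> (l \<ge> 0 \<longrightarrow> bfun n w (Ann n f l) = [:- complex_of_real (of_int l * ord_f n f w), 1:])"
proof -
  interpret F: diff_field n mv_const mv_var "\<lambda>i. fract_deriv (mv_deriv i)"
    by (rule diff_field_mvpoly)
  let ?I = "Ann n f l" and ?c = "complex_of_real (of_int l * ord_f n f w)"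
  have I: "?I \<subseteq> weyl_alg n" by (auto simp: Ann_def)
  obtain u0 where u0: "F.lead w (ord_f n f w) (F.toF f) u0" "u0 \<noteq> 0"
    using F.lead_toF[OF assms(1,2)] unfolding F.ord_f_eq_Min[OF assms(1,2)] by blast
  have root: "poly p ?c = 0" if "p \<in> bideal n w ?I" for p
    by (rule F.bideal_Ann_root[OF assms(1,2) u0 that])
  show ?thesis
  proof (cases "l \<ge> 0")
    case True
    define q where "q = fst (fpow f l)"
    have q: "q \<in> polys n" unfolding q_def by (rule F.fpow_polys[OF assms(1)])
    have val: "F.val f (fpow f l) = F.toF q" using True by (simp add: F.val_def q_def fpow_def)
    have "F.toF f \<noteq> 0" using F.toF_eq_0[OF assms(1)] assms(2) by blast
    hence "F.zpow (F.toF f) l \<noteq> 0" by (simp add: F.zpow_def)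
    hence "F.toF q \<noteq> 0" using F.val_fpow[OF assms(1)] val by metis
    hence qnz: "q \<noteq> (\<lambda>_. 0)" by (auto simp: F.toF_def supp_def)
    have "P \<in> ?I" if "P \<in> weyl_alg n" "app (F.op P) (F.toF q) = 0" for P
      using that F.Ann_iff[OF assms(1,2)] val by simp
    then obtain c where c: "[:- c, 1:] \<in> bideal n w ?I"
      using F.linear_in_J[OF I _ q qnz assms(3)] by blast
    \<comment> \<open>Every member of \<open>bideal\<close> vanishes at \<open>?c\<close>, which
      pins down the constant of the linear one.\<close>
    from root[OF c] have "c = ?c" by simp
    hence "bfun n w ?I = [:- ?c, 1:]" using F.bfun_linear[OF I _ root] c by blast
    thus ?thesis by simp
  next
    case False
    obtain B where B: "f \<in> F.pbox B" using F.polys_pbox[OF assms(1)] .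
    have "0 < n" using assms(3) by auto
    \<comment> \<open>The growth constant is \<open>B + 1\<close> because the numerators in
      \<open>Ann_growth\<close> have degree at most \<open>(B + 1) * N\<close> when \<open>f\<close>
      has degree at most \<open>B\<close> in each variable.\<close>
    then obtain p where "p \<noteq> 0" "p \<in> bideal n w ?I"
      using F.bideal_nonzero[OF I, of "B + 1"] F.Ann_growth[OF B assms(2)] False by force
    thus ?thesis using F.bfun_root[OF I _ _ root] False by auto
  qed
qed

end
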